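(* Let $M$ be an $n$-dimensional Riemannian manifold and let $c\in(-(n+1)\pi/2,(n+1)\pi/2)$. Equip $\mathbb{R}\times M$ with the product metric and let $t$ be the coordinate on $\mathbb{R}$. Then the degenerate special Lagrangian subequation $\{A\in\mathrm{Sym}^2(\mathbb{R}^{n+1}):\widetilde\Theta(A)\ge c\}$ carries over to a global subequation on $\mathbb{R}\times M$: for a 2-jet $J=J^2_pu$ at $p\in\mathbb{R}\times M$, the condition $$\widetilde\Theta\big((\mathrm{Hess}_p u)(\bar e,\bar e)\big)\ge c,\qquad \bar e=(\partial_t,e_1,\dots,e_n),$$ is independent of the choice of local orthonormal frame $e=(e_1,\dots,e_n)$ of $TM$ near the projection of $p$ to $M$, and the resulting well-defined subset $\mathcal{F}_c\subset J^2(\mathbb{R}\times M)$ is a subequation on $\mathbb{R}\times M$.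
   Context: **Jets and subequations.** For a Riemannian manifold $\mathcal M$, $J^2(\mathcal M)$ is the second-order jet bundle (fibre at $x$: germs of smooth functions at $x$ modulo germs vanishing to order 3). With the Riemannian Hessian $(\mathrm{Hess}\,u)(V,W)=V(Wu)-(\nabla_VW)u$ it is identified with $\mathbb{R}\oplus T^*\mathcal M\oplus\mathrm{Sym}^2(T^*\mathcal M)$ via $J^2_xu\mapsto(u(x),(du)_x,\mathrm{Hess}_xu)$. For a local frame $e=(e_1,\dots,e_m)$, $(\mathrm{Hess}\,u)(e,e)$ is the symmetric matrix with entries $(\mathrm{Hess}\,u)(e_i,e_j)$. A *subequation* on $\mathcal M$ is a subset $F\subset J^2(\mathcal M)$ (fibres $F_x$) satisfying: (P) $F+P\subset F$, where $P_x=\{(0,0,A):A\ge0\}$; (N) $F+N\subset F$, where $N_x=\{(r,0,0):r\le 0\}$; (T) $F=\overline{\mathrm{Int}\,F}$, $F_x=\overline{\mathrm{Int}\,F_x}$ and $\mathrm{Int}\,F_x=(\mathrm{Int}\,F)_x$ for all $x$. **The function $\widetilde\Theta$.** Let $I_n=\mathrm{diag}(0,1,\dots,1)$ be $(n+1)\times(n+1)$, and let $\mathcal S\subset\mathrm{Sym}^2(\mathbb{R}^{n+1})$ be the set of matrices whose first row and column vanish, i.e. $A=\mathrm{diag}(0,B)$ with $B\in\mathrm{Sym}^2(\mathbb{R}^n)$. For $A\in\mathrm{Sym}^2(\mathbb{R}^{n+1})\setminus\mathcal S$ put $\widehat\Theta(A)=\sum_{\lambda\in\mathrm{spec}(I_n+\sqrt{-1}A)}m(\lambda)\arg(\lambda)$,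 with $m(\lambda)$ the multiplicity as a root of the characteristic polynomial and $\arg$ valued in $(-\pi,\pi]$. $\widetilde\Theta$ is the minimal upper semicontinuous extension of $\widehat\Theta$ to $\mathrm{Sym}^2(\mathbb{R}^{n+1})$; explicitly $\widetilde\Theta(\mathrm{diag}(0,B))=\frac{\pi}{2}+\mathrm{tr}\tan^{-1}(B)$ on $\mathcal S$. It is known (Rubinstein–Solomon) that $\{A:\widetilde\Theta(A)\ge c\}$ is a Euclidean subequation for the degenerate special Lagrangian equation of phase $\theta\equiv c \bmod 2\pi$ on $\mathbb{R}^{n+1}$. *)

theory Defs
  imports "HOL-Analysis.Analysis" "HOL-Computational_Algebra.Polynomial"
begin

section \<open>Smooth manifolds\<close>

text \<open>\<open>C\<^sup>k\<close> on an open subset of a finite-dimensional space.\<close>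

primrec Ck_on :: "nat \<Rightarrow> 'a::real_normed_vector set \<Rightarrow> ('a \<Rightarrow> 'b::real_normed_vector) \<Rightarrow> bool" where
  "Ck_on 0 S f \<longleftrightarrow> continuous_on S f"
| "Ck_on (Suc k) S f \<longleftrightarrow>
     (\<forall>x\<in>S. f differentiable (at x)) \<and>
     (\<forall>v. Ck_on k S (\<lambda>x. frechet_derivative f (at x) v))"

definition smooth_on :: "'a::real_normed_vector set \<Rightarrow> ('a \<Rightarrow> 'b::real_normed_vector) \<Rightarrow> bool" where
  "smooth_on S f \<longleftrightarrow> (\<forall>k. Ck_on k S f)"

text \<open>A chart is a domain together with a coordinate map, whose values outside the domain are
  irrelevant.  A smooth manifold of dimension \<open>CARD('k)\<close> is a second countable Hausdorff space
  \<open>'m\<close> with an atlas, which is not required to be maximal.\<close>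

type_synonym ('m, 'k) chart = "'m set \<times> ('m \<Rightarrow> real ^ 'k)"

definition smooth_atlas ::
    "('m::{t2_space,second_countable_topology}, 'k::finite) chart set \<Rightarrow> bool" where
  "smooth_atlas A \<longleftrightarrow>
     (\<forall>(U, \<phi>)\<in>A. open U \<and> open (\<phi> ` U) \<and> homeomorphism U (\<phi> ` U) \<phi> (inv_into U \<phi>)) \<and>
     (\<Union>(U, \<phi>)\<in>A. U) = UNIV \<and>
     (\<forall>(U, \<phi>)\<in>A. \<forall>(V, \<psi>)\<in>A. smooth_on (\<phi> ` (U \<inter> V)) (\<psi> \<circ> inv_into U \<phi>))"

text \<open>Smoothness of a real function on an open set \<open>W\<close>, and of its germ at \<open>x\<close>.\<close>

definition smooth_fun_on ::
    "('m::topological_space, 'k::finite) chart set \<Rightarrow> 'm set \<Rightarrow> ('m \<Rightarrow> real) \<Rightarrow> bool" where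
  "smooth_fun_on A W f \<longleftrightarrow> (\<forall>(U, \<phi>)\<in>A. smooth_on (\<phi> ` (U \<inter> W)) (f \<circ> inv_into U \<phi>))"

definition smooth_near ::
    "('m::topological_space, 'k::finite) chart set \<Rightarrow> 'm \<Rightarrow> ('m \<Rightarrow> real) \<Rightarrow> bool" where
  "smooth_near A x f \<longleftrightarrow> (\<exists>W. open W \<and> x \<in> W \<and> smooth_fun_on A W f)"

section \<open>Tangent vectors and vector fields\<close>

text \<open>Tangent vectors at \<open>x\<close> are the derivations of the algebra of germs of smooth functions
  at \<open>x\<close>.  They are extended by \<open>0\<close> to functions that are not smooth near \<open>x\<close>, so that distinct
  HOL functions represent distinct tangent vectors.\<close>

type_synonym 'm tangent = "('m \<Rightarrow> real) \<Rightarrow> real"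
type_synonym 'm field = "'m \<Rightarrow> 'm tangent"

definition tangent_space ::
    "('m::topological_space, 'k::finite) chart set \<Rightarrow> 'm \<Rightarrow> 'm tangent set" where
  "tangent_space A x = {X.
     (\<forall>f h a b. smooth_near A x f \<longrightarrow> smooth_near A x h \<longrightarrow>
        X (\<lambda>y. a * f y + b * h y) = a * X f + b * X h) \<and>
     (\<forall>f h. smooth_near A x f \<longrightarrow> smooth_near A x h \<longrightarrow>
        X (\<lambda>y. f y * h y) = f x * X h + h x * X f) \<and>
     (\<forall>f h. smooth_near A x f \<longrightarrow> smooth_near A x h \<longrightarrow> eventually (\<lambda>y. f y = h y) (nhds x) \<longrightarrow>
        X f = X h) \<and>
     (\<forall>f. \<not> smooth_near A x f \<longrightarrow> X f = 0)}"

definition vector_field_on ::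
    "('m::topological_space, 'k::finite) chart set \<Rightarrow> 'm set \<Rightarrow> 'm field \<Rightarrow> bool" where
  "vector_field_on A W V \<longleftrightarrow>
     (\<forall>x\<in>W. V x \<in> tangent_space A x) \<and>
     (\<forall>f W'. open W' \<longrightarrow> W' \<subseteq> W \<longrightarrow> smooth_fun_on A W' f \<longrightarrow> smooth_fun_on A W' (\<lambda>x. V x f))"

section \<open>Riemannian metrics, the Levi-Civita connection and the Hessian\<close>

type_synonym 'm metric = "'m \<Rightarrow> 'm tangent \<Rightarrow> 'm tangent \<Rightarrow> real"

definition riemannian_metric ::
    "('m::topological_space, 'k::finite) chart set \<Rightarrow> 'm metric \<Rightarrow> bool" where
  "riemannian_metric A g \<longleftrightarrow>
     (\<forall>x. \<forall>X\<in>tangent_space A x. \<forall>Y\<in>tangent_space A x.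
        g x X Y = g x Y X \<and>
        (X \<noteq> (\<lambda>f. 0) \<longrightarrow> g x X X > 0) \<and>
        (\<forall>Z\<in>tangent_space A x. \<forall>a b.
           g x (\<lambda>f. a * X f + b * Y f) Z = a * g x X Z + b * g x Y Z)) \<and>
     (\<forall>W V V'. open W \<longrightarrow> vector_field_on A W V \<longrightarrow> vector_field_on A W V' \<longrightarrow>
        smooth_fun_on A W (\<lambda>x. g x (V x) (V' x)))"

definition riemannian_manifold ::
    "('m::{t2_space,second_countable_topology}, 'k::finite) chart set \<Rightarrow> 'm metric \<Rightarrow> bool" where
  "riemannian_manifold A g \<longleftrightarrow> smooth_atlas A \<and> riemannian_metric A g"

text \<open>\<open>D V W\<close> stands for \<open>\<nabla>\<^sub>V W\<close>.  The conditions are additivity and linearity over functions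
  in \<open>V\<close>, additivity and the Leibniz rule in \<open>W\<close>, vanishing torsion, and compatibility
  with \<open>g\<close>.\<close>

definition levi_civita_connection ::
    "('m::topological_space, 'k::finite) chart set \<Rightarrow> 'm metric \<Rightarrow>
     ('m field \<Rightarrow> 'm field \<Rightarrow> 'm field) \<Rightarrow> bool" where
  "levi_civita_connection A g D \<longleftrightarrow>
     (\<forall>U V V' W f. open U \<longrightarrow> vector_field_on A U V \<longrightarrow> vector_field_on A U V' \<longrightarrow>
        vector_field_on A U W \<longrightarrow> smooth_fun_on A U f \<longrightarrow>
        vector_field_on A U (D V W) \<and>
        (\<forall>x\<in>U.
           D (\<lambda>y h. V y h + V' y h) W x = (\<lambda>h. D V W x h + D V' W x h) \<and>
           D (\<lambda>y h. f y * V y h) W x = (\<lambda>h. f x * D V W x h) \<and>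
           D W (\<lambda>y h. V y h + V' y h) x = (\<lambda>h. D W V x h + D W V' x h) \<and>
           D V (\<lambda>y h. f y * W y h) x = (\<lambda>h. f x * D V W x h + V x f * W x h) \<and>
           (\<forall>h. smooth_near A x h \<longrightarrow>
              D V W x h - D W V x h = V x (\<lambda>y. W y h) - W x (\<lambda>y. V y h)) \<and>
           V x (\<lambda>y. g y (V' y) (W y)) = g x (D V V' x) (W x) + g x (V' x) (D V W x)))"

text \<open>On a Riemannian manifold such a connection exists, and its values at smooth vector fields
  are uniquely determined.\<close>

definition levi_civita ::
    "('m::topological_space, 'k::finite) chart set \<Rightarrow> 'm metric \<Rightarrow> 'm field \<Rightarrow> 'm field \<Rightarrow> 'm field" where
  "levi_civita A g = (SOME D. levi_civita_connection A g D)"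

definition Hess ::
    "('m::topological_space, 'k::finite) chart set \<Rightarrow> 'm metric \<Rightarrow> ('m \<Rightarrow> real) \<Rightarrow> 'm \<Rightarrow>
     'm field \<Rightarrow> 'm field \<Rightarrow> real" where
  "Hess A g u x V W = V x (\<lambda>y. W y u) - levi_civita A g V W x u"

section \<open>The bundle of 2-jets\<close>

definition pd :: "'k::finite \<Rightarrow> (real ^ 'k \<Rightarrow> real) \<Rightarrow> real ^ 'k \<Rightarrow> real" where
  "pd i F a = frechet_derivative F (at a) (axis i 1)"

text \<open>Value, gradient and matrix of second partial derivatives of \<open>u\<close> in the chart
  \<open>(U, \<phi>)\<close>.\<close>

definition jet_coords ::
    "('m, 'k::finite) chart \<Rightarrow> 'm \<Rightarrow> ('m \<Rightarrow> real) \<Rightarrow> real \<times> (real ^ 'k) \<times> (real ^ 'k ^ 'k)" where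
  "jet_coords = (\<lambda>(U, \<phi>) x u.
     let F = u \<circ> inv_into U \<phi> in
       (u x, (\<chi> i. pd i F (\<phi> x)), (\<chi> i j. pd i (pd j F) (\<phi> x))))"

definition vanishes_to_order_3 ::
    "('m::topological_space, 'k::finite) chart set \<Rightarrow> 'm \<Rightarrow> ('m \<Rightarrow> real) \<Rightarrow> bool" where
  "vanishes_to_order_3 A x f \<longleftrightarrow> (\<forall>(U, \<phi>)\<in>A. x \<in> U \<longrightarrow> jet_coords (U, \<phi>) x f = 0)"

text \<open>A 2-jet is its base point together with the class of all functions, smooth near that point,
  that represent it.\<close>

type_synonym 'm jet = "'m \<times> ('m \<Rightarrow> real) set"

definition jet2 ::
    "('m::topological_space, 'k::finite) chart set \<Rightarrow> 'm \<Rightarrow> ('m \<Rightarrow> real) \<Rightarrow> 'm jet" where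
  "jet2 A x u = (x, {v. smooth_near A x v \<and> vanishes_to_order_3 A x (\<lambda>y. v y - u y)})"

definition J2 :: "('m::topological_space, 'k::finite) chart set \<Rightarrow> 'm jet set" where
  "J2 A = {jet2 A x u |x u. smooth_near A x u}"

definition jet_fibre :: "'m jet set \<Rightarrow> 'm \<Rightarrow> 'm jet set" where
  "jet_fibre F x = {j \<in> F. fst j = x}"

text \<open>The bundle topology: every chart \<open>(U, \<phi>)\<close> identifies the jets over \<open>U\<close> with the subset of
  \<open>\<phi>(U) \<times> \<real> \<times> \<real>\<^sup>k \<times> Mat\<^sub>k(\<real>)\<close> where the matrix is symmetric.\<close>

definition jet_topology ::
    "('m::topological_space, 'k::finite) chart set \<Rightarrow> 'm jet topology" where
  "jet_topology A = topology_generated_by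
     {{jet2 A x u |x u. x \<in> U \<and> smooth_near A x u \<and> (\<phi> x, jet_coords (U, \<phi>) x u) \<in> Q} |U \<phi> Q.
        (U, \<phi>) \<in> A \<and> open Q}"

definition jet_fibre_topology ::
    "('m::topological_space, 'k::finite) chart set \<Rightarrow> 'm \<Rightarrow> 'm jet topology" where
  "jet_fibre_topology A x = subtopology (jet_topology A) (jet_fibre (J2 A) x)"

section \<open>Subequations\<close>

text \<open>The sets \<open>P = {(0, 0, A) | A \<ge> 0}\<close> and \<open>N = {(r, 0, 0) | r \<le> 0}\<close>, in terms of the
  identification of the jet of \<open>u\<close> at \<open>x\<close> with the triple consisting of \<open>u x\<close>, the differential
  and the Riemannian Hessian of \<open>u\<close> at \<open>x\<close>.  Hessians are tested on vector fields
  defined near \<open>x\<close>.\<close>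

definition jet_P :: "('m::topological_space, 'k::finite) chart set \<Rightarrow> 'm metric \<Rightarrow> 'm jet set" where
  "jet_P A g = {jet2 A x u |x u. smooth_near A x u \<and> u x = 0 \<and>
     (\<forall>X\<in>tangent_space A x. X u = 0) \<and>
     (\<forall>W V. open W \<longrightarrow> x \<in> W \<longrightarrow> vector_field_on A W V \<longrightarrow> Hess A g u x V V \<ge> 0)}"

definition jet_N :: "('m::topological_space, 'k::finite) chart set \<Rightarrow> 'm metric \<Rightarrow> 'm jet set" where
  "jet_N A g = {jet2 A x u |x u. smooth_near A x u \<and> u x \<le> 0 \<and>
     (\<forall>X\<in>tangent_space A x. X u = 0) \<and>
     (\<forall>W V V'. open W \<longrightarrow> x \<in> W \<longrightarrow> vector_field_on A W V \<longrightarrow> vector_field_on A W V' \<longrightarrow>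
        Hess A g u x V V' = 0)}"

text \<open>Fibrewise sum of two sets of jets.\<close>

definition jet_sum ::
    "('m::topological_space, 'k::finite) chart set \<Rightarrow> 'm jet set \<Rightarrow> 'm jet set \<Rightarrow> 'm jet set" where
  "jet_sum A F G = {jet2 A x (\<lambda>y. u y + v y) |x u v. smooth_near A x u \<and> smooth_near A x v \<and>
     jet2 A x u \<in> F \<and> jet2 A x v \<in> G}"

definition subequation ::
    "('m::topological_space, 'k::finite) chart set \<Rightarrow> 'm metric \<Rightarrow> 'm jet set \<Rightarrow> bool" where
  "subequation A g F \<longleftrightarrow>
     F \<subseteq> J2 A \<and>
     jet_sum A F (jet_P A g) \<subseteq> F \<and>
     jet_sum A F (jet_N A g) \<subseteq> F \<and>
     F = jet_topology A closure_of (jet_topology A interior_of F) \<and>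
     (\<forall>x. jet_fibre F x =
        jet_fibre_topology A x closure_of (jet_fibre_topology A x interior_of jet_fibre F x)) \<and>
     (\<forall>x. jet_fibre_topology A x interior_of jet_fibre F x =
        jet_fibre (jet_topology A interior_of F) x)"

section \<open>The function \<open>\<Theta>\<close>\<close>

text \<open>Matrices of size \<open>n + 1\<close> are indexed by \<open>'n option\<close>, with \<open>None\<close> as the first index.\<close>

definition Sym :: "(real ^ 'k::finite ^ 'k) set" where
  "Sym = {A. transpose A = A}"

definition Sing :: "(real ^ 'n::finite option ^ 'n option) set" where
  "Sing = {A \<in> Sym. \<forall>k. A $ None $ k = 0 \<and> A $ k $ None = 0}"

definition I_plus_iA :: "real ^ 'n::finite option ^ 'n option \<Rightarrow> complex ^ 'n option ^ 'n option" where
  "I_plus_iA A = (\<chi> k l. (if k = l \<and> k \<noteq> None then 1 else 0) + \<i> * of_real (A $ k $ l))"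

definition charpoly :: "'a::comm_ring_1 ^ 'k::finite ^ 'k \<Rightarrow> 'a poly" where
  "charpoly M = det (\<chi> i j. (if i = j then [:0, 1:] else 0) - [:M $ i $ j:])"

definition Theta_hat :: "real ^ 'n::finite option ^ 'n option \<Rightarrow> real" where
  "Theta_hat A = (let p = charpoly (I_plus_iA A) in
     \<Sum>z | poly p z = 0. real (order z p) * Arg z)"

definition usc_on :: "'a::topological_space set \<Rightarrow> ('a \<Rightarrow> real) \<Rightarrow> bool" where
  "usc_on S f \<longleftrightarrow> (\<forall>a. openin (top_of_set S) {x \<in> S. f x < a})"

text \<open>The minimal upper semicontinuous extension from \<open>Sym - Sing\<close> to \<open>Sym\<close>.\<close>

definition Theta_tilde :: "real ^ 'n::finite option ^ 'n option \<Rightarrow> real" where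
  "Theta_tilde A = Inf {f A |f. usc_on Sym f \<and> (\<forall>B\<in>Sym - Sing. f B = Theta_hat B)}"

section \<open>The product \<open>\<real> \<times> M\<close>\<close>

definition product_atlas ::
    "('m::topological_space, 'n::finite) chart set \<Rightarrow> (real \<times> 'm, 'n option) chart set" where
  "product_atlas A =
     (\<lambda>(U, \<phi>). (UNIV \<times> U, \<lambda>(t, x). \<chi> k. case k of None \<Rightarrow> t | Some i \<Rightarrow> \<phi> x $ i)) ` A"

text \<open>\<open>X fst\<close> is \<open>dt(X)\<close>, and \<open>\<lambda>f. X (f \<circ> snd)\<close> is the push-forward of \<open>X\<close> to \<open>M\<close>.\<close>

definition product_metric :: "'m metric \<Rightarrow> (real \<times> 'm) metric" where
  "product_metric g = (\<lambda>(t, x) X Y.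
     X fst * Y fst + g x (\<lambda>f. X (f \<circ> snd)) (\<lambda>f. Y (f \<circ> snd)))"

definition orthonormal_frame_on ::
    "('m::topological_space, 'n::finite) chart set \<Rightarrow> 'm metric \<Rightarrow> 'm set \<Rightarrow> ('n \<Rightarrow> 'm field) \<Rightarrow> bool" where
  "orthonormal_frame_on A g W e \<longleftrightarrow>
     (\<forall>i. vector_field_on A W (e i)) \<and>
     (\<forall>x\<in>W. \<forall>i j. g x (e i x) (e j x) = (if i = j then 1 else 0))"

text \<open>The frame \<open>(\<partial>\<^sub>t, e\<^sub>1, \<dots>, e\<^sub>n)\<close> of \<open>\<real> \<times> M\<close>.\<close>

definition bar_frame ::
    "('m::topological_space, 'n::finite) chart set \<Rightarrow> ('n \<Rightarrow> 'm field) \<Rightarrow>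
     'n option \<Rightarrow> (real \<times> 'm) field" where
  "bar_frame A e k = (\<lambda>(t, x) u.
     if smooth_near (product_atlas A) (t, x) u then
       (case k of None \<Rightarrow> deriv (\<lambda>s. u (s, x)) t | Some i \<Rightarrow> e i x (\<lambda>y. u (t, y)))
     else 0)"

definition Hess_matrix ::
    "('m::topological_space, 'n::finite) chart set \<Rightarrow> 'm metric \<Rightarrow> ('n \<Rightarrow> 'm field) \<Rightarrow>
     (real \<times> 'm \<Rightarrow> real) \<Rightarrow> real \<times> 'm \<Rightarrow> real ^ 'n option ^ 'n option" where
  "Hess_matrix A g e u p =
     (\<chi> k l. Hess (product_atlas A) (product_metric g) u p (bar_frame A e k) (bar_frame A e l))"

text \<open>The set \<open>\<F>\<^sub>c\<close> of jets over \<open>\<real> \<times> M\<close>.\<close>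

definition DSL_subequation ::
    "('m::topological_space, 'n::finite) chart set \<Rightarrow> 'm metric \<Rightarrow> real \<Rightarrow> (real \<times> 'm) jet set" where
  "DSL_subequation A g c = {jet2 (product_atlas A) p u |p u.
     smooth_near (product_atlas A) p u \<and>
     (\<exists>W e. open W \<and> snd p \<in> W \<and> orthonormal_frame_on A g W e \<and>
        Theta_tilde (Hess_matrix A g e u p) \<ge> c)}"

end

theory Submission
  imports Defs "HOL-Computational_Algebra.Fundamental_Theorem_Algebra"
begin

text \<open>Perturbing \<open>I\<^sub>n + iA\<close> to \<open>I\<^sub>n + \<epsilon> E\<^sub>0\<^sub>0 + iA\<close> moves all eigenvalues into the open right half plane. The
  sum of their arguments is then a continuous argument of the determinant; along \<open>A + sP\<close> with
  \<open>P \<ge> 0\<close> the determinant is a polynomial in \<open>s\<close> whose roots lie in the upper half plane, so this argument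
  increases with \<open>s\<close>. Letting \<open>\<epsilon> \<rightarrow> 0\<close>, \<open>\<Theta>\<close> is monotone away from the singular set, and its minimal upper
  semicontinuous extension at \<open>A\<close> is the infimum of \<open>\<Theta>(A + \<delta>I)\<close> over \<open>\<delta> > 0\<close>. Hence \<open>{\<Theta> \<ge> c}\<close> is a closed
  set of symmetric matrices which is stable under adding positive semidefinite ones, and \<open>H + \<epsilon>I\<close> is an
  interior point for each of its elements \<open>H\<close>.

  On a Riemannian manifold the value, the derivatives along an orthonormal frame and the Hessian
  in that frame trivialize the 2-jet bundle locally, so that a closed, monotone set of
  matrices that is invariant under frame changes defines a subequation. Two frames of the form
  \<open>(\<partial>\<^sub>t, e)\<close> differ by \<open>diag(1, Q)\<close> with \<open>Q\<close> orthogonal, which does not change the eigenvalues of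
  \<open>I\<^sub>n + iA\<close>.\<close>

section \<open>Smooth functions on open sets of normed spaces\<close>

text \<open>The corner entry 0 of I_n is the obstacle. All eigenvalues of I_n + iA have nonnegative
  real part, and 0 is among them exactly when A is singular; only there can an argument jump. A
  segment from A to A + P may cross the singular set although its ends avoid it, so arguments cannot
  be followed along it without the perturbation.

  The infimum along A + \<delta>I has its origin in the order of matrices: each A + \<delta>I
  dominates a whole ball around A, so by monotonicity the upper limit of \<Theta> at A can be
  computed along this one ray.

  On the manifold, tangent vectors are derivations of germs and the connection is picked by a choice
  operator. Its existence must therefore be proved before the Hessian obeys any law, and its values
  must be shown to ignore what a field does outside the open set on which it is smooth. Moreover,
  jets are topologized through charts while the condition on them is stated in frames, so the
  passage between the two must be continuous in both directions.\<close>

lemma Ck_on_subset: "Ck_on k S f \<Longrightarrow> T \<subseteq> S \<Longrightarrow> Ck_on k T f"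
proof (induction k arbitrary: f)
  case 0
  then show ?case unfolding Ck_on.simps by (rule continuous_on_subset)
next
  case (Suc k)
  then show ?case unfolding Ck_on.simps by blast
qed

lemma Ck_on_cong:
  assumes "open S" "\<And>x. x \<in> S \<Longrightarrow> f x = g x" "Ck_on k S f"
  shows "Ck_on k S g"
  using assms(2,3)
proof (induction k arbitrary: f g)
  case 0
  then show ?case unfolding Ck_on.simps by (blast intro: continuous_on_eq)
next
  case (Suc k)
  have D: "(g has_derivative frechet_derivative f (at x)) (at x)" if x: "x \<in> S" for x
  proof -
    have f: "(f has_derivative frechet_derivative f (at x)) (at x)"
      using Suc.prems(2) x unfolding Ck_on.simps frechet_derivative_works by blast
    show ?thesis
      by (rule has_derivative_transform_within_open[OF f assms(1) x]) (rule Suc.prems(1))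
  qed
  show ?case
  proof (simp, intro conjI ballI allI)
    fix x assume "x \<in> S" then show "g differentiable at x" using D differentiableI by blast
  next
    fix v
    show "Ck_on k S (\<lambda>x. frechet_derivative g (at x) v)"
    proof (rule Suc.IH)
      show "Ck_on k S (\<lambda>x. frechet_derivative f (at x) v)" using Suc.prems(2) by simp
      show "frechet_derivative f (at x) v = frechet_derivative g (at x) v" if "x \<in> S" for x
        by (simp only: frechet_derivative_at[OF D[OF that]])
    qed
  qed
qed

lemma Ck_on_SucI:
  assumes "open S" "\<And>x. x \<in> S \<Longrightarrow> (f has_derivative f' x) (at x)"
    "\<And>v. Ck_on k S (\<lambda>x. f' x v)"
  shows "Ck_on (Suc k) S f"
proof (simp, intro conjI ballI allI)
  fix x assume "x \<in> S" then show "f differentiable at x" using assms(2) differentiableI by blast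
next
  fix v
  show "Ck_on k S (\<lambda>x. frechet_derivative f (at x) v)"
    by (rule Ck_on_cong[OF assms(1) _ assms(3)[of v]])
       (simp add: frechet_derivative_at[OF assms(2), symmetric])
qed

lemma Ck_on_SucD: "Ck_on (Suc k) S f \<Longrightarrow> x \<in> S \<Longrightarrow> (f has_derivative frechet_derivative f (at x)) (at x)"
  by (auto simp: frechet_derivative_works[symmetric])

lemma Ck_on_Suc_imp: "Ck_on (Suc k) S f \<Longrightarrow> Ck_on k S f"
proof (induction k arbitrary: f)
  case 0
  then show ?case
    by (auto intro!: continuous_at_imp_continuous_on differentiable_imp_continuous_within)
next
  case (Suc k)
  then show ?case by (metis Ck_on.simps(2))
qed

lemma Ck_on_imp_continuous_on: "Ck_on k S f \<Longrightarrow> continuous_on S f"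
  by (induction k) (use Ck_on_Suc_imp in \<open>auto simp del: Ck_on.simps(2)\<close>)

lemma Ck_on_const: "open S \<Longrightarrow> Ck_on k S (\<lambda>x. c)"
proof (induction k arbitrary: c)
  case (Suc k)
  then show ?case by (intro Ck_on_SucI[where f'="\<lambda>_ _. 0"]) auto
qed simp

lemma Ck_on_bounded_linear:
  assumes "open S" "bounded_linear L"
  shows "Ck_on k S L"
proof (cases k)
  case 0
  then show ?thesis using assms by (simp add: linear_continuous_on)
next
  case (Suc k)
  then show ?thesis using assms
    by (auto intro!: Ck_on_SucI[where f'="\<lambda>_. L"] bounded_linear_imp_has_derivative Ck_on_const simp del: Ck_on.simps)
qed

lemma Ck_on_add:
  assumes "open S" "Ck_on k S f" "Ck_on k S g"
  shows "Ck_on k S (\<lambda>x. f x + g x)"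
  using assms(2,3)
proof (induction k arbitrary: f g)
  case (Suc k)
  show ?case
    by (rule Ck_on_SucI[OF assms(1) has_derivative_add[OF Ck_on_SucD Ck_on_SucD]])
       (use Suc in auto)
qed (auto intro: continuous_intros)

lemma Ck_on_linear_compose:
  assumes "open S" "bounded_linear L" "Ck_on k S f"
  shows "Ck_on k S (\<lambda>x. L (f x))"
  using assms(3)
proof (induction k arbitrary: f)
  case 0
  then show ?case using assms(2) by (simp add: bounded_linear.continuous_on)
next
  case (Suc k)
  show ?case
    by (rule Ck_on_SucI[OF assms(1) bounded_linear.has_derivative[OF assms(2) Ck_on_SucD]])
       (use Suc in auto)
qed

lemma Ck_on_bilinear:
  assumes "open S" "bounded_bilinear B" "Ck_on k S f" "Ck_on k S g"
  shows "Ck_on k S (\<lambda>x. B (f x) (g x))"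
  using assms(3,4)
proof (induction k arbitrary: f g)
  case 0
  then show ?case using bounded_bilinear.continuous_on[OF assms(2)] by simp
next
  case (Suc k)
  show ?case
    by (rule Ck_on_SucI[OF assms(1) bounded_bilinear.FDERIV[OF assms(2) Ck_on_SucD Ck_on_SucD]])
       (use Suc Ck_on_Suc_imp[OF Suc.prems(1)] Ck_on_Suc_imp[OF Suc.prems(2)]
        in \<open>auto intro!: Ck_on_add assms(1)\<close>)
qed

lemma Ck_on_sum:
  assumes "open S" "\<And>i. i \<in> I \<Longrightarrow> Ck_on k S (f i)"
  shows "Ck_on k S (\<lambda>x. \<Sum>i\<in>I. f i x)"
  using assms(2)
  by (induction I rule: infinite_finite_induct) (auto intro: Ck_on_add Ck_on_const assms(1))

lemma Ck_on_local:
  assumes "\<And>x. x \<in> S \<Longrightarrow> \<exists>T. open T \<and> x \<in> T \<and> Ck_on k T f"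
  shows "Ck_on k S f"
  using assms
proof (induction k arbitrary: f)
  case 0
  show ?case
    by (simp, rule continuous_at_imp_continuous_on)
       (use 0 in \<open>force simp: continuous_on_eq_continuous_at\<close>)
next
  case (Suc k)
  show ?case
  proof (simp, intro conjI ballI allI)
    fix x assume "x \<in> S" then show "f differentiable at x" using Suc.prems[of x] by auto
  next
    fix v
    show "Ck_on k S (\<lambda>x. frechet_derivative f (at x) v)"
    proof (rule Suc.IH)
      fix x assume "x \<in> S"
      from Suc.prems[OF this] show "\<exists>T. open T \<and> x \<in> T \<and> Ck_on k T (\<lambda>x. frechet_derivative f (at x) v)"
        by auto
    qed
  qed
qed

text \<open>Since \<open>Ck_on\<close> speaks of derivatives in constant directions only, the
  varying direction \<open>frechet_derivative h (at x) v\<close> of the chain rule is expanded in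
  the basis. This leaves scalar coefficients times derivatives of \<open>f\<close> in fixed
  directions composed with \<open>h\<close>, to which the induction hypothesis applies.\<close>

lemma Ck_on_compose:
  fixes h :: "'a::real_normed_vector \<Rightarrow> 'b::euclidean_space"
  assumes "open S" "open T" "h ` S \<subseteq> T" "Ck_on k S h" "Ck_on k T f"
  shows "Ck_on k S (\<lambda>x. f (h x))"
  using assms(4,5)
proof (induction k arbitrary: f)
  case 0
  then show ?case using assms(3) by (auto intro: continuous_on_compose2)
next
  case (Suc k)
  show ?case
  proof (rule Ck_on_SucI[OF assms(1)])
    fix x assume x: "x \<in> S"
    then have "h x \<in> T" using assms(3) by auto
    have f: "(f has_derivative frechet_derivative f (at (h x))) (at (h x))"
      by (rule Ck_on_SucD[OF Suc.prems(2)]) fact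
    then interpret L: bounded_linear "frechet_derivative f (at (h x))"
      by (rule has_derivative_bounded_linear)
    have "((\<lambda>x. f (h x)) has_derivative (\<lambda>v. frechet_derivative f (at (h x)) (frechet_derivative h (at x) v))) (at x)"
      by (rule has_derivative_compose[OF Ck_on_SucD[OF Suc.prems(1) x] f])
    also have "(\<lambda>v. frechet_derivative f (at (h x)) (frechet_derivative h (at x) v)) =
       (\<lambda>v. \<Sum>b\<in>Basis. (frechet_derivative h (at x) v \<bullet> b) *\<^sub>R frechet_derivative f (at (h x)) b)"
      by (subst euclidean_representation[symmetric]) (simp only: L.sum L.scaleR)
    finally show "((\<lambda>x. f (h x)) has_derivative (\<lambda>v. \<Sum>b\<in>Basis. (frechet_derivative h (at x) v \<bullet> b) *\<^sub>R frechet_derivative f (at (h x)) b)) (at x)" .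
  next
    fix v
    show "Ck_on k S (\<lambda>x. \<Sum>b\<in>Basis. (frechet_derivative h (at x) v \<bullet> b) *\<^sub>R frechet_derivative f (at (h x)) b)"
      using Suc.prems
      by (intro Ck_on_sum Ck_on_bilinear[OF _ bounded_bilinear_scaleR] assms(1)
           Ck_on_linear_compose[OF _ bounded_linear_inner_left] Suc.IH Ck_on_Suc_imp[OF Suc.prems(1)]) auto
  qed
qed

lemma smooth_on_subset: "smooth_on S f \<Longrightarrow> T \<subseteq> S \<Longrightarrow> smooth_on T f"
  by (auto simp: smooth_on_def intro: Ck_on_subset)

lemma smooth_on_cong:
  "open S \<Longrightarrow> (\<And>x. x \<in> S \<Longrightarrow> f x = g x) \<Longrightarrow> smooth_on S f \<Longrightarrow> smooth_on S g"
  by (auto simp: smooth_on_def intro: Ck_on_cong)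

lemma smooth_on_local:
  "(\<And>x. x \<in> S \<Longrightarrow> \<exists>T. open T \<and> x \<in> T \<and> smooth_on T f) \<Longrightarrow> smooth_on S f"
  unfolding smooth_on_def by (intro allI Ck_on_local) metis

lemma smooth_on_const: "open S \<Longrightarrow> smooth_on S (\<lambda>x. c)"
  by (auto simp: smooth_on_def intro: Ck_on_const)

lemma smooth_on_bounded_linear: "open S \<Longrightarrow> bounded_linear L \<Longrightarrow> smooth_on S L"
  by (auto simp: smooth_on_def intro: Ck_on_bounded_linear)

lemma smooth_on_add: "open S \<Longrightarrow> smooth_on S f \<Longrightarrow> smooth_on S g \<Longrightarrow> smooth_on S (\<lambda>x. f x + g x)"
  by (auto simp: smooth_on_def intro: Ck_on_add)

lemma smooth_on_scaleR:
  "open S \<Longrightarrow> smooth_on S f \<Longrightarrow> smooth_on S g \<Longrightarrow> smooth_on S (\<lambda>x. f x *\<^sub>R g x)"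
  by (auto simp: smooth_on_def intro: Ck_on_bilinear[OF _ bounded_bilinear_scaleR])

lemma smooth_on_mult:
  fixes f g :: "'a::real_normed_vector \<Rightarrow> real"
  shows "open S \<Longrightarrow> smooth_on S f \<Longrightarrow> smooth_on S g \<Longrightarrow> smooth_on S (\<lambda>x. f x * g x)"
  by (auto simp: smooth_on_def intro: Ck_on_bilinear[OF _ bounded_bilinear_mult])

lemma smooth_on_sum:
  "open S \<Longrightarrow> (\<And>i. i \<in> I \<Longrightarrow> smooth_on S (f i)) \<Longrightarrow> smooth_on S (\<lambda>x. \<Sum>i\<in>I. f i x)"
  by (auto simp: smooth_on_def intro: Ck_on_sum)

lemma smooth_on_compose:
  fixes h :: "'a::real_normed_vector \<Rightarrow> 'b::euclidean_space"
  shows "open S \<Longrightarrow> open T \<Longrightarrow> h ` S \<subseteq> T \<Longrightarrow> smooth_on S h \<Longrightarrow> smooth_on T f \<Longrightarrow> smooth_on S (\<lambda>x. f (h x))"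
  by (auto simp: smooth_on_def intro: Ck_on_compose)

lemma smooth_on_frechet_derivative:
  "smooth_on S f \<Longrightarrow> smooth_on S (\<lambda>x. frechet_derivative f (at x) v)"
  unfolding smooth_on_def by (metis Ck_on.simps(2))

lemma smooth_on_has_derivative:
  "smooth_on S f \<Longrightarrow> x \<in> S \<Longrightarrow> (f has_derivative frechet_derivative f (at x)) (at x)"
  unfolding smooth_on_def by (metis Ck_on_SucD)

lemma smooth_on_imp_continuous_on: "smooth_on S f \<Longrightarrow> continuous_on S f"
  unfolding smooth_on_def by (metis Ck_on.simps(1))

lemma smooth_on_vec:
  fixes f :: "'a::real_normed_vector \<Rightarrow> real ^ 'k::finite"
  assumes "open S" "\<And>i. smooth_on S (\<lambda>x. f x $ i)"
  shows "smooth_on S f"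
proof -
  have "f = (\<lambda>x. \<Sum>i\<in>UNIV. f x $ i *\<^sub>R axis i 1)"
    by (auto simp: vec_eq_iff axis_def if_distrib[where f="\<lambda>y. _ * y"] cong: if_cong)
  moreover have "smooth_on S (\<lambda>x. \<Sum>i\<in>UNIV. f x $ i *\<^sub>R axis i (1::real))"
    using assms by (intro smooth_on_sum smooth_on_scaleR smooth_on_const) auto
  ultimately show ?thesis by simp
qed

lemma smooth_on_vec_nth:
  fixes f :: "'a::real_normed_vector \<Rightarrow> real ^ 'k::finite"
  shows "open S \<Longrightarrow> smooth_on S f \<Longrightarrow> smooth_on S (\<lambda>x. f x $ i)"
  unfolding smooth_on_def by (auto intro: Ck_on_linear_compose bounded_linear_vec_nth)

text \<open>The exponent -1/2 normalizes fields in \<open>gram_schmidt\<close>. All exponents are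
  treated together because each derivative lowers the exponent by one.\<close>

lemma smooth_on_powr: "smooth_on {0<..} (\<lambda>s::real. s powr p)"
proof -
  have "Ck_on k {0<..} (\<lambda>s::real. s powr p)" for k
  proof (induction k arbitrary: p)
    case 0
    then show ?case by (auto intro!: continuous_intros)
  next
    case (Suc k)
    show ?case
    proof (rule Ck_on_SucI)
      fix x :: real assume "x \<in> {0<..}"
      then have "((\<lambda>s. s powr p) has_real_derivative p * x powr (p - 1)) (at x)"
        by (auto intro!: has_real_derivative_powr)
      then show "((\<lambda>s. s powr p) has_derivative (\<lambda>v. (p * v) * x powr (p - 1))) (at x)"
        by (simp add: has_field_derivative_def mult_ac mult_commute_abs)
    qed (auto intro!: Ck_on_bilinear[OF _ bounded_bilinear_mult] Ck_on_const Suc)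
  qed
  then show ?thesis by (simp add: smooth_on_def)
qed

text \<open>Differentiation under the integral sign brings out one factor \<open>t\<close> by the
  chain rule. The weight \<open>t ^ m\<close> makes the statement stable under this, so that the
  induction on \<open>k\<close> closes.\<close>

lemma Ck_on_integral_ray:
  fixes F :: "'a::euclidean_space \<Rightarrow> real"
  assumes "Ck_on k (ball a r) F"
  shows "Ck_on k (ball a r) (\<lambda>x. integral (cbox 0 1) (\<lambda>t::real. t ^ m * F (a + t *\<^sub>R (x - a))))"
  using assms
proof (induction k arbitrary: F m)
  case (0 F m)
  have in_ball: "a + t *\<^sub>R (x - a) \<in> ball a r" if "x \<in> ball a r" "t \<in> cbox 0 1" for x t
  proof -
    have "\<bar>t\<bar> * norm (x - a) \<le> norm (x - a)" using that by (simp add: mult_left_le_one_le)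
    then show ?thesis using that by (simp add: dist_norm norm_minus_commute)
  qed
  show ?case
    unfolding Ck_on.simps
  proof (rule integral_continuous_on_param, unfold split_beta)
    show "continuous_on (ball a r \<times> cbox 0 1) (\<lambda>p. snd p ^ m * F (a + snd p *\<^sub>R (fst p - a)))"
      using 0 in_ball
      by (intro continuous_intros continuous_on_compose2[where f="\<lambda>p. a + snd p *\<^sub>R (fst p - a)" and g=F and t="ball a r"]) auto
  qed
next
  case (Suc k F m)
  have in_ball: "a + t *\<^sub>R (x - a) \<in> ball a r" if "x \<in> ball a r" "t \<in> cbox 0 1" for x t
  proof -
    have "\<bar>t\<bar> * norm (x - a) \<le> norm (x - a)" using that by (simp add: mult_left_le_one_le)
    then show ?thesis using that by (simp add: dist_norm norm_minus_commute)
  qed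
  let ?f = "\<lambda>x t. t ^ m * F (a + t *\<^sub>R (x - a))"
  \<comment> \<open>\<open>leibniz_rule\<close> wants the derivative as a continuous map into the
    bounded linear maps. In finite dimension this follows from continuity in each fixed direction,
    which is what \<open>Ck_on\<close> provides.\<close>
  define F' where "F' x = Blinfun (frechet_derivative F (at x))" for x
  have F': "blinfun_apply (F' x) = frechet_derivative F (at x)" if "x \<in> ball a r" for x
    unfolding F'_def using Ck_on_SucD[OF Suc.prems that]
    by (intro bounded_linear_Blinfun_apply has_derivative_bounded_linear)
  have C: "continuous_on (ball a r) (\<lambda>x. frechet_derivative F (at x) v)" for v
    using Suc.prems by (auto intro: Ck_on_imp_continuous_on)
  have cF': "continuous_on (ball a r) F'"
    by (rule continuous_on_blinfun_componentwise, rule continuous_on_eq[OF C]) (simp add: F')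
  have D: "((\<lambda>x. integral (cbox 0 1) (?f x)) has_derivative
      integral (cbox 0 1) (\<lambda>t. (t ^ Suc m) *\<^sub>R F' (a + t *\<^sub>R (x0 - a)))) (at x0 within ball a r)"
    if x0: "x0 \<in> ball a r" for x0
  proof (rule leibniz_rule[OF _ _ _ x0 convex_ball])
    fix x t assume xt: "x \<in> ball a r" "t \<in> cbox (0::real) 1"
    have "((\<lambda>x. F (a + t *\<^sub>R (x - a))) has_derivative (\<lambda>v. frechet_derivative F (at (a + t *\<^sub>R (x - a))) (t *\<^sub>R v))) (at x)"
      by (rule has_derivative_compose[where f="\<lambda>x. a + t *\<^sub>R (x - a)", OF _ Ck_on_SucD[OF Suc.prems in_ball[OF xt]]])
         (auto intro!: derivative_eq_intros)
    then have "((\<lambda>x. ?f x t) has_derivative (\<lambda>v. t ^ m * frechet_derivative F (at (a + t *\<^sub>R (x - a))) (t *\<^sub>R v))) (at x)"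
      by (rule has_derivative_mult_right)
    also have "(\<lambda>v. t ^ m * frechet_derivative F (at (a + t *\<^sub>R (x - a))) (t *\<^sub>R v)) = blinfun_apply ((t ^ Suc m) *\<^sub>R F' (a + t *\<^sub>R (x - a)))"
      by (rule ext) (simp add: F'[OF in_ball[OF xt], symmetric] blinfun.scaleR_left blinfun.scaleR_right)
    finally show "((\<lambda>x. ?f x t) has_derivative blinfun_apply ((t ^ Suc m) *\<^sub>R F' (a + t *\<^sub>R (x - a)))) (at x within ball a r)"
      by (rule has_derivative_at_withinI)
  next
    fix x assume "x \<in> ball a r"
    then show "?f x integrable_on cbox 0 1"
      using in_ball Ck_on_Suc_imp[OF Suc.prems]
      by (intro integrable_continuous continuous_intros continuous_on_compose2[where f="\<lambda>t. a + t *\<^sub>R (x - a)" and g=F and t="ball a r"])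
         (auto intro: continuous_at_imp_continuous_on Ck_on_SucD[OF Suc.prems, THEN has_derivative_continuous])
  next
    show "continuous_on (ball a r \<times> cbox 0 1) (\<lambda>(x, t). t ^ Suc m *\<^sub>R F' (a + t *\<^sub>R (x - a)))"
      unfolding split_beta
      using in_ball
      by (intro continuous_intros continuous_on_compose2[where f="\<lambda>p. a + snd p *\<^sub>R (fst p - a)" and g=F' and t="ball a r"] cF') auto
  qed
  show ?case
  proof (rule Ck_on_SucI)
    fix x assume x: "x \<in> ball a r"
    show "((\<lambda>x. integral (cbox 0 1) (?f x)) has_derivative
      integral (cbox 0 1) (\<lambda>t. (t ^ Suc m) *\<^sub>R F' (a + t *\<^sub>R (x - a)))) (at x)"
      using D[OF x] unfolding at_within_open[OF x open_ball] .
  next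
    fix v
    show "Ck_on k (ball a r) (\<lambda>x. integral (cbox 0 1) (\<lambda>t. (t ^ Suc m) *\<^sub>R F' (a + t *\<^sub>R (x - a))) v)"
    proof (rule Ck_on_cong[OF open_ball _ Suc.IH])
      show "Ck_on k (ball a r) (\<lambda>x. frechet_derivative F (at x) v)" using Suc.prems by simp
      fix x assume x: "x \<in> ball a r"
      have "(\<lambda>t. (t ^ Suc m) *\<^sub>R F' (a + t *\<^sub>R (x - a))) integrable_on cbox 0 1"
        using in_ball x
        by (intro integrable_continuous continuous_intros continuous_on_compose2[where f="\<lambda>t. a + t *\<^sub>R (x - a)" and g=F' and t="ball a r"] cF') auto
      then show "integral (cbox 0 1) (\<lambda>t. t ^ Suc m * frechet_derivative F (at (a + t *\<^sub>R (x - a))) v)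
        = blinfun_apply (integral (cbox 0 1) (\<lambda>t. (t ^ Suc m) *\<^sub>R F' (a + t *\<^sub>R (x - a)))) v"
        using in_ball[OF x]
        by (subst blinfun_apply_integral) (auto intro!: integral_cong simp: blinfun.scaleR_left F')
    qed
  qed simp
qed

text \<open>The fundamental theorem of calculus along the segment from \<open>a\<close> to
  \<open>x\<close>: \<open>h b\<close> is the mean of the derivative in direction \<open>b\<close>
  over that segment, hence smooth by \<open>Ck_on_integral_ray\<close>.\<close>

lemma hadamard:
  fixes f :: "'a::euclidean_space \<Rightarrow> real"
  assumes f: "smooth_on (ball a r) f" and r: "r > 0"
  obtains h where "\<And>b. smooth_on (ball a r) (h b)" "\<And>b. h b a = frechet_derivative f (at a) b"
    "\<And>x. x \<in> ball a r \<Longrightarrow> f x = f a + (\<Sum>b\<in>Basis. ((x - a) \<bullet> b) * h b x)"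
proof
  let ?h = "\<lambda>b x. integral (cbox 0 1) (\<lambda>t::real. frechet_derivative f (at (a + t *\<^sub>R (x - a))) b)"
  show "smooth_on (ball a r) (?h b)" for b
    unfolding smooth_on_def
  proof
    fix k
    show "Ck_on k (ball a r) (?h b)"
      using Ck_on_integral_ray[of k a r "\<lambda>x. frechet_derivative f (at x) b" 0]
        smooth_on_frechet_derivative[OF f, of b]
      by (simp add: smooth_on_def)
  qed
  show "?h b a = frechet_derivative f (at a) b" for b by simp
  fix x assume x: "x \<in> ball a r"
  have in_ball: "a + t *\<^sub>R (x - a) \<in> ball a r" if "t \<in> cbox 0 1" for t
  proof -
    have "\<bar>t\<bar> * norm (x - a) \<le> norm (x - a)" using that by (simp add: mult_left_le_one_le)
    then show ?thesis using that x by (simp add: dist_norm norm_minus_commute)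
  qed
  have D: "((\<lambda>t. f (a + t *\<^sub>R (x - a))) has_vector_derivative
       frechet_derivative f (at (a + t *\<^sub>R (x - a))) (x - a)) (at t within {0..1})" if t: "t \<in> {0..1}" for t
  proof -
    have F: "(f has_derivative frechet_derivative f (at (a + t *\<^sub>R (x - a)))) (at (a + t *\<^sub>R (x - a)))"
      using smooth_on_has_derivative[OF f] in_ball t by simp
    have "((\<lambda>t. f (a + t *\<^sub>R (x - a))) has_derivative (\<lambda>s. frechet_derivative f (at (a + t *\<^sub>R (x - a))) (s *\<^sub>R (x - a)))) (at t)"
      by (rule has_derivative_compose[where f="\<lambda>t. a + t *\<^sub>R (x - a)", OF _ F]) (auto intro!: derivative_eq_intros)
    then show ?thesis
      using has_derivative_bounded_linear[OF F]
      by (simp add: has_vector_derivative_def linear_simps has_derivative_at_withinI)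
  qed
  have L: "frechet_derivative f (at (a + t *\<^sub>R (x - a))) (x - a) =
     (\<Sum>b\<in>Basis. ((x - a) \<bullet> b) * frechet_derivative f (at (a + t *\<^sub>R (x - a))) b)" if "t \<in> {0..1}" for t
  proof -
    interpret L: bounded_linear "frechet_derivative f (at (a + t *\<^sub>R (x - a)))"
      using smooth_on_has_derivative[OF f] in_ball that has_derivative_bounded_linear by auto
    have "frechet_derivative f (at (a + t *\<^sub>R (x - a))) (\<Sum>b\<in>Basis. ((x - a) \<bullet> b) *\<^sub>R b) =
      (\<Sum>b\<in>Basis. ((x - a) \<bullet> b) * frechet_derivative f (at (a + t *\<^sub>R (x - a))) b)"
      by (simp only: L.sum L.scaleR real_scaleR_def)
    then show ?thesis by (simp only: euclidean_representation)
  qed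
  have I: "(\<lambda>t. frechet_derivative f (at (a + t *\<^sub>R (x - a))) b) integrable_on {0..1}" for b
    using in_ball smooth_on_imp_continuous_on[OF smooth_on_frechet_derivative[OF f]]
    by (intro integrable_continuous_real continuous_on_compose2[where f="\<lambda>t. a + t *\<^sub>R (x - a)"
       and g="\<lambda>x. frechet_derivative f (at x) b" and t="ball a r"]) (auto intro!: continuous_intros)
  have "((\<lambda>t. frechet_derivative f (at (a + t *\<^sub>R (x - a))) (x - a)) has_integral f x - f a) {0..1}"
    using fundamental_theorem_of_calculus[OF _ D] by simp
  then have "f x - f a = integral {0..1} (\<lambda>t. frechet_derivative f (at (a + t *\<^sub>R (x - a))) (x - a))"
    by (simp add: integral_unique)
  also have "\<dots> = integral {0..1} (\<lambda>t. \<Sum>b\<in>Basis. ((x - a) \<bullet> b) * frechet_derivative f (at (a + t *\<^sub>R (x - a))) b)"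
    by (rule integral_cong) (rule L)
  also have "\<dots> = (\<Sum>b\<in>Basis. ((x - a) \<bullet> b) * ?h b x)"
    using I by (subst integral_sum) (auto intro: integrable_on_mult_right)
  finally show "f x = f a + (\<Sum>b\<in>Basis. ((x - a) \<bullet> b) * ?h b x)" by simp
qed

section \<open>The arguments of the eigenvalues\<close>

lemma poly_det: "poly (det P) x = det (\<chi> i j. poly (P $ i $ j) x)"
  by (simp add: det_def poly_sum poly_prod of_int_poly[symmetric] del: of_int_poly)

lemma poly_charpoly: "poly (charpoly M) x = det (mat x - M)"
  unfolding charpoly_def poly_det
  by (rule arg_cong[where f=det]) (auto simp: vec_eq_iff mat_def)

text \<open>Only the identity permutation contributes degree \<open>CARD('k)\<close>: any other
  moves some index \<open>a\<close>, and the factor of row \<open>a\<close> is then an off-diagonal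
  constant.\<close>

lemma charpoly_monic:
  fixes M :: "complex ^ 'k::finite ^ 'k"
  shows "degree (charpoly M) = CARD('k)" "coeff (charpoly M) CARD('k) = 1"
proof -
  let ?P = "\<chi> i j. (if i = j then [:0, 1:] else 0) - [:M $ i $ j:]"
  let ?t = "\<lambda>p. of_int (sign p) * (\<Prod>i\<in>UNIV. ?P $ i $ p i)"
  have deg: "degree (?P $ i $ j) \<le> (if i = j then 1 else 0)" for i j by simp
  have off: "degree (?t p) < CARD('k)" if pid: "p \<noteq> id" for p :: "'k \<Rightarrow> 'k"
  proof -
    obtain a where a: "p a \<noteq> a" using pid by (auto simp: fun_eq_iff)
    have "degree (?t p) \<le> degree (\<Prod>i\<in>UNIV. ?P $ i $ p i)"
      using degree_mult_le[of "of_int (sign p)" "\<Prod>i\<in>UNIV. ?P $ i $ p i"] by simp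
    also have "\<dots> \<le> (\<Sum>i\<in>UNIV. degree (?P $ i $ p i))"
      using degree_prod_sum_le[of UNIV "\<lambda>i. ?P $ i $ p i"] by (simp add: o_def)
    also have "\<dots> \<le> (\<Sum>i\<in>UNIV. if i = a then 0 else 1)"
      by (rule sum_mono) (use a deg in auto)
    also have "\<dots> = card (UNIV - {a})" by (simp add: sum.If_cases Compl_eq_Diff_UNIV)
    also have "\<dots> < CARD('k)" by (intro psubset_card_mono) auto
    finally show ?thesis .
  qed
  define q where "q = (\<Sum>p\<in>{p. p permutes (UNIV::'k set)} - {id}. ?t p)"
  have fin: "finite {p. p permutes (UNIV::'k set)}" by (simp add: finite_permutations)
  have c: "charpoly M = (\<Prod>i\<in>UNIV. [:- M $ i $ i, 1:]) + q"
    unfolding charpoly_def det_def q_def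
    by (subst sum.remove[OF fin, of id]) (auto simp: permutes_id sign_id)
  have q: "degree q < CARD('k)"
    unfolding q_def by (rule degree_sum_less) (use off in auto)
  have l: "lead_coeff (\<Prod>i\<in>(UNIV::'k set). [:- M $ i $ i, 1:]) = 1"
    by (simp add: lead_coeff_prod)
  have d: "degree (\<Prod>i\<in>(UNIV::'k set). [:- M $ i $ i, 1:]) = CARD('k)"
    by (subst degree_prod_sum_eq) auto
  show "degree (charpoly M) = CARD('k)" unfolding c using d q by (simp add: degree_add_eq_left)
  show "coeff (charpoly M) CARD('k) = 1" unfolding c using l d q by (simp add: coeff_eq_0)
qed

text \<open>The roots are collected in a vector indexed like the matrix, so that they can converge
  in a finite-dimensional space.\<close>

lemma charpoly_factor:
  fixes M :: "complex ^ 'k::finite ^ 'k"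
  obtains r :: "complex ^ 'k" where "charpoly M = (\<Prod>i\<in>UNIV. [:- r $ i, 1:])"
proof -
  obtain root where "smult (lead_coeff (charpoly M)) (\<Prod>i<degree (charpoly M). [:-root i, 1:]) = charpoly M"
    by (rule complex_poly_decompose')
  then have root: "charpoly M = (\<Prod>i<CARD('k). [:-root i, 1:])" by (simp add: charpoly_monic)
  obtain h where h: "bij_betw h (UNIV::'k set) {0..<CARD('k)}"
    using ex_bij_betw_finite_nat finite by blast
  then have h: "bij_betw h UNIV {..<CARD('k)}" by (simp add: atLeast0LessThan)
  have "charpoly M = (\<Prod>i\<in>UNIV. [:- (\<chi> i. root (h i)) $ i, 1:])"
    unfolding root using prod.reindex_bij_betw[OF h, of "\<lambda>i. [:-root i, 1:]"] by simp
  then show ?thesis by (rule that)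
qed

lemma order_prod_linear:
  "finite I \<Longrightarrow> order z (\<Prod>i\<in>I. [:- r i, 1:]) = card {i \<in> I. r i = (z::complex)}"
proof (induction I rule: finite_induct)
  case empty
  then show ?case by (simp add: order_0I)
next
  case (insert a I)
  have "order z [:- r a, 1:] = (if r a = z then 1 else 0)"
    using order_power_n_n[of z 1] by (auto intro: order_0I)
  moreover have "{i \<in> insert a I. r i = z} = (if r a = z then insert a {i \<in> I. r i = z} else {i \<in> I. r i = z})"
    by auto
  moreover have "[:- r a, 1:] * (\<Prod>i\<in>I. [:- r i, 1:]) \<noteq> 0"
    using insert.hyps by (simp del: mult_pCons_left)
  ultimately show ?case using insert by (simp add: order_mult del: mult_pCons_left)
qed

section \<open>The sum of the arguments of the eigenvalues and its continuity\<close>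

definition argsum :: "complex poly \<Rightarrow> real" where
  "argsum p = (\<Sum>z | poly p z = 0. real (order z p) * Arg z)"

lemma argsum_prod:
  fixes r :: "complex ^ 'k::finite"
  shows "argsum (\<Prod>i\<in>UNIV. [:- r $ i, 1:]) = (\<Sum>i\<in>UNIV. Arg (r $ i))"
proof -
  have roots: "{z. poly (\<Prod>i\<in>UNIV. [:- r $ i, 1:]) z = 0} = range (($) r)"
    by (auto simp: poly_prod)
  have "argsum (\<Prod>i\<in>UNIV. [:- r $ i, 1:]) = (\<Sum>z\<in>range (($) r). \<Sum>i | r $ i = z. Arg (r $ i))"
    unfolding argsum_def roots by (intro sum.cong refl) (simp add: order_prod_linear)
  also have "\<dots> = (\<Sum>i\<in>UNIV. Arg (r $ i))"
    using sum.image_gen[of UNIV "\<lambda>i. Arg (r $ i)" "($) r"] by simp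
  finally show ?thesis .
qed

definition argdet :: "complex ^ 'k::finite ^ 'k \<Rightarrow> real" where
  "argdet M = argsum (charpoly M)"

lemma Theta_hat_eq: "Theta_hat A = argdet (I_plus_iA A)"
  by (simp add: Theta_hat_def argdet_def argsum_def Let_def)

lemma det_eq_0_kernel:
  fixes M :: "complex ^ 'k::finite ^ 'k"
  assumes "det M = 0"
  obtains v where "v \<noteq> 0" "M *v v = 0"
proof -
  have "\<not> (\<exists>B. B ** M = mat 1)"
    using assms invertible_left_inverse invertible_det_nz by blast
  then show ?thesis using that matrix_left_invertible_ker by blast
qed

lemma eigenvector:
  fixes M :: "complex ^ 'k::finite ^ 'k"
  assumes "poly (charpoly M) z = 0"
  obtains v where "v \<noteq> 0" "M *v v = z *s v"
proof -
  obtain v where v: "v \<noteq> 0" "(mat z - M) *v v = 0"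
    using assms det_eq_0_kernel by (auto simp: poly_charpoly)
  moreover have "mat z *v v = z *s v"
    by (auto simp: vec_eq_iff matrix_vector_mult_def mat_def if_distrib[where f="\<lambda>x. x * _"] cong: if_cong)
  ultimately show ?thesis using that by (simp add: matrix_vector_mult_diff_rdistrib)
qed

text \<open>This supplies the compactness of the roots in \<open>argdet_tendsto\<close>; comparing
  the norms of both sides of \<open>M *v v = z *s v\<close> is enough.\<close>

lemma eigenvalue_bound:
  fixes M :: "complex ^ 'k::finite ^ 'k"
  assumes "poly (charpoly M) z = 0"
  shows "cmod z \<le> (\<Sum>i\<in>UNIV. \<Sum>j\<in>UNIV. cmod (M $ i $ j))"
proof -
  obtain v where v: "v \<noteq> 0" "M *v v = z *s v" using eigenvector[OF assms] .
  have "cmod z * norm v = norm (z *s v)"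
    unfolding norm_vec_def vector_scalar_mult_def by (simp add: norm_mult L2_set_right_distrib)
  also have "\<dots> \<le> (\<Sum>i\<in>UNIV. cmod ((M *v v) $ i))"
    unfolding v(2)[symmetric] norm_vec_def by (rule L2_set_le_sum) simp
  also have "\<dots> \<le> (\<Sum>i\<in>UNIV. \<Sum>j\<in>UNIV. cmod (M $ i $ j) * norm v)"
  proof (rule sum_mono)
    fix i
    have "cmod ((M *v v) $ i) \<le> (\<Sum>j\<in>UNIV. cmod (M $ i $ j * v $ j))"
      by (simp add: matrix_vector_mult_def norm_sum)
    also have "\<dots> \<le> (\<Sum>j\<in>UNIV. cmod (M $ i $ j) * norm v)"
      by (intro sum_mono) (simp add: norm_mult mult_left_mono Finite_Cartesian_Product.norm_nth_le)
    finally show "cmod ((M *v v) $ i) \<le> (\<Sum>j\<in>UNIV. cmod (M $ i $ j) * norm v)" .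
  qed
  also have "\<dots> = (\<Sum>i\<in>UNIV. \<Sum>j\<in>UNIV. cmod (M $ i $ j)) * norm v"
    by (simp add: sum_distrib_right)
  finally show ?thesis using v(1) by simp
qed

lemma tendsto_det:
  fixes M :: "nat \<Rightarrow> complex ^ 'k::finite ^ 'k"
  assumes "\<And>i j. (\<lambda>k. M k $ i $ j) \<longlonglongrightarrow> M0 $ i $ j"
  shows "(\<lambda>k. det (M k)) \<longlonglongrightarrow> det M0"
  unfolding det_def by (intro tendsto_intros assms)

text \<open>The roots of the characteristic polynomials lie in a compact set, so every subsequence has a
  further subsequence along which they converge, and the limits are the roots of the limiting
  polynomial.\<close>

lemma argdet_tendsto:
  fixes M :: "nat \<Rightarrow> complex ^ 'k::finite ^ 'k"
  assumes lim: "M \<longlonglongrightarrow> M0"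
    and roots: "\<And>z. poly (charpoly M0) z = 0 \<Longrightarrow> z \<notin> \<real>\<^sub>\<le>\<^sub>0"
  shows "(\<lambda>k. argdet (M k)) \<longlonglongrightarrow> argdet M0"
proof (rule ccontr)
  assume "\<not> ?thesis"
  then obtain e where e: "e > 0" "\<not> eventually (\<lambda>k. dist (argdet (M k)) (argdet M0) < e) sequentially"
    by (auto simp: tendsto_iff)
  obtain s :: "nat \<Rightarrow> nat" where s: "strict_mono s" "\<And>n. \<not> dist (argdet (M (s n))) (argdet M0) < e"
    using not_eventually_sequentiallyD[OF e(2)] by blast
  have "\<forall>n. \<exists>r. charpoly (M (s n)) = (\<Prod>i\<in>UNIV. [:- (r::complex^'k) $ i, 1:])"
    by (metis charpoly_factor)
  then obtain r :: "nat \<Rightarrow> complex ^ 'k" where r: "\<And>n. charpoly (M (s n)) = (\<Prod>i\<in>UNIV. [:- r n $ i, 1:])"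
    by metis
  have "bounded (range M)" using lim convergent_imp_bounded by blast
  then obtain B where B: "\<And>n. norm (M n) \<le> B" by (auto simp: bounded_iff)
  have root: "poly (charpoly (M (s n))) (r n $ i) = 0" for n i
    unfolding r by (auto simp: poly_prod)
  have bd: "cmod (r n $ i) \<le> real CARD('k) * (real CARD('k) * B)" for n i
  proof -
    have "cmod (r n $ i) \<le> (\<Sum>i\<in>UNIV. \<Sum>j\<in>UNIV. cmod (M (s n) $ i $ j))"
      by (rule eigenvalue_bound[OF root])
    also have "\<dots> \<le> (\<Sum>i\<in>(UNIV::'k set). \<Sum>j\<in>(UNIV::'k set). B)"
      by (intro sum_mono) (meson B Finite_Cartesian_Product.norm_nth_le order_trans)
    finally show ?thesis by simp
  qed
  have "norm (r n) \<le> (\<Sum>i\<in>(UNIV::'k set). real CARD('k) * (real CARD('k) * B))" for n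
    unfolding norm_vec_def by (rule order_trans[OF L2_set_le_sum sum_mono]) (auto intro: bd)
  then have "bounded (range r)" unfolding bounded_iff by blast
  then obtain r0 t where t: "strict_mono t" "((r \<circ> t) \<longlongrightarrow> r0) sequentially"
    using bounded_imp_convergent_subsequence by blast
  have st: "strict_mono (s \<circ> t)" using s(1) t(1) by (simp add: strict_mono_o)
  have Mlim: "(\<lambda>n. M (s (t n))) \<longlonglongrightarrow> M0"
    using LIMSEQ_subseq_LIMSEQ[OF lim st] by (simp add: o_def)
  have "charpoly M0 = (\<Prod>i\<in>UNIV. [:- r0 $ i, 1:])"
  proof (rule poly_eq_poly_eq_iff[THEN iffD1], rule ext)
    show "poly (charpoly M0) z = poly (\<Prod>i\<in>UNIV. [:- r0 $ i, 1:]) z" for z :: complex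
    proof (rule LIMSEQ_unique)
      have "(\<lambda>n. (mat z - M (s (t n))) $ i $ j) \<longlonglongrightarrow> (mat z - M0) $ i $ j" for i j
        by (intro tendsto_intros tendsto_vec_nth Mlim)
      then show "(\<lambda>n. poly (charpoly (M (s (t n)))) z) \<longlonglongrightarrow> poly (charpoly M0) z"
        unfolding poly_charpoly by (rule tendsto_det)
      have "(\<lambda>n. r (t n)) \<longlonglongrightarrow> r0" using t(2) by (simp add: o_def)
      then have "(\<lambda>n. \<Prod>i\<in>UNIV. z - r (t n) $ i) \<longlonglongrightarrow> (\<Prod>i\<in>UNIV. z - r0 $ i)"
        by (intro tendsto_prod tendsto_diff tendsto_const tendsto_vec_nth)
      then show "(\<lambda>n. poly (charpoly (M (s (t n)))) z) \<longlonglongrightarrow> poly (\<Prod>i\<in>UNIV. [:- r0 $ i, 1:]) z"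
        unfolding r poly_prod by simp
    qed
  qed
  note c0 = this
  have Arg: "isCont Arg (r0 $ i)" for i
    by (intro continuous_at_Arg roots) (auto simp: c0 poly_prod)
  have rlim: "(\<lambda>n. r (t n)) \<longlonglongrightarrow> r0" using t(2) by (simp add: o_def)
  have "(\<lambda>n. \<Sum>i\<in>UNIV. Arg (r (t n) $ i)) \<longlonglongrightarrow> (\<Sum>i\<in>UNIV. Arg (r0 $ i))"
    by (intro tendsto_sum isCont_tendsto_compose[OF Arg] tendsto_vec_nth[OF rlim])
  then have "(\<lambda>n. argdet (M (s (t n)))) \<longlonglongrightarrow> argdet M0"
    unfolding argdet_def r c0 argsum_prod .
  from tendstoD[OF this e(1)] show False using s(2) by simp
qed

lemma argdet_abs_le:
  fixes M :: "complex ^ 'k::finite ^ 'k"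
  shows "\<bar>argdet M\<bar> \<le> real CARD('k) * pi"
proof -
  obtain r :: "complex ^ 'k" where r: "charpoly M = (\<Prod>i\<in>UNIV. [:- r $ i, 1:])"
    by (rule charpoly_factor)
  have "\<bar>Arg z\<bar> \<le> pi" for z using Arg_le_pi[of z] mpi_less_Arg[of z] by linarith
  then have "\<bar>\<Sum>i\<in>UNIV. Arg (r $ i)\<bar> \<le> (\<Sum>i\<in>(UNIV::'k set). pi)"
    by (intro order_trans[OF sum_abs sum_mono])
  then show ?thesis by (simp add: argdet_def r argsum_prod)
qed

text \<open>The characteristic polynomial at 0 shows that the determinant is the product of the
  roots, so \<open>argdet\<close> is an argument of the determinant that has not been reduced modulo
  2\<pi>. A zero root does no harm, since its modulus makes both sides vanish.\<close>

lemma argdet_exp: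
  fixes M :: "complex ^ 'k::finite ^ 'k"
  shows "det M = of_real (cmod (det M)) * exp (\<i> * of_real (argdet M))"
proof -
  obtain r :: "complex ^ 'k" where r: "charpoly M = (\<Prod>i\<in>UNIV. [:- r $ i, 1:])"
    by (rule charpoly_factor)
  have "poly (charpoly M) 0 = det (- M)" unfolding poly_charpoly by (simp add: mat_def vec_eq_iff zero_vec_def[symmetric])
  also have "- M = (\<chi> i. (-1) *s M $ i)" by (simp add: vec_eq_iff)
  also have "det \<dots> = (-1) ^ CARD('k) * det M" by (subst det_rows_mul) simp
  finally have "(-1) ^ CARD('k) * det M = (\<Prod>i\<in>UNIV. - r $ i)" by (simp add: r poly_prod)
  also have "\<dots> = (-1) ^ CARD('k) * (\<Prod>i\<in>UNIV. r $ i)" by (simp add: prod_uminus)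
  finally have det: "det M = (\<Prod>i\<in>UNIV. r $ i)" by simp
  also have "\<dots> = (\<Prod>i\<in>UNIV. of_real (cmod (r $ i)) * exp (\<i> * of_real (Arg (r $ i))))"
    by (intro prod.cong refl) (metis Arg_eq Arg_zero exp_zero mult_zero_left norm_zero of_real_0 )
  also have "\<dots> = of_real (\<Prod>i\<in>UNIV. cmod (r $ i)) * exp (\<i> * of_real (argdet M))"
    by (simp add: prod.distrib argdet_def r argsum_prod exp_sum sum_distrib_left)
  also have "(\<Prod>i\<in>UNIV. cmod (r $ i)) = cmod (det M)" unfolding det by (simp add: prod_norm)
  finally show ?thesis .
qed

section \<open>Semidefinite and symmetric matrices\<close>

definition psd :: "real ^ 'k::finite ^ 'k \<Rightarrow> bool" where
  "psd P \<longleftrightarrow> (\<forall>x. 0 \<le> x \<bullet> (P *v x))"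

lemma psd_add: "psd P \<Longrightarrow> psd Q \<Longrightarrow> psd (P + Q)"
  by (simp add: psd_def matrix_vector_mult_add_rdistrib inner_add_right)

lemma mat_mult_vector: "mat c *v x = c *\<^sub>R (x :: real ^ 'k::finite)"
  by (simp add: vec_eq_iff matrix_vector_mult_def mat_def if_distrib[where f="\<lambda>x. x * _"] cong: if_cong)

lemma psd_mat: "c \<ge> 0 \<Longrightarrow> psd (mat c)"
  by (simp add: psd_def mat_mult_vector)

text \<open>The Euclidean norm of the entries bounds the operator norm, and Cauchy-Schwarz does the
  rest. Thus the ball of radius \<open>c\<close> around \<open>H + mat c\<close> lies in
  \<open>H\<close> plus the semidefinite cone, which is the source of all interior points.\<close>

lemma psd_mat_add:
  fixes C :: "real ^ 'k::finite ^ 'k"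
  assumes "norm C \<le> c"
  shows "psd (mat c + C)"
  unfolding psd_def
proof
  fix x :: "real ^ 'k"
  have "norm (C *v x) \<le> norm C * norm x"
  proof -
    have "norm (C *v x) = L2_set (\<lambda>i. (C *v x) $ i) UNIV" by (simp add: norm_vec_def L2_set_def)
    also have "\<dots> \<le> L2_set (\<lambda>i. norm (C $ i) * norm x) UNIV"
      unfolding L2_set_def
    proof (intro real_sqrt_le_mono sum_mono)
      fix i
      have "(C *v x) $ i = C $ i \<bullet> x" by (simp add: matrix_vector_mult_def inner_vec_def)
      then have "\<bar>(C *v x) $ i\<bar> \<le> norm (C $ i) * norm x" by (simp add: Cauchy_Schwarz_ineq2)
      then have "\<bar>(C *v x) $ i\<bar>\<^sup>2 \<le> (norm (C $ i) * norm x)\<^sup>2" by (rule power_mono) simp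
      then show "((C *v x) $ i)\<^sup>2 \<le> (norm (C $ i) * norm x)\<^sup>2" by simp
    qed
    also have "\<dots> = norm C * norm x" by (simp add: norm_vec_def[of C] L2_set_left_distrib)
    finally show ?thesis .
  qed
  then have "\<bar>x \<bullet> (C *v x)\<bar> \<le> norm x * (c * norm x)"
    by (meson Cauchy_Schwarz_ineq2 assms mult_left_mono mult_right_mono norm_ge_zero order_trans)
  moreover have "x \<bullet> (mat c *v x) = norm x * (c * norm x)"
    by (simp add: mat_mult_vector dot_square_norm power2_eq_square)
  ultimately show "0 \<le> x \<bullet> ((mat c + C) *v x)"
    by (simp add: matrix_vector_mult_add_rdistrib inner_add_right)
qed

lemma mem_Sym: "A \<in> Sym \<longleftrightarrow> (\<forall>i j. A $ i $ j = A $ j $ i)"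
  by (auto simp: Sym_def transpose_def vec_eq_iff)

lemma Sym_add: "A \<in> Sym \<Longrightarrow> B \<in> Sym \<Longrightarrow> A + B \<in> Sym"
  by (simp add: mem_Sym)

lemma Sym_diff: "A \<in> Sym \<Longrightarrow> B \<in> Sym \<Longrightarrow> A - B \<in> Sym"
  by (simp add: mem_Sym)

lemma Sym_mat: "mat c \<in> Sym"
  by (auto simp: mem_Sym mat_def)

text \<open>For symmetric \<open>A\<close> this is the Hermitian form of \<open>A\<close> at
  \<open>v\<close>, split into real and imaginary parts so that \<open>psd\<close>, which tests real
  vectors only, applies to complex ones.\<close>

definition herm_form :: "real ^ 'k::finite ^ 'k \<Rightarrow> complex ^ 'k \<Rightarrow> real" where
  "herm_form A v = (\<chi> k. Re (v $ k)) \<bullet> (A *v (\<chi> k. Re (v $ k))) + (\<chi> k. Im (v $ k)) \<bullet> (A *v (\<chi> k. Im (v $ k)))"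

lemma herm_form_nonneg: "psd A \<Longrightarrow> herm_form A v \<ge> 0"
  by (simp add: herm_form_def psd_def)

lemma herm_form_eq:
  assumes "A \<in> Sym"
  shows "(\<Sum>k\<in>UNIV. \<Sum>l\<in>UNIV. cnj (v $ k) * (of_real (A $ k $ l) * v $ l)) = of_real (herm_form A v)"
proof (rule complex_eqI)
  show "Re (\<Sum>k\<in>UNIV. \<Sum>l\<in>UNIV. cnj (v $ k) * (of_real (A $ k $ l) * v $ l)) = Re (of_real (herm_form A v))"
    by (simp add: herm_form_def inner_vec_def matrix_vector_mult_def sum_distrib_left
        sum.distrib[symmetric] algebra_simps)
  have "(\<Sum>k\<in>UNIV. \<Sum>l\<in>UNIV. A $ k $ l * (Re (v $ k) * Im (v $ l))) =
    (\<Sum>k\<in>UNIV. \<Sum>l\<in>UNIV. A $ k $ l * (Im (v $ k) * Re (v $ l)))"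
    using assms by (subst sum.swap) (auto simp: mem_Sym mult.commute intro!: sum.cong)
  then show "Im (\<Sum>k\<in>UNIV. \<Sum>l\<in>UNIV. cnj (v $ k) * (of_real (A $ k $ l) * v $ l)) = Im (of_real (herm_form A v))"
    by (simp add: sum_subtractf algebra_simps)
qed

text \<open>The matrices \<open>I\<^sub>n + \<epsilon> E\<^sub>0\<^sub>0 + iA\<close>: for \<open>\<epsilon> > 0\<close> no eigenvalue lies on the imaginary axis,
  whether or not \<open>A\<close> is singular.\<close>

definition rho :: "real \<Rightarrow> 'n option \<Rightarrow> real" where
  "rho \<epsilon> k = (if k = None then \<epsilon> else 1)"

definition R_iA :: "real \<Rightarrow> real ^ 'n::finite option ^ 'n option \<Rightarrow> complex ^ 'n option ^ 'n option" where
  "R_iA \<epsilon> A = (\<chi> k l. (if k = l then of_real (rho \<epsilon> k) else 0) + \<i> * of_real (A $ k $ l))"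

lemma I_plus_iA_eq: "I_plus_iA A = R_iA 0 A"
  by (auto simp: I_plus_iA_def R_iA_def vec_eq_iff rho_def)

lemma R_iA_mult: "(R_iA \<epsilon> A *v v) $ k = of_real (rho \<epsilon> k) * v $ k + \<i> * (\<Sum>l\<in>UNIV. of_real (A $ k $ l) * v $ l)"
  by (simp add: R_iA_def matrix_vector_mult_def distrib_right sum.distrib sum_distrib_left mult.assoc
        if_distrib[where f="\<lambda>x. x * _"] cong: if_cong)

text \<open>The real diagonal contributes the real part and \<open>A\<close> the imaginary part. At
  an eigenvector this reads off the real part of the eigenvalue; at a kernel vector in
  \<open>argdet_mono_eps\<close> it gives the sign of the imaginary part of
  \<open>s\<close>.\<close>

lemma R_iA_form:
  assumes "A \<in> Sym"
  shows "(\<Sum>k\<in>UNIV. cnj (v $ k) * (R_iA \<epsilon> A *v v) $ k) =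
    of_real (\<Sum>k\<in>UNIV. rho \<epsilon> k * (cmod (v $ k))\<^sup>2) + \<i> * of_real (herm_form A v)"
proof -
  have sq: "cnj z * z = of_real ((cmod z)\<^sup>2)" for z
    by (metis complex_norm_square mult.commute)
  have "(\<Sum>k\<in>UNIV. cnj (v $ k) * (R_iA \<epsilon> A *v v) $ k) =
    (\<Sum>k\<in>UNIV. of_real (rho \<epsilon> k) * (cnj (v $ k) * v $ k) + \<i> * (\<Sum>l\<in>UNIV. cnj (v $ k) * (of_real (A $ k $ l) * v $ l)))"
    by (simp add: R_iA_mult algebra_simps sum_distrib_left)
  also have "\<dots> = (\<Sum>k\<in>UNIV. of_real (rho \<epsilon> k) * (cnj (v $ k) * v $ k)) + \<i> * of_real (herm_form A v)"
    by (simp only: sum.distrib sum_distrib_left[symmetric, where r=\<i>] herm_form_eq[OF assms])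
  finally show ?thesis by (simp only: sq of_real_mult[symmetric] of_real_sum[symmetric])
qed

lemma cmod_sum_pos:
  fixes v :: "complex ^ 'n::finite option"
  assumes "v \<noteq> 0" "\<epsilon> > 0"
  shows "(\<Sum>k\<in>UNIV. rho \<epsilon> k * (cmod (v $ k))\<^sup>2) > 0"
proof -
  obtain k where "v $ k \<noteq> 0" using assms(1) by (auto simp: vec_eq_iff)
  then have "rho \<epsilon> k * (cmod (v $ k))\<^sup>2 > 0" using assms(2) by (auto simp: rho_def)
  then show ?thesis
    using assms(2) by (intro sum_pos2[of _ k]) (auto simp: rho_def)
qed

lemma R_iA_eigenvalue:
  assumes A: "A \<in> Sym" and v: "v \<noteq> 0" "R_iA \<epsilon> A *v v = z *s v"
  shows "Re z * (\<Sum>k\<in>UNIV. (cmod (v $ k))\<^sup>2) = (\<Sum>k\<in>UNIV. rho \<epsilon> k * (cmod (v $ k))\<^sup>2)"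
proof -
  have "cnj w * (z * w) = z * of_real ((cmod w)\<^sup>2)" for w
    by (metis complex_norm_square mult.commute mult.left_commute)
  then have "(\<Sum>k\<in>UNIV. cnj (v $ k) * (z *s v) $ k) = z * of_real (\<Sum>k\<in>UNIV. (cmod (v $ k))\<^sup>2)"
    by (simp only: sum_distrib_left of_real_sum vector_smult_component)
  with R_iA_form[OF A, of v \<epsilon>] v
  have "z * of_real (\<Sum>k\<in>UNIV. (cmod (v $ k))\<^sup>2) = of_real (\<Sum>k\<in>UNIV. rho \<epsilon> k * (cmod (v $ k))\<^sup>2) + \<i> * of_real (herm_form A v)"
    by simp
  from arg_cong[OF this, of Re] show ?thesis by simp
qed

lemma R_iA_eigenvalue_pos:
  assumes "A \<in> Sym" "\<epsilon> > 0" "poly (charpoly (R_iA \<epsilon> A)) z = 0"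
  shows "z \<notin> \<real>\<^sub>\<le>\<^sub>0"
proof -
  obtain v where v: "v \<noteq> 0" "R_iA \<epsilon> A *v v = z *s v" using eigenvector[OF assms(3)] .
  have "Re z * (\<Sum>k\<in>UNIV. (cmod (v $ k))\<^sup>2) > 0"
    using R_iA_eigenvalue[OF assms(1) v] cmod_sum_pos[OF v(1) assms(2)] by simp
  moreover have "(\<Sum>k\<in>UNIV. (cmod (v $ k))\<^sup>2) \<ge> 0" by (simp add: sum_nonneg)
  ultimately have "Re z > 0" by (simp add: zero_less_mult_iff)
  then show ?thesis by (auto simp: complex_nonpos_Reals_iff)
qed

text \<open>An eigenvalue with nonpositive real part forces the eigenvector onto the first axis and
  then has real part 0. Being a nonpositive real it is 0, so \<open>A\<close> kills the first axis
  and lies in \<open>Sing\<close>. Nonzero imaginary eigenvalues can occur, but they stay off the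
  branch cut of \<open>Arg\<close>.\<close>

lemma I_plus_iA_eigenvalue:
  fixes A :: "real ^ 'n::finite option ^ 'n option"
  assumes "A \<in> Sym - Sing" "poly (charpoly (R_iA 0 A)) z = 0"
  shows "z \<notin> \<real>\<^sub>\<le>\<^sub>0"
proof
  assume z: "z \<in> \<real>\<^sub>\<le>\<^sub>0"
  obtain v where v: "v \<noteq> 0" "R_iA 0 A *v v = z *s v" using eigenvector[OF assms(2)] .
  have A: "A \<in> Sym" using assms(1) by simp
  have nn: "(\<Sum>k\<in>UNIV. rho 0 k * (cmod (v $ k))\<^sup>2) \<ge> 0" by (intro sum_nonneg) (auto simp: rho_def)
  have "Re z * (\<Sum>k\<in>UNIV. (cmod (v $ k))\<^sup>2) \<le> 0"
    using z by (intro mult_nonpos_nonneg sum_nonneg) (auto simp: complex_nonpos_Reals_iff)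
  with nn R_iA_eigenvalue[OF A v] have 0: "(\<Sum>k\<in>UNIV. rho 0 k * (cmod (v $ k))\<^sup>2) = 0" by simp
  have "\<forall>k\<in>UNIV. rho 0 k * (cmod (v $ k))\<^sup>2 = 0"
    using 0 by (subst (asm) sum_nonneg_eq_0_iff) (auto simp: rho_def)
  then have vS: "v $ Some i = 0" for i by (metis UNIV_I mult_1 norm_eq_zero option.distinct(1) power_eq_0_iff rho_def)
  have vN: "v $ None \<noteq> 0" using v(1) vS by (metis option.exhaust vec_eq_iff zero_index)
  have "(\<Sum>k\<in>UNIV. (cmod (v $ k))\<^sup>2) > 0"
    using vN by (intro sum_pos2[of _ None]) auto
  with 0 R_iA_eigenvalue[OF A v] have "Re z = 0" by simp
  with z have z0: "z = 0" by (auto simp: complex_nonpos_Reals_iff complex_eq_iff)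
  have "A $ k $ None = 0" for k
  proof -
    have "(\<Sum>l\<in>UNIV. complex_of_real (A $ k $ l) * v $ l) = (\<Sum>l\<in>(UNIV::'n option set). if l = None then of_real (A $ k $ None) * v $ None else 0)"
    proof (rule sum.cong[OF refl])
      fix l show "complex_of_real (A $ k $ l) * v $ l = (if l = None then of_real (A $ k $ None) * v $ None else 0)"
        by (cases l) (simp_all add: vS)
    qed
    then have s: "(\<Sum>l\<in>UNIV. complex_of_real (A $ k $ l) * v $ l) = of_real (A $ k $ None) * v $ None" by simp
    have "of_real (rho 0 k) * v $ k = 0" by (cases k) (auto simp: rho_def vS)
    with arg_cong[OF v(2), of "\<lambda>w. w $ k"] s vN show ?thesis by (simp add: R_iA_mult z0)
  qed
  with A have "A \<in> Sing" by (auto simp: Sing_def mem_Sym)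
  with assms(1) show False by simp
qed

text \<open>As a polynomial in \<open>s\<close>, the determinant \<open>det (I\<^sub>n + \<epsilon> E\<^sub>0\<^sub>0 + i(A + sP))\<close> has all its roots in the open
  upper half plane, so each linear factor contributes an increasing argument along the real axis.\<close>

lemma argdet_mono_eps:
  fixes A P :: "real ^ 'n::finite option ^ 'n option"
  assumes A: "A \<in> Sym" and P: "P \<in> Sym" "psd P" and \<epsilon>: "\<epsilon> > 0"
  shows "argdet (R_iA \<epsilon> A) \<le> argdet (R_iA \<epsilon> (A + P))"
proof -
  define \<theta> where "\<theta> s = argdet (R_iA \<epsilon> (A + s *\<^sub>R P))" for s
  define Q where "Q = det (\<chi> k l. [:R_iA \<epsilon> A $ k $ l, \<i> * complex_of_real (P $ k $ l):])"
  have Q: "poly Q s = det (\<chi> k l. R_iA \<epsilon> A $ k $ l + s * (\<i> * complex_of_real (P $ k $ l)))" for s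
    by (simp add: Q_def poly_det)
  have Q_real: "poly Q (of_real s) = det (R_iA \<epsilon> (A + s *\<^sub>R P))" for s
    unfolding Q by (rule arg_cong[where f=det]) (simp add: vec_eq_iff R_iA_def algebra_simps)
  have Sym_s: "A + s *\<^sub>R P \<in> Sym" for s using A P by (simp add: mem_Sym)
  have Im_pos: "Im s > 0" if s0: "poly Q s = 0" for s
  proof -
    obtain v where v: "v \<noteq> 0" "(\<chi> k l. R_iA \<epsilon> A $ k $ l + s * (\<i> * complex_of_real (P $ k $ l))) *v v = 0"
      by (rule det_eq_0_kernel[OF s0[unfolded Q]])
    have k: "(R_iA \<epsilon> A *v v) $ k + \<i> * s * (\<Sum>l\<in>UNIV. of_real (P $ k $ l) * v $ l) = 0" for k
      using arg_cong[OF v(2), of "\<lambda>w. w $ k"]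
      by (simp add: matrix_vector_mult_def algebra_simps sum.distrib sum_distrib_left)
    \<comment> \<open>The kernel equation is paired with \<open>v\<close> itself. Its real part
      equates the positive form of \<open>rho\<close> with \<open>Im s\<close> times the nonnegative
      form of \<open>P\<close>, so \<open>Im s\<close> must be positive.\<close>
    have "0 = (\<Sum>k\<in>UNIV. cnj (v $ k) * ((R_iA \<epsilon> A *v v) $ k + \<i> * s * (\<Sum>l\<in>UNIV. of_real (P $ k $ l) * v $ l)))"
      by (simp only: k) simp
    also have "\<dots> = (\<Sum>k\<in>UNIV. cnj (v $ k) * (R_iA \<epsilon> A *v v) $ k) +
        \<i> * s * (\<Sum>k\<in>UNIV. \<Sum>l\<in>UNIV. cnj (v $ k) * (of_real (P $ k $ l) * v $ l))"
      by (simp add: algebra_simps sum.distrib sum_distrib_left)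
    also have "\<dots> = of_real (\<Sum>k\<in>UNIV. rho \<epsilon> k * (cmod (v $ k))\<^sup>2) + \<i> * of_real (herm_form A v) + \<i> * s * of_real (herm_form P v)"
      by (simp only: R_iA_form[OF A] herm_form_eq[OF P(1)])
    finally have "(\<Sum>k\<in>UNIV. rho \<epsilon> k * (cmod (v $ k))\<^sup>2) = Im s * herm_form P v"
      by (drule_tac arg_cong[where f=Re]) simp
    with cmod_sum_pos[OF v(1) \<epsilon>] have "Im s * herm_form P v > 0" by simp
    with herm_form_nonneg[OF P(2), of v] show ?thesis by (simp add: zero_less_mult_iff)
  qed
  obtain root where root: "smult (lead_coeff Q) (\<Prod>i<degree Q. [:-root i, 1:]) = Q"
    by (rule complex_poly_decompose')
  have poly_Q: "poly Q s = lead_coeff Q * (\<Prod>i<degree Q. s - root i)" for s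
    by (subst root[symmetric]) (simp add: poly_prod)
  have root_pos: "Im (root i) > 0" if "i < degree Q" for i
    using that by (intro Im_pos) (auto simp: poly_Q)
  have nz: "poly Q (of_real s) \<noteq> 0" for s using Im_pos[of "of_real s"] by auto
  \<comment> \<open>The factor \<open>of_real s - root i\<close> has argument
    \<open>\<alpha> i s - pi / 2\<close>. As the root lies in the upper half plane, the denominator
    is positive and \<open>\<alpha> i\<close> increases with \<open>s\<close>.\<close>
  define \<alpha> where "\<alpha> i s = arctan ((s - Re (root i)) / Im (root i))" for i s
  have \<alpha>: "of_real s - root i = of_real (cmod (of_real s - root i)) * (- \<i> * exp (\<i> * of_real (\<alpha> i s)))"
    if "i < degree Q" for i s
  proof -
    let ?a = "s - Re (root i)" and ?b = "Im (root i)"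
    have b: "?b > 0" by (rule root_pos) fact
    have c: "cmod (of_real s - root i) = sqrt (?a\<^sup>2 + ?b\<^sup>2)" by (simp add: cmod_def)
    have "sqrt (1 + (?a / ?b)\<^sup>2) = sqrt (?a\<^sup>2 + ?b\<^sup>2) / ?b"
    proof -
      have "1 + (?a / ?b)\<^sup>2 = (?a\<^sup>2 + ?b\<^sup>2) / ?b\<^sup>2" using b by (simp add: field_simps)
      then show ?thesis using b by (simp add: real_sqrt_divide)
    qed
    moreover have "sqrt (?a\<^sup>2 + ?b\<^sup>2) > 0" using b by (simp add: sum_power2_gt_zero_iff)
    ultimately have "sqrt (?a\<^sup>2 + ?b\<^sup>2) * cos (\<alpha> i s) = ?b" "sqrt (?a\<^sup>2 + ?b\<^sup>2) * sin (\<alpha> i s) = ?a"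
      using b by (simp_all add: \<alpha>_def cos_arctan sin_arctan)
    then show ?thesis
      unfolding c by (simp add: complex_eq_iff cis_conv_exp[symmetric])
  qed
  \<comment> \<open>\<open>\<theta> s\<close> and the sum of the \<open>\<alpha> i s\<close> are
    arguments of the same number up to the constant rotation \<open>K\<close>. Hence values of their
    difference can only differ by multiples of 2\<pi>, and continuity makes it constant.\<close>
  define \<phi> where "\<phi> s = \<theta> s - (\<Sum>i<degree Q. \<alpha> i s)" for s
  define K where "K = lead_coeff Q / of_real (cmod (lead_coeff Q)) * (- \<i>) ^ degree Q"
  have lc: "lead_coeff Q \<noteq> 0" using nz[of 0] by auto
  have K: "exp (\<i> * of_real (\<phi> s)) = K" for s
  proof -
    have m: "cmod (poly Q (of_real s)) = cmod (lead_coeff Q) * (\<Prod>i<degree Q. cmod (of_real s - root i))"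
      by (simp only: poly_Q norm_mult prod_norm)
    have "of_real (cmod (poly Q (of_real s))) * exp (\<i> * of_real (\<theta> s)) = poly Q (of_real s)"
      unfolding \<theta>_def Q_real using argdet_exp by metis
    also have "\<dots> = lead_coeff Q * (\<Prod>i<degree Q. of_real (cmod (of_real s - root i)) * (- \<i> * exp (\<i> * of_real (\<alpha> i s))))"
      unfolding poly_Q by (intro arg_cong2[where f="(*)"] prod.cong refl \<alpha>) simp
    also have "\<dots> = lead_coeff Q * (of_real (\<Prod>i<degree Q. cmod (of_real s - root i)) * ((- \<i>) ^ degree Q * exp (\<i> * of_real (\<Sum>i<degree Q. \<alpha> i s))))"
      by (simp only: prod.distrib exp_sum[OF finite_lessThan] of_real_prod of_real_sum sum_distrib_left prod_constant card_lessThan)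
    also have "\<dots> = of_real (cmod (poly Q (of_real s))) * (K * exp (\<i> * of_real (\<Sum>i<degree Q. \<alpha> i s)))"
      unfolding m K_def using lc by (simp add: field_simps)
    finally have "exp (\<i> * of_real (\<theta> s)) = K * exp (\<i> * of_real (\<Sum>i<degree Q. \<alpha> i s))"
      using nz[of s] by simp
    then show ?thesis by (simp add: \<phi>_def exp_diff right_diff_distrib field_simps)
  qed
  \<comment> \<open>Because \<epsilon> is positive, the eigenvalues avoid the branch cut along the
    whole segment and no argument jumps.\<close>
  have cont_\<theta>: "continuous_on {0..1} \<theta>"
  proof (rule continuous_on_sequentiallyI)
    fix u :: "nat \<Rightarrow> real" and a assume u: "u \<longlonglongrightarrow> a"
    have "(\<lambda>n. R_iA \<epsilon> (A + u n *\<^sub>R P)) \<longlonglongrightarrow> R_iA \<epsilon> (A + a *\<^sub>R P)"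
      unfolding R_iA_def
      by (intro vec_tendstoI) (auto intro!: tendsto_intros u)
    then show "(\<lambda>n. \<theta> (u n)) \<longlonglongrightarrow> \<theta> a"
      unfolding \<theta>_def using Sym_s \<epsilon> by (intro argdet_tendsto) (auto dest: R_iA_eigenvalue_pos)
  qed
  have cont: "continuous_on {0..1} \<phi>"
    unfolding \<phi>_def \<alpha>_def by (intro continuous_intros cont_\<theta>) (use root_pos in force)
  have "\<phi> constant_on {0..1}"
  proof (rule continuous_discrete_range_constant[OF _ cont])
    fix x :: real
    have "2 * pi \<le> norm (\<phi> y - \<phi> x)" if "\<phi> y \<noteq> \<phi> x" for y
    proof -
      have "exp (\<i> * of_real (\<phi> y)) = exp (\<i> * of_real (\<phi> x))" by (simp only: K)
      then obtain n :: int where "\<i> * of_real (\<phi> y) = \<i> * of_real (\<phi> x) + (of_int (2 * n) * pi) * \<i>"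
        unfolding exp_eq by blast
      then have n: "\<phi> y = \<phi> x + of_int (2 * n) * pi"
        by (simp add: complex_eq_iff)
      with that have "n \<noteq> 0" by auto
      then have "1 \<le> \<bar>real_of_int n\<bar>" by linarith
      then show ?thesis unfolding n by (simp add: abs_mult)
    qed
    then show "\<exists>e>0. \<forall>y. y \<in> {0..1} \<and> \<phi> y \<noteq> \<phi> x \<longrightarrow> e \<le> norm (\<phi> y - \<phi> x)"
      by (intro exI[of _ "2 * pi"]) auto
  qed simp
  then have "\<phi> 0 = \<phi> 1" by (auto simp: constant_on_def)
  moreover have "(\<Sum>i<degree Q. \<alpha> i 0) \<le> (\<Sum>i<degree Q. \<alpha> i 1)"
    unfolding \<alpha>_def arctan_le_iff
    by (intro sum_mono arctan_monotone' divide_right_mono) (auto intro: less_imp_le root_pos)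
  ultimately have "\<theta> 0 \<le> \<theta> 1" by (simp add: \<phi>_def)
  then show ?thesis by (simp add: \<theta>_def)
qed

lemma R_iA_tendsto:
  assumes "u \<longlonglongrightarrow> \<epsilon>" "X \<longlonglongrightarrow> A"
  shows "(\<lambda>n. R_iA (u n) (X n)) \<longlonglongrightarrow> R_iA \<epsilon> A"
  unfolding R_iA_def rho_def by (intro vec_tendstoI) (auto intro!: tendsto_intros assms)

lemma Theta_hat_tendsto:
  assumes "X \<longlonglongrightarrow> A" "A \<in> Sym - Sing"
  shows "(\<lambda>n. Theta_hat (X n)) \<longlonglongrightarrow> Theta_hat A"
  unfolding Theta_hat_eq I_plus_iA_eq
  by (rule argdet_tendsto[OF R_iA_tendsto[OF tendsto_const assms(1)] I_plus_iA_eigenvalue[OF assms(2)]])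

text \<open>The limit \<epsilon> \<rightarrow> 0 is taken only at the nonsingular ends
  \<open>A\<close> and \<open>B\<close>, where \<open>argdet\<close> is continuous; the path between
  them enters through its perturbation alone.\<close>

lemma Theta_hat_mono:
  assumes "A \<in> Sym - Sing" "B \<in> Sym - Sing" "psd (B - A)"
  shows "Theta_hat A \<le> Theta_hat B"
proof (rule LIMSEQ_le)
  let ?e = "\<lambda>n. inverse (real (Suc n))"
  show "(\<lambda>n. argdet (R_iA (?e n) A)) \<longlonglongrightarrow> Theta_hat A" "(\<lambda>n. argdet (R_iA (?e n) B)) \<longlonglongrightarrow> Theta_hat B"
    unfolding Theta_hat_eq I_plus_iA_eq
    by (rule argdet_tendsto[OF R_iA_tendsto[OF LIMSEQ_inverse_real_of_nat tendsto_const]],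
        rule I_plus_iA_eigenvalue, rule assms, assumption)+
  have "argdet (R_iA (?e n) A) \<le> argdet (R_iA (?e n) B)" for n
    using argdet_mono_eps[of A "B - A" "?e n"] assms by (simp add: Sym_diff)
  then show "\<exists>N. \<forall>n\<ge>N. argdet (R_iA (?e n) A) \<le> argdet (R_iA (?e n) B)" by blast
qed

section \<open>The minimal upper semicontinuous extension\<close>

text \<open>Singular shifts are left out because there the formula of \<open>Theta_hat\<close>
  counts the zero eigenvalue with \<open>Arg 0 = 0\<close>. At most one \<delta> is lost in this way
  (\<open>Sing_mat_unique\<close>), so arbitrarily small shifts remain.\<close>

definition Theta_prime :: "real ^ 'n::finite option ^ 'n option \<Rightarrow> real" where
  "Theta_prime A = Inf {Theta_hat (A + mat \<delta>) |\<delta>. \<delta> > 0 \<and> A + mat \<delta> \<notin> Sing}"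

lemma Theta_hat_bdd:
  fixes A :: "real ^ 'n::finite option ^ 'n option"
  shows "bdd_below {Theta_hat (A + mat \<delta>) |\<delta>. P \<delta>}"
proof (rule bdd_belowI)
  fix y assume "y \<in> {Theta_hat (A + mat \<delta>) |\<delta>. P \<delta>}"
  then obtain \<delta> where "y = argdet (I_plus_iA (A + mat \<delta>))" by (auto simp: Theta_hat_eq)
  then show "- (real (CARD('n option)) * pi) \<le> y"
    using argdet_abs_le[of "I_plus_iA (A + mat \<delta>)"] by linarith
qed

lemma Theta_prime_le: "\<delta> > 0 \<Longrightarrow> A + mat \<delta> \<notin> Sing \<Longrightarrow> Theta_prime A \<le> Theta_hat (A + mat \<delta>)"
  unfolding Theta_prime_def by (intro cInf_lower Theta_hat_bdd) blast

lemma Sing_mat_unique: "A + mat \<delta> \<in> Sing \<Longrightarrow> A + mat \<delta>' \<in> Sing \<Longrightarrow> \<delta> = \<delta>'"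
proof -
  assume "A + mat \<delta> \<in> Sing" "A + mat \<delta>' \<in> Sing"
  then have "(A + mat \<delta>) $ None $ None = (A + mat \<delta>') $ None $ None"
    unfolding Sing_def by fastforce
  then show "\<delta> = \<delta>'" by (simp add: mat_def)
qed

lemma nonsingular_shift:
  assumes "\<delta> > 0"
  obtains \<delta>' where "0 < \<delta>'" "\<delta>' \<le> \<delta>" "A + mat \<delta>' \<notin> Sing"
proof (cases "A + mat \<delta> \<in> Sing")
  case True
  then have "A + mat (\<delta> / 2) \<notin> Sing" using Sing_mat_unique[of A \<delta> "\<delta> / 2"] assms by auto
  then show ?thesis using that[of "\<delta> / 2"] assms by simp
next
  case False
  then show ?thesis using that[of \<delta>] assms by simp
qed

lemma le_Theta_prime:
  assumes "\<And>\<delta>. \<delta> > 0 \<Longrightarrow> A + mat \<delta> \<notin> Sing \<Longrightarrow> b \<le> Theta_hat (A + mat \<delta>)"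
  shows "b \<le> Theta_prime A"
  unfolding Theta_prime_def
proof (rule cInf_greatest)
  show "{Theta_hat (A + mat \<delta>) |\<delta>. 0 < \<delta> \<and> A + mat \<delta> \<notin> Sing} \<noteq> {}"
    using nonsingular_shift[of 1 A] by auto
qed (use assms in auto)

lemma Theta_prime_mono:
  assumes A: "A \<in> Sym" and B: "B \<in> Sym" and "psd (B - A)"
  shows "Theta_prime A \<le> Theta_prime B"
proof (rule le_Theta_prime)
  fix \<delta> :: real assume d: "\<delta> > 0" "B + mat \<delta> \<notin> Sing"
  obtain \<delta>' where d': "0 < \<delta>'" "\<delta>' \<le> \<delta>" "A + mat \<delta>' \<notin> Sing"
    using nonsingular_shift[OF d(1)] .
  have "Theta_prime A \<le> Theta_hat (A + mat \<delta>')" using d' by (intro Theta_prime_le) auto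
  also have "\<dots> \<le> Theta_hat (B + mat \<delta>)"
  proof (rule Theta_hat_mono)
    have "B + mat \<delta> - (A + mat \<delta>') = (B - A) + mat (\<delta> - \<delta>')"
      by (simp add: vec_eq_iff mat_def)
    then show "psd (B + mat \<delta> - (A + mat \<delta>'))"
      using assms(3) d'(2) by (simp only: psd_add psd_mat diff_ge_0_iff_ge)
  qed (use A B d d' in \<open>auto intro: Sym_add Sym_mat\<close>)
  finally show "Theta_prime A \<le> Theta_hat (B + mat \<delta>)" .
qed

lemma norm_mat_le: "norm (mat \<delta> :: real ^ 'k::finite ^ 'k) \<le> real CARD('k) * \<bar>\<delta>\<bar>"
proof -
  have "norm (mat \<delta> $ i :: real ^ 'k) \<le> \<bar>\<delta>\<bar>" for i :: 'k
  proof -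
    have "norm (mat \<delta> $ i :: real ^ 'k) \<le> (\<Sum>j\<in>UNIV. \<bar>(mat \<delta> $ i :: real ^ 'k) $ j\<bar>)"
      by (rule norm_le_l1_cart)
    also have "\<dots> = (\<Sum>j\<in>UNIV. if i = j then \<bar>\<delta>\<bar> else 0)" by (intro sum.cong) (auto simp: mat_def)
    finally show ?thesis by simp
  qed
  then have "(\<Sum>i\<in>UNIV. norm (mat \<delta> $ i :: real ^ 'k)) \<le> (\<Sum>i\<in>(UNIV::'k set). \<bar>\<delta>\<bar>)"
    by (rule sum_mono)
  moreover have "norm (mat \<delta> :: real ^ 'k ^ 'k) \<le> (\<Sum>i\<in>UNIV. norm (mat \<delta> $ i :: real ^ 'k))"
    unfolding norm_vec_def[of "mat \<delta>"] by (rule L2_set_le_sum) simp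
  ultimately show ?thesis by simp
qed

text \<open>If \<open>Theta_hat (A + mat \<delta>) < a\<close>, the same shifted matrix dominates
  small shifts of every \<open>B\<close> close to \<open>A\<close>: one half of \<delta> absorbs the
  shift of \<open>B\<close>, the other half the distance from \<open>A\<close> to
  \<open>B\<close>.\<close>

lemma usc_Theta_prime: "usc_on Sym (Theta_prime :: real ^ 'n::finite option ^ 'n option \<Rightarrow> real)"
  unfolding usc_on_def openin_contains_ball
proof (intro allI conjI ballI)
  fix a and A :: "real ^ 'n option ^ 'n option" assume "A \<in> {x \<in> Sym. Theta_prime x < a}"
  then have A: "A \<in> Sym" "Theta_prime A < a" by auto
  then obtain \<delta> where d: "\<delta> > 0" "A + mat \<delta> \<notin> Sing" "Theta_hat (A + mat \<delta>) < a"
    using le_Theta_prime[of A a] by (meson not_less)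
  have "Theta_prime B < a" if B: "B \<in> Sym" "B \<in> ball A (\<delta> / 2)" for B
  proof -
    obtain \<delta>' where d': "0 < \<delta>'" "\<delta>' \<le> \<delta> / 2" "B + mat \<delta>' \<notin> Sing"
      using nonsingular_shift[of "\<delta> / 2"] d(1) by auto
    have "Theta_prime B \<le> Theta_hat (B + mat \<delta>')" using d' by (intro Theta_prime_le) auto
    also have "\<dots> \<le> Theta_hat (A + mat \<delta>)"
    proof (rule Theta_hat_mono)
      have "A + mat \<delta> - (B + mat \<delta>') = mat (\<delta> - \<delta>') + (A - B)"
        by (simp add: vec_eq_iff mat_def)
      moreover have "norm (A - B) \<le> \<delta> - \<delta>'" using B(2) d' by (simp add: dist_norm)
      ultimately show "psd (A + mat \<delta> - (B + mat \<delta>'))" by (simp only: psd_mat_add)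
    qed (use A B d d' in \<open>auto intro: Sym_add Sym_mat\<close>)
    finally show ?thesis using d by simp
  qed
  then show "\<exists>e>0. ball A e \<inter> Sym \<subseteq> {x \<in> Sym. Theta_prime x < a}"
    using d(1) by (intro exI[of _ "\<delta> / 2"]) auto
qed auto

text \<open>Continuity at a nonsingular matrix gives one inequality through small shifts,
  monotonicity the other.\<close>

lemma Theta_prime_nonsingular:
  fixes A :: "real ^ 'n::finite option ^ 'n option"
  assumes A: "A \<in> Sym - Sing"
  shows "Theta_prime A = Theta_hat A"
proof (rule antisym)
  let ?e = "\<lambda>n. inverse (real (Suc n))"
  have "(\<lambda>n. mat (?e n) :: real ^ 'n option ^ 'n option) \<longlonglongrightarrow> mat 0"
  proof (intro vec_tendstoI)
    fix i j
    show "(\<lambda>n. (mat (?e n) :: real ^ 'n option ^ 'n option) $ i $ j) \<longlonglongrightarrow> mat 0 $ i $ j"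
      using LIMSEQ_inverse_real_of_nat by (cases "i = j") (simp_all add: mat_def)
  qed
  then have "(\<lambda>n. A + mat (?e n)) \<longlonglongrightarrow> A + mat 0" by (intro tendsto_intros)
  moreover have "A + mat 0 = A" by (simp add: vec_eq_iff mat_def)
  ultimately have lim: "(\<lambda>n. Theta_hat (A + mat (?e n))) \<longlonglongrightarrow> Theta_hat A"
    using Theta_hat_tendsto[OF _ A] by simp
  have "eventually (\<lambda>n. A + mat (?e n) \<notin> Sing) sequentially"
  proof (cases "\<exists>m. A + mat (?e m) \<in> Sing")
    case True
    then obtain m where m: "A + mat (?e m) \<in> Sing" by blast
    have "A + mat (?e n) \<notin> Sing" if "n > m" for n
      using Sing_mat_unique[OF m, of "?e n"] that by auto
    then show ?thesis by (metis eventually_at_top_dense)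
  qed auto
  then have "eventually (\<lambda>n. Theta_prime A \<le> Theta_hat (A + mat (?e n))) sequentially"
    by eventually_elim (auto intro!: Theta_prime_le)
  with lim show "Theta_prime A \<le> Theta_hat A"
    by (intro tendsto_lowerbound) auto
  show "Theta_hat A \<le> Theta_prime A"
  proof (rule le_Theta_prime)
    fix \<delta> :: real assume "\<delta> > 0" "A + mat \<delta> \<notin> Sing"
    then show "Theta_hat A \<le> Theta_hat (A + mat \<delta>)"
      using A by (intro Theta_hat_mono) (auto intro: Sym_add Sym_mat psd_mat)
  qed
qed

text \<open>A competitor smaller than \<open>Theta_prime A\<close> at \<open>A\<close> stays below
  this number near \<open>A\<close>, in particular at a small nonsingular shift of \<open>A\<close>.
  There it equals \<open>Theta_hat\<close>, which is not below the infimum. So the infimum in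
  \<open>Theta_tilde\<close> is a minimum, attained by \<open>Theta_prime\<close>.\<close>

lemma Theta_tilde_eq:
  fixes A :: "real ^ 'n::finite option ^ 'n option"
  assumes A: "A \<in> Sym"
  shows "Theta_tilde A = Theta_prime A"
  unfolding Theta_tilde_def
proof (rule cInf_eq_minimum)
  show "Theta_prime A \<in> {f A |f. usc_on Sym f \<and> (\<forall>B\<in>Sym - Sing. f B = Theta_hat B)}"
    using usc_Theta_prime Theta_prime_nonsingular by blast
next
  fix y assume "y \<in> {f A |f. usc_on Sym f \<and> (\<forall>B\<in>Sym - Sing. f B = Theta_hat B)}"
  then obtain f where f: "y = f A" "usc_on Sym f" "\<And>B. B \<in> Sym - Sing \<Longrightarrow> f B = Theta_hat B" by blast
  show "Theta_prime A \<le> y"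
  proof (rule ccontr)
    assume "\<not> Theta_prime A \<le> y"
    then have "A \<in> {x \<in> Sym. f x < Theta_prime A}" using f(1) A by simp
    moreover have "openin (top_of_set Sym) {x \<in> Sym. f x < Theta_prime A}"
      using f(2) by (simp add: usc_on_def)
    ultimately obtain e where e: "e > 0" "ball A e \<inter> Sym \<subseteq> {x \<in> Sym. f x < Theta_prime A}"
      by (auto simp: openin_contains_ball)
    \<comment> \<open>By \<open>norm_mat_le\<close> the matrix \<open>mat \<delta>\<close> has norm
      at most \<open>N * \<delta>\<close>; the 2 in the bound \<open>e / (2 * N)\<close> makes the
      ball condition strict.\<close>
    define N where "N = real CARD('n option)"
    have N: "N > 0" by (simp add: N_def)
    obtain \<delta> where d: "0 < \<delta>" "\<delta> \<le> e / (2 * N)" "A + mat \<delta> \<notin> Sing"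
      using nonsingular_shift[of "e / (2 * N)"] e(1) N by auto
    have "norm (mat \<delta> :: real ^ 'n option ^ 'n option) \<le> N * (e / (2 * N))"
      using d(1) N norm_mat_le[of \<delta>, where 'k="'n option"]
      by (intro order_trans[OF _ mult_left_mono[OF d(2)]]) (auto simp: N_def)
    also have "\<dots> = e / 2" using N by simp
    also have "\<dots> < e" using e by simp
    finally have "A + mat \<delta> \<in> ball A e" by (simp add: dist_norm)
    then have "f (A + mat \<delta>) < Theta_prime A" using e(2) Sym_add[OF A Sym_mat] by blast
    moreover have "f (A + mat \<delta>) = Theta_hat (A + mat \<delta>)" using A d by (intro f(3)) (auto intro: Sym_add Sym_mat)
    ultimately show False using Theta_prime_le[OF d(1,3)] by simp
  qed
qed

lemma Theta_tilde_mono: "A \<in> Sym \<Longrightarrow> B \<in> Sym \<Longrightarrow> psd (B - A) \<Longrightarrow> Theta_tilde A \<le> Theta_tilde B"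
  by (simp add: Theta_tilde_eq Theta_prime_mono)

lemma closed_Sym: "closed (Sym :: (real ^ 'k::finite ^ 'k) set)"
proof -
  have Sym_eq: "Sym = (\<Inter>i. \<Inter>j. {A :: real ^ 'k ^ 'k. A $ i $ j = A $ j $ i})" by (auto simp: mem_Sym)
  show ?thesis unfolding Sym_eq by (intro closed_INT ballI closed_Collect_eq continuous_intros)
qed

text \<open>Upper semicontinuity makes the strict sublevel set open relative to \<open>Sym\<close>,
  and \<open>Sym\<close> is closed.\<close>

lemma Theta_tilde_closed: "closed {A \<in> Sym. c \<le> Theta_tilde (A :: real ^ 'n::finite option ^ 'n option)}"
proof -
  have "{A \<in> Sym. c \<le> Theta_tilde (A :: real ^ 'n option ^ 'n option)} = Sym - {A \<in> Sym. Theta_prime A < c}"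
    by (auto simp: Theta_tilde_eq)
  moreover have "closedin (top_of_set Sym) (Sym - {A \<in> Sym. Theta_prime (A :: real ^ 'n option ^ 'n option) < c})"
    using usc_Theta_prime by (intro closedin_diff) (auto simp: usc_on_def)
  ultimately show ?thesis using closedin_closed_trans[OF _ closed_Sym] by simp
qed

section \<open>Invariance under orthogonal changes that fix the first axis\<close>

definition cmat :: "real ^ 'k::finite ^ 'k \<Rightarrow> complex ^ 'k ^ 'k" where
  "cmat M = (\<chi> i j. of_real (M $ i $ j))"

lemma matrix_mult_right_add: "(A + B) ** C = A ** C + B ** C"
  by (simp add: vec_eq_iff matrix_matrix_mult_def distrib_right sum.distrib)

lemma matrix_mult_left_diff:
  fixes A :: "'a::comm_ring_1 ^ 'k::finite ^ 'm"
  shows "A ** (B - C) = A ** B - A ** C"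
  by (simp add: vec_eq_iff matrix_matrix_mult_def right_diff_distrib sum_subtractf)

lemma matrix_mult_right_diff:
  fixes A :: "'a::comm_ring_1 ^ 'k::finite ^ 'm"
  shows "(A - B) ** C = A ** C - B ** C"
  by (simp add: vec_eq_iff matrix_matrix_mult_def left_diff_distrib sum_subtractf)

lemma cmat_mult: "cmat (M ** N) = cmat M ** cmat N"
  by (simp add: cmat_def matrix_matrix_mult_def vec_eq_iff)

lemma mat_mult_matrix: "mat c ** M = (\<chi> i j. c * M $ i $ j)"
  by (simp add: vec_eq_iff matrix_matrix_mult_def mat_def if_distrib[where f="\<lambda>x. x * _"] cong: if_cong)

lemma matrix_mult_mat: "M ** mat c = (\<chi> i j. M $ i $ j * c)"
  by (simp add: vec_eq_iff matrix_matrix_mult_def mat_def if_distrib[where f="\<lambda>x. _ * x"] cong: if_cong)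

lemma sum_UNIV_option: "(\<Sum>k\<in>UNIV. f k) = f None + (\<Sum>i\<in>(UNIV::'n::finite set). f (Some i))"
  by (subst UNIV_option_conv, subst sum.insert) (auto simp: sum.reindex)

text \<open>An orthogonal \<open>Q\<close> that fixes the first axis commutes with I_n, so
  conjugation by \<open>Q\<close> is a similarity of I_n + iB and preserves the characteristic
  polynomial.\<close>

lemma Theta_hat_conj:
  fixes B Q :: "real ^ 'n::finite option ^ 'n option"
  assumes Q: "Q ** transpose Q = mat 1" and Q0: "\<And>k. Q $ k $ None = (if k = None then 1 else 0)"
  shows "Theta_hat (Q ** B ** transpose Q) = Theta_hat B"
proof -
  define D :: "real ^ 'n option ^ 'n option" where "D = (\<chi> k l. if k = l \<and> k \<noteq> None then 1 else 0)"
  have I: "I_plus_iA X = cmat D + mat \<i> ** cmat X" for X :: "real ^ 'n option ^ 'n option"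
    by (simp add: I_plus_iA_def cmat_def D_def mat_mult_matrix vec_eq_iff) (metis not_None_eq)
  have D: "Q ** D ** transpose Q = D"
  proof -
    \<comment> \<open>\<open>D\<close> is the identity minus the projection onto the first axis, so
      its conjugate is \<open>Q ** transpose Q\<close> minus the product of the first column of
      \<open>Q\<close> with its transpose.\<close>
    have "(Q ** D ** transpose Q) $ k $ l = (Q ** transpose Q) $ k $ l - Q $ k $ None * Q $ l $ None" for k l
      by (simp add: matrix_matrix_mult_def D_def transpose_def sum_UNIV_option
            if_distrib[where f="\<lambda>x. _ * x"] cong: if_cong)
    then show ?thesis by (auto simp: vec_eq_iff Q Q0 D_def mat_def)
  qed
  define U V where "U = cmat Q" and "V = cmat (transpose Q)"
  have UV: "U ** V = mat 1" by (simp add: U_def V_def cmat_mult[symmetric] Q) (simp add: cmat_def mat_def vec_eq_iff)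
  have c: "U ** mat x = mat x ** U" for x by (simp add: mat_mult_matrix matrix_mult_mat mult.commute)
  have "poly (charpoly (I_plus_iA (Q ** B ** transpose Q))) x = poly (charpoly (I_plus_iA B)) x" for x
  proof -
    have "U ** mat x ** V = mat x" by (simp only: c matrix_mul_assoc[symmetric] UV matrix_mul_rid)
    moreover have "U ** cmat D ** V = cmat D" using D by (simp only: U_def V_def cmat_mult[symmetric])
    moreover have "U ** (mat \<i> ** cmat B) ** V = mat \<i> ** cmat (Q ** B ** transpose Q)"
      by (simp only: matrix_mul_assoc c) (simp only: U_def V_def cmat_mult matrix_mul_assoc)
    ultimately have "mat x - I_plus_iA (Q ** B ** transpose Q) = U ** (mat x - I_plus_iA B) ** V"
      by (simp only: I matrix_add_ldistrib matrix_mult_left_diff matrix_mult_right_add matrix_mult_right_diff)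
    moreover have "det U * det V = 1" using UV det_mul[of U V] by simp
    ultimately show ?thesis by (simp add: poly_charpoly det_mul mult_ac)
  qed
  then have "charpoly (I_plus_iA (Q ** B ** transpose Q)) = charpoly (I_plus_iA B)"
    by (intro poly_eq_poly_eq_iff[THEN iffD1]) auto
  then show ?thesis by (simp add: Theta_hat_eq argdet_def)
qed

lemma Sing_conj:
  fixes B Q :: "real ^ 'n::finite option ^ 'n option"
  assumes Q0: "\<And>k. Q $ k $ None = (if k = None then 1 else 0)"
    and Q1: "\<And>k. Q $ None $ k = (if k = None then 1 else 0)"
    and B: "B \<in> Sing"
  shows "Q ** B ** transpose Q \<in> Sing"
proof -
  have "(Q ** B ** transpose Q) $ None $ k = 0" "(Q ** B ** transpose Q) $ k $ None = 0" for k
    using B by (simp_all add: Sing_def matrix_matrix_mult_def transpose_def Q0 Q1 Q1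
       if_distrib[where f="\<lambda>x. x * _"] if_distrib[where f="\<lambda>x. _ * x"] cong: if_cong)
  moreover have "Q ** B ** transpose Q \<in> Sym"
    using B by (simp add: Sing_def Sym_def matrix_transpose_mul matrix_mul_assoc)
  ultimately show ?thesis by (simp add: Sing_def)
qed

text \<open>Conjugation fixes \<open>mat \<delta>\<close> and preserves \<open>Sing\<close> in both
  directions, so the two infima run over the same values.\<close>

lemma Theta_tilde_conj:
  fixes A Q :: "real ^ 'n::finite option ^ 'n option"
  assumes A: "A \<in> Sym" and Q: "Q ** transpose Q = mat 1"
    and Q0: "\<And>k. Q $ k $ None = (if k = None then 1 else 0)"
    and Q1: "\<And>k. Q $ None $ k = (if k = None then 1 else 0)"
  shows "Theta_tilde (Q ** A ** transpose Q) = Theta_tilde A"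
proof -
  have Q': "transpose Q ** Q = mat 1" using Q matrix_left_right_inverse by blast
  have inverse_conj: "transpose Q ** (Q ** B ** transpose Q) ** Q = B" for B
    by (metis Q' matrix_mul_assoc matrix_mul_lid matrix_mul_rid)
  have shift: "Q ** A ** transpose Q + mat \<delta> = Q ** (A + mat \<delta>) ** transpose Q" for \<delta>
  proof -
    have "Q ** mat \<delta> = mat \<delta> ** Q" by (simp add: mat_mult_matrix matrix_mult_mat mult.commute)
    then have "Q ** mat \<delta> ** transpose Q = mat \<delta>" by (metis Q matrix_mul_assoc matrix_mul_rid)
    then show ?thesis by (simp add: matrix_add_ldistrib matrix_mult_right_add)
  qed
  have Sing: "Q ** B ** transpose Q \<in> Sing \<longleftrightarrow> B \<in> Sing" for B
    using Sing_conj[OF Q0 Q1, of B] Sing_conj[of "transpose Q" "Q ** B ** transpose Q"] Q0 Q1 inverse_conj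
    by (auto simp: transpose_def)
  have "Q ** A ** transpose Q \<in> Sym"
    using A by (simp add: Sym_def matrix_transpose_mul matrix_mul_assoc)
  then show ?thesis
    by (simp add: Theta_tilde_eq A Theta_prime_def shift Sing Theta_hat_conj[OF Q Q0])
qed

section \<open>Smooth functions, tangent vectors and vector fields\<close>

lemma pd_has_derivative:
  "(F has_derivative F') (at a) \<Longrightarrow> pd i F a = F' (axis i 1)"
  by (simp add: pd_def frechet_derivative_at[symmetric])

lemma smooth_on_pd: "smooth_on S F \<Longrightarrow> smooth_on S (pd i F)"
  using smooth_on_frechet_derivative[of S F "axis i 1"] by (simp add: pd_def[abs_def])

lemma pd_cong:
  assumes "open S" "a \<in> S" "\<And>x. x \<in> S \<Longrightarrow> F x = G x" "smooth_on S F"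
  shows "pd i G a = pd i F a"
proof -
  have "(F has_derivative frechet_derivative F (at a)) (at a)"
    by (rule smooth_on_has_derivative[OF assms(4,2)])
  then have "(G has_derivative frechet_derivative F (at a)) (at a)"
    by (rule has_derivative_transform_within_open[OF _ assms(1,2)]) (rule assms(3))
  then show ?thesis by (simp add: pd_has_derivative) (simp add: pd_def)
qed

lemma sum_Basis_axis:
  fixes f :: "real ^ 'k::finite \<Rightarrow> real"
  shows "(\<Sum>b\<in>Basis. f b) = (\<Sum>i\<in>UNIV. f (axis i 1))"
proof -
  have "Basis = range (\<lambda>i. axis i (1::real) :: real ^ 'k)" by (auto simp: Basis_vec_def)
  moreover have "inj (\<lambda>i. axis i (1::real) :: real ^ 'k)" by (auto simp: inj_on_def axis_eq_axis)
  ultimately show ?thesis by (metis (no_types, lifting) sum.reindex o_apply sum.cong)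
qed

section \<open>Charts and germs of smooth functions\<close>

locale atlas =
  fixes A :: "('m::{t2_space,second_countable_topology}, 'k::finite) chart set"
  assumes smooth_atlas: "smooth_atlas A"
begin

lemma chart_cover: obtains U \<phi> where "(U, \<phi>) \<in> A" "x \<in> U"
  using smooth_atlas unfolding smooth_atlas_def by blast

context
  fixes U \<phi> assumes chart: "(U, \<phi>) \<in> A"
begin

lemma chart_open: "open U" "open (\<phi> ` U)"
  using smooth_atlas chart unfolding smooth_atlas_def by auto

lemma chart_homeomorphism: "homeomorphism U (\<phi> ` U) \<phi> (inv_into U \<phi>)"
  using smooth_atlas chart unfolding smooth_atlas_def by auto

lemma chart_inverse [simp]: "x \<in> U \<Longrightarrow> inv_into U \<phi> (\<phi> x) = x"
  using chart_homeomorphism by (simp add: homeomorphism_def)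

lemma chart_continuous: "continuous_on U \<phi>" "continuous_on (\<phi> ` U) (inv_into U \<phi>)"
  using chart_homeomorphism by (simp_all add: homeomorphism_def)

lemma chart_inj: "inj_on \<phi> U"
  by (metis chart_inverse inj_on_inverseI)

lemma chart_open_image:
  assumes "open W" "W \<subseteq> U"
  shows "open (\<phi> ` W)"
proof -
  have "\<phi> ` W = \<phi> ` U \<inter> inv_into U \<phi> -` W" using assms(2) by auto
  then show ?thesis
    using continuous_open_preimage[OF chart_continuous(2) chart_open(2) assms(1)] by simp
qed

lemma smooth_transition:
  "(V, \<xi>) \<in> A \<Longrightarrow> smooth_on (\<xi> ` (V \<inter> U)) (\<phi> \<circ> inv_into V \<xi>)"
  using smooth_atlas chart unfolding smooth_atlas_def by fast

text \<open>Smooth transition maps carry smoothness from one chart to all others, so a single chart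
  around \<open>W\<close> decides.\<close>

lemma smooth_fun_chart:
  assumes W: "open W" "W \<subseteq> U"
  shows "smooth_fun_on A W f \<longleftrightarrow> smooth_on (\<phi> ` W) (f \<circ> inv_into U \<phi>)"
proof
  assume "smooth_fun_on A W f"
  then have "smooth_on (\<phi> ` (U \<inter> W)) (f \<circ> inv_into U \<phi>)"
    using chart unfolding smooth_fun_on_def by auto
  moreover have "U \<inter> W = W" using W by auto
  ultimately show "smooth_on (\<phi> ` W) (f \<circ> inv_into U \<phi>)" by simp
next
  assume f: "smooth_on (\<phi> ` W) (f \<circ> inv_into U \<phi>)"
  show "smooth_fun_on A W f"
    unfolding smooth_fun_on_def
  proof (clarify)
    fix V \<xi> assume V: "(V, \<xi>) \<in> A"
    have inv: "inv_into V \<xi> (\<xi> y) = y" if "y \<in> V" for y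
      by (rule atlas.chart_inverse[OF atlas_axioms V that])
    have o: "open (\<xi> ` (V \<inter> W))"
      using atlas.chart_open_image[OF atlas_axioms V, of "V \<inter> W"] atlas.chart_open[OF atlas_axioms V] W by auto
    have "smooth_on (\<xi> ` (V \<inter> W)) (\<lambda>a. (f \<circ> inv_into U \<phi>) ((\<phi> \<circ> inv_into V \<xi>) a))"
    proof (rule smooth_on_compose[OF o chart_open_image[OF W] _ _ f])
      show "(\<phi> \<circ> inv_into V \<xi>) ` \<xi> ` (V \<inter> W) \<subseteq> \<phi> ` W" using inv by auto
      show "smooth_on (\<xi> ` (V \<inter> W)) (\<phi> \<circ> inv_into V \<xi>)"
        by (rule smooth_on_subset[OF smooth_transition[OF V]]) (use W in auto)
    qed
    then show "smooth_on (\<xi> ` (V \<inter> W)) (f \<circ> inv_into V \<xi>)"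
      by (rule smooth_on_cong[OF o, rotated]) (use inv W in auto)
  qed
qed

lemma smooth_near_chart:
  assumes "x \<in> U"
  shows "smooth_near A x f \<longleftrightarrow> (\<exists>W. open W \<and> x \<in> W \<and> W \<subseteq> U \<and> smooth_on (\<phi> ` W) (f \<circ> inv_into U \<phi>))"
proof
  assume "smooth_near A x f"
  then obtain W where W: "open W" "x \<in> W" "smooth_fun_on A W f" by (auto simp: smooth_near_def)
  then have "smooth_on (\<phi> ` (U \<inter> W)) (f \<circ> inv_into U \<phi>)" using chart by (auto simp: smooth_fun_on_def)
  then show "\<exists>W. open W \<and> x \<in> W \<and> W \<subseteq> U \<and> smooth_on (\<phi> ` W) (f \<circ> inv_into U \<phi>)"
    using W assms chart_open by (intro exI[of _ "U \<inter> W"]) auto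
next
  assume "\<exists>W. open W \<and> x \<in> W \<and> W \<subseteq> U \<and> smooth_on (\<phi> ` W) (f \<circ> inv_into U \<phi>)"
  then show "smooth_near A x f" using smooth_fun_chart by (auto simp: smooth_near_def)
qed

end

lemma smooth_fun_on_subset:
  assumes "smooth_fun_on A W f" "W' \<subseteq> W"
  shows "smooth_fun_on A W' f"
  unfolding smooth_fun_on_def
proof clarify
  fix U \<phi> assume "(U, \<phi>) \<in> A"
  then have "smooth_on (\<phi> ` (U \<inter> W)) (f \<circ> inv_into U \<phi>)"
    using assms(1) by (auto simp: smooth_fun_on_def)
  then show "smooth_on (\<phi> ` (U \<inter> W')) (f \<circ> inv_into U \<phi>)"
    by (rule smooth_on_subset) (use assms(2) in auto)
qed

lemma smooth_nearE:
  assumes "smooth_near A x f" "open O'" "x \<in> O'"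
  obtains W where "open W" "x \<in> W" "W \<subseteq> O'" "smooth_fun_on A W f"
proof -
  from assms(1) obtain W where "open W" "x \<in> W" "smooth_fun_on A W f" by (auto simp: smooth_near_def)
  then show ?thesis using that[of "W \<inter> O'"] assms(2,3) smooth_fun_on_subset by auto
qed

text \<open>Differentiability is local in each chart. This lets smoothness on an open set be checked
  point by point through germs.\<close>

lemma smooth_fun_on_iff:
  assumes W: "open W"
  shows "smooth_fun_on A W f \<longleftrightarrow> (\<forall>x\<in>W. smooth_near A x f)"
proof
  assume "smooth_fun_on A W f" then show "\<forall>x\<in>W. smooth_near A x f" using W by (auto simp: smooth_near_def)
next
  assume near: "\<forall>x\<in>W. smooth_near A x f"
  show "smooth_fun_on A W f"
    unfolding smooth_fun_on_def
  proof clarify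
    fix U \<phi> assume chart: "(U, \<phi>) \<in> A"
    show "smooth_on (\<phi> ` (U \<inter> W)) (f \<circ> inv_into U \<phi>)"
    proof (rule smooth_on_local)
      fix a assume "a \<in> \<phi> ` (U \<inter> W)"
      then obtain x where x: "a = \<phi> x" "x \<in> U" "x \<in> W" by auto
      then obtain O' where O': "open O'" "x \<in> O'" "O' \<subseteq> U" "smooth_on (\<phi> ` O') (f \<circ> inv_into U \<phi>)"
        using near smooth_near_chart[OF chart x(2)] by blast
      then show "\<exists>T. open T \<and> a \<in> T \<and> smooth_on T (f \<circ> inv_into U \<phi>)"
        using chart_open_image[OF chart O'(1,3)] x(1) by blast
    qed
  qed
qed

lemma smooth_near_nhd:
  assumes "smooth_near A x f"
  obtains W where "open W" "x \<in> W" "\<And>y. y \<in> W \<Longrightarrow> smooth_near A y f"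
  using assms smooth_fun_on_iff unfolding smooth_near_def by blast

lemma smooth_near_cong:
  assumes "smooth_near A x f" "open W" "x \<in> W" "\<And>y. y \<in> W \<Longrightarrow> f y = h y"
  shows "smooth_near A x h"
proof -
  obtain U \<phi> where U: "(U, \<phi>) \<in> A" "x \<in> U" by (rule chart_cover)
  obtain W' where W': "open W'" "x \<in> W'" "W' \<subseteq> W \<inter> U" "smooth_fun_on A W' f"
    using smooth_nearE[OF assms(1), of "W \<inter> U"] assms(2,3) U chart_open[OF U(1)] by auto
  have f: "smooth_on (\<phi> ` W') (f \<circ> inv_into U \<phi>)"
    using smooth_fun_chart[OF U(1) W'(1)] W' by auto
  have "smooth_on (\<phi> ` W') (h \<circ> inv_into U \<phi>)"
  proof (rule smooth_on_cong[OF _ _ f])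
    show "open (\<phi> ` W')" using chart_open_image[OF U(1) W'(1)] W'(3) by auto
    fix a assume "a \<in> \<phi> ` W'"
    then obtain y where y: "y \<in> W'" "a = \<phi> y" by auto
    then have "inv_into U \<phi> a = y" using chart_inverse[OF U(1)] W'(3) by auto
    then show "(f \<circ> inv_into U \<phi>) a = (h \<circ> inv_into U \<phi>) a" using assms(4) W'(3) y by auto
  qed
  then show ?thesis unfolding smooth_near_chart[OF U] using W' by auto
qed

lemma smooth_near_binop:
  assumes op: "\<And>S (F::real^'k \<Rightarrow> real) G. open S \<Longrightarrow> smooth_on S F \<Longrightarrow> smooth_on S G \<Longrightarrow> smooth_on S (\<lambda>a. op (F a) (G a))"
    and "smooth_near A x f" "smooth_near A x h"
  shows "smooth_near A x (\<lambda>y. op (f y) (h y))"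
proof -
  obtain U \<phi> where U: "(U, \<phi>) \<in> A" "x \<in> U" by (rule chart_cover)
  obtain W where W: "open W" "x \<in> W" "W \<subseteq> U" "smooth_on (\<phi> ` W) (f \<circ> inv_into U \<phi>)"
    using assms(2) smooth_near_chart[OF U] by auto
  obtain W' where W': "open W'" "x \<in> W'" "W' \<subseteq> U" "smooth_on (\<phi> ` W') (h \<circ> inv_into U \<phi>)"
    using assms(3) smooth_near_chart[OF U] by auto
  have "smooth_on (\<phi> ` (W \<inter> W')) (\<lambda>a. op ((f \<circ> inv_into U \<phi>) a) ((h \<circ> inv_into U \<phi>) a))"
    using W W' by (intro op chart_open_image[OF U(1)] smooth_on_subset[OF W(4)] smooth_on_subset[OF W'(4)]) auto
  then show ?thesis unfolding smooth_near_chart[OF U] using W W'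
    by (intro exI[of _ "W \<inter> W'"]) (auto simp: o_def)
qed

lemma smooth_near_add: "smooth_near A x f \<Longrightarrow> smooth_near A x h \<Longrightarrow> smooth_near A x (\<lambda>y. f y + h y)"
  by (rule smooth_near_binop[of "(+)"]) (auto intro: smooth_on_add)

lemma smooth_near_mult: "smooth_near A x f \<Longrightarrow> smooth_near A x h \<Longrightarrow> smooth_near A x (\<lambda>y. f y * h y)"
  by (rule smooth_near_binop[of "(*)"]) (auto intro: smooth_on_mult)

lemma smooth_near_const: "smooth_near A x (\<lambda>y. c)"
proof -
  obtain U \<phi> where U: "(U, \<phi>) \<in> A" "x \<in> U" by (rule chart_cover)
  then show ?thesis unfolding smooth_near_chart[OF U]
    using chart_open[OF U(1)] by (intro exI[of _ U]) (auto simp: o_def intro: smooth_on_const)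
qed

lemma smooth_near_scale: "smooth_near A x f \<Longrightarrow> smooth_near A x (\<lambda>y. c * f y)"
  by (intro smooth_near_mult smooth_near_const)

lemma smooth_near_minus: "smooth_near A x f \<Longrightarrow> smooth_near A x h \<Longrightarrow> smooth_near A x (\<lambda>y. f y - h y)"
  using smooth_near_add[of x f "\<lambda>y. (-1) * h y"] smooth_near_scale[of x h "-1"] by simp

lemma smooth_near_sum: "(\<And>i. i \<in> I \<Longrightarrow> smooth_near A x (f i)) \<Longrightarrow> smooth_near A x (\<lambda>y. \<Sum>i\<in>I. f i y)"
  by (induction I rule: infinite_finite_induct) (auto intro: smooth_near_const smooth_near_add)

lemma smooth_near_compose:
  assumes f: "smooth_near A x f" and h: "open T" "smooth_on T h" "f x \<in> T"
  shows "smooth_near A x (\<lambda>y. h (f y :: real))"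
proof -
  obtain U \<phi> where U: "(U, \<phi>) \<in> A" "x \<in> U" by (rule chart_cover)
  obtain W where W: "open W" "x \<in> W" "W \<subseteq> U" "smooth_on (\<phi> ` W) (f \<circ> inv_into U \<phi>)"
    using f smooth_near_chart[OF U] by auto
  note oW = chart_open_image[OF U(1) W(1,3)]
  define S where "S = \<phi> ` W \<inter> (f \<circ> inv_into U \<phi>) -` T"
  have S: "open S" unfolding S_def
    by (rule continuous_open_preimage[OF smooth_on_imp_continuous_on[OF W(4)] oW h(1)])
  define W' where "W' = U \<inter> \<phi> -` S"
  have W': "open W'" unfolding W'_def
    by (rule continuous_open_preimage[OF chart_continuous(1)[OF U(1)] chart_open(1)[OF U(1)] S])
  have im: "\<phi> ` W' = S" using W(3) by (auto simp: W'_def S_def)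
  have "smooth_on S (\<lambda>a. h ((f \<circ> inv_into U \<phi>) a))"
    by (rule smooth_on_compose[OF S h(1) _ smooth_on_subset[OF W(4)] h(2)]) (auto simp: S_def)
  moreover have "x \<in> W'" using U W(2) h(3) by (auto simp: W'_def S_def chart_inverse[OF U(1)])
  ultimately show ?thesis unfolding smooth_near_chart[OF U] using W' im
    by (intro exI[of _ W']) (auto simp: o_def W'_def)
qed

lemma smooth_near_coord:
  assumes U: "(U, \<phi>) \<in> A" "x \<in> U"
  shows "smooth_near A x (\<lambda>y. \<phi> y $ i)"
proof -
  have "smooth_on (\<phi> ` U) (\<lambda>a. a $ i)"
    by (intro smooth_on_bounded_linear chart_open[OF U(1)] bounded_linear_vec_nth)
  then have "smooth_on (\<phi> ` U) ((\<lambda>y. \<phi> y $ i) \<circ> inv_into U \<phi>)"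
    by (rule smooth_on_cong[OF chart_open(2)[OF U(1)], rotated]) (auto simp: chart_inverse[OF U(1)])
  then show ?thesis unfolding smooth_near_chart[OF U] using chart_open[OF U(1)] U by blast
qed

lemma smooth_near_comp_coord:
  assumes U: "(U, \<phi>) \<in> A" "x \<in> U" and F: "open S" "\<phi> x \<in> S" "smooth_on S F"
  shows "smooth_near A x (\<lambda>y. F (\<phi> y))"
proof -
  define W where "W = U \<inter> \<phi> -` S"
  have W: "open W" unfolding W_def
    by (rule continuous_open_preimage[OF chart_continuous(1)[OF U(1)] chart_open(1)[OF U(1)] F(1)])
  have "smooth_on (\<phi> ` W) ((\<lambda>y. F (\<phi> y)) \<circ> inv_into U \<phi>)"
  proof (rule smooth_on_cong)
    show "open (\<phi> ` W)" using chart_open_image[OF U(1) W] by (auto simp: W_def)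
    show "smooth_on (\<phi> ` W) F" by (rule smooth_on_subset[OF F(3)]) (auto simp: W_def)
  qed (auto simp: W_def chart_inverse[OF U(1)])
  then show ?thesis unfolding smooth_near_chart[OF U] using W F(2) U(2) by (auto simp: W_def)
qed

section \<open>Tangent vectors as derivations\<close>

lemma tangent_lincomb:
  "X \<in> tangent_space A x \<Longrightarrow> smooth_near A x f \<Longrightarrow> smooth_near A x h \<Longrightarrow>
   X (\<lambda>y. a * f y + b * h y) = a * X f + b * X h"
  unfolding tangent_space_def by blast

lemma tangent_mult:
  "X \<in> tangent_space A x \<Longrightarrow> smooth_near A x f \<Longrightarrow> smooth_near A x h \<Longrightarrow>
   X (\<lambda>y. f y * h y) = f x * X h + h x * X f"
  unfolding tangent_space_def by blast

lemma tangent_nonsmooth: "X \<in> tangent_space A x \<Longrightarrow> \<not> smooth_near A x f \<Longrightarrow> X f = 0"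
  unfolding tangent_space_def by blast

text \<open>Nonsmooth functions are covered as well: if \<open>f\<close> is not smooth near
  \<open>x\<close>, neither is \<open>h\<close>, and both values are the default 0.\<close>

lemma tangent_cong:
  assumes X: "X \<in> tangent_space A x" and W: "open W" "x \<in> W" "\<And>y. y \<in> W \<Longrightarrow> f y = h y"
  shows "X f = X h"
proof (cases "smooth_near A x f")
  case True
  then have "smooth_near A x h" using smooth_near_cong W by blast
  moreover have "eventually (\<lambda>y. f y = h y) (nhds x)" using W eventually_nhds by blast
  ultimately show ?thesis using X True unfolding tangent_space_def by blast
next
  case False
  then have "\<not> smooth_near A x h" using smooth_near_cong[of x h W f] W by auto
  then show ?thesis using X False tangent_nonsmooth by metis
qed

lemma tangent_add:
  "X \<in> tangent_space A x \<Longrightarrow> smooth_near A x f \<Longrightarrow> smooth_near A x h \<Longrightarrow> X (\<lambda>y. f y + h y) = X f + X h"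
  using tangent_lincomb[of X x f h 1 1] by simp

lemma tangent_minus:
  "X \<in> tangent_space A x \<Longrightarrow> smooth_near A x f \<Longrightarrow> smooth_near A x h \<Longrightarrow> X (\<lambda>y. f y - h y) = X f - X h"
  using tangent_lincomb[of X x f h 1 "-1"] by simp

lemma tangent_const: "X \<in> tangent_space A x \<Longrightarrow> X (\<lambda>y. c) = 0"
  using tangent_mult[of X x "\<lambda>y. 1" "\<lambda>y. 1"] tangent_lincomb[of X x "\<lambda>y. 1" "\<lambda>y. 1" c 0]
  by (simp add: smooth_near_const)

lemma tangent_scale: "X \<in> tangent_space A x \<Longrightarrow> smooth_near A x f \<Longrightarrow> X (\<lambda>y. c * f y) = c * X f"
  using tangent_lincomb[of X x f "\<lambda>y. 0" c 0] by (simp add: smooth_near_const)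

lemma tangent_sum:
  "X \<in> tangent_space A x \<Longrightarrow> (\<And>i. i \<in> I \<Longrightarrow> smooth_near A x (f i)) \<Longrightarrow>
   X (\<lambda>y. \<Sum>i\<in>I. f i y) = (\<Sum>i\<in>I. X (f i))"
proof (induction I rule: infinite_finite_induct)
  case (insert j I)
  then have "smooth_near A x (f j)" "smooth_near A x (\<lambda>y. \<Sum>i\<in>I. f i y)"
    by (auto intro: smooth_near_sum)
  note add = tangent_add[OF insert.prems(1) this]
  show ?case using insert by (simp add: add)
qed (simp_all add: tangent_const)

lemma tangent_space_lincomb:
  assumes "X \<in> tangent_space A x" "Y \<in> tangent_space A x"
  shows "(\<lambda>f. a * X f + b * Y f) \<in> tangent_space A x"
  unfolding tangent_space_def
proof (intro CollectI conjI allI impI)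
  note t = tangent_lincomb[OF assms(1)] tangent_lincomb[OF assms(2)]
    tangent_mult[OF assms(1)] tangent_mult[OF assms(2)]
  show "a * X (\<lambda>y. c * f y + d * h y) + b * Y (\<lambda>y. c * f y + d * h y) =
      c * (a * X f + b * Y f) + d * (a * X h + b * Y h)"
    "a * X (\<lambda>y. f y * h y) + b * Y (\<lambda>y. f y * h y) =
      f x * (a * X h + b * Y h) + h x * (a * X f + b * Y f)"
    if "smooth_near A x f" "smooth_near A x h" for f h c d
    using that by (simp_all add: t algebra_simps)
  fix f h :: "'m \<Rightarrow> real" assume "eventually (\<lambda>y. f y = h y) (nhds x)"
  then obtain N where N: "open N" "x \<in> N" "\<And>y. y \<in> N \<Longrightarrow> f y = h y" by (auto simp: eventually_nhds)
  show "a * X f + b * Y f = a * X h + b * Y h"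
    using tangent_cong[OF assms(1) N] tangent_cong[OF assms(2) N] by simp
next
  fix f assume "\<not> smooth_near A x f"
  then show "a * X f + b * Y f = 0"
    by (simp add: tangent_nonsmooth[OF assms(1)] tangent_nonsmooth[OF assms(2)])
qed

lemma tangent_space_zero: "(\<lambda>f. 0) \<in> tangent_space A x"
  unfolding tangent_space_def by simp

lemma tangent_space_sum:
  "(\<And>i. i \<in> I \<Longrightarrow> X i \<in> tangent_space A x) \<Longrightarrow> (\<lambda>f. \<Sum>i\<in>I. a i * X i f) \<in> tangent_space A x"
proof (induction I rule: infinite_finite_induct)
  case (insert i I)
  then have "(\<lambda>f. a i * X i f + 1 * (\<Sum>i\<in>I. a i * X i f)) \<in> tangent_space A x"
    by (intro tangent_space_lincomb) auto
  then show ?case using insert.hyps by simp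
qed (auto simp: tangent_space_zero)

text \<open>The coordinate vector field, with the cut-off to 0 that membership in
  \<open>tangent_space\<close> demands.\<close>

definition cvec :: "'m set \<Rightarrow> ('m \<Rightarrow> real ^ 'k) \<Rightarrow> 'k \<Rightarrow> 'm field" where
  "cvec U \<phi> i x f = (if smooth_near A x f then pd i (f \<circ> inv_into U \<phi>) (\<phi> x) else 0)"

lemma chart_smooth_germ:
  assumes U: "(U, \<phi>) \<in> A" "x \<in> U" and f: "smooth_near A x f"
  obtains r where "r > 0" "ball (\<phi> x) r \<subseteq> \<phi> ` U" "smooth_on (ball (\<phi> x) r) (f \<circ> inv_into U \<phi>)"
proof -
  obtain W where W: "open W" "x \<in> W" "W \<subseteq> U" "smooth_on (\<phi> ` W) (f \<circ> inv_into U \<phi>)"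
    using f smooth_near_chart[OF U] by auto
  then obtain r where "r > 0" "ball (\<phi> x) r \<subseteq> \<phi> ` W"
    using chart_open_image[OF U(1) W(1,3)] by (meson image_eqI open_contains_ball)
  then show ?thesis using that W smooth_on_subset by blast
qed

lemma chart_has_derivative:
  assumes U: "(U, \<phi>) \<in> A" "x \<in> U" and f: "smooth_near A x f"
  shows "((f \<circ> inv_into U \<phi>) has_derivative frechet_derivative (f \<circ> inv_into U \<phi>) (at (\<phi> x))) (at (\<phi> x))"
  using chart_smooth_germ[OF assms] smooth_on_has_derivative by (metis centre_in_ball)

lemma cvec_tangent:
  assumes U: "(U, \<phi>) \<in> A" "x \<in> U"
  shows "cvec U \<phi> i x \<in> tangent_space A x"
  unfolding tangent_space_def
proof (intro CollectI conjI allI impI)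
  fix f h a b assume fh: "smooth_near A x f" "smooth_near A x h"
  note D = chart_has_derivative[OF U fh(1)] chart_has_derivative[OF U fh(2)]
  have "(((\<lambda>y. a * f y + b * h y) \<circ> inv_into U \<phi>) has_derivative
     (\<lambda>v. a * frechet_derivative (f \<circ> inv_into U \<phi>) (at (\<phi> x)) v + b * frechet_derivative (h \<circ> inv_into U \<phi>) (at (\<phi> x)) v)) (at (\<phi> x))"
    using has_derivative_add[OF has_derivative_mult_right[OF D(1), of a] has_derivative_mult_right[OF D(2), of b]]
    by (simp add: o_def)
  then show "cvec U \<phi> i x (\<lambda>y. a * f y + b * h y) = a * cvec U \<phi> i x f + b * cvec U \<phi> i x h"
    using fh by (simp add: cvec_def pd_has_derivative[OF D(1)] pd_has_derivative[OF D(2)] pd_has_derivative smooth_near_add smooth_near_scale)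
next
  fix f h assume fh: "smooth_near A x f" "smooth_near A x h"
  note D = chart_has_derivative[OF U fh(1)] chart_has_derivative[OF U fh(2)]
  have "(((\<lambda>y. f y * h y) \<circ> inv_into U \<phi>) has_derivative
     (\<lambda>v. f x * frechet_derivative (h \<circ> inv_into U \<phi>) (at (\<phi> x)) v + frechet_derivative (f \<circ> inv_into U \<phi>) (at (\<phi> x)) v * h x)) (at (\<phi> x))"
    using has_derivative_mult[OF D] by (simp add: o_def chart_inverse[OF U])
  then show "cvec U \<phi> i x (\<lambda>y. f y * h y) = f x * cvec U \<phi> i x h + h x * cvec U \<phi> i x f"
    using fh by (simp add: cvec_def pd_has_derivative[OF D(1)] pd_has_derivative[OF D(2)] pd_has_derivative smooth_near_mult)
next
  fix f h assume fh: "smooth_near A x f" "smooth_near A x h" and "eventually (\<lambda>y. f y = h y) (nhds x)"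
  then obtain W where W: "open W" "x \<in> W" "\<And>y. y \<in> W \<Longrightarrow> f y = h y" by (auto simp: eventually_nhds)
  obtain W' where W': "open W'" "x \<in> W'" "W' \<subseteq> W \<inter> U" "smooth_fun_on A W' f"
    using smooth_nearE[OF fh(1), of "W \<inter> U"] W U chart_open[OF U(1)] by auto
  have "pd i (h \<circ> inv_into U \<phi>) (\<phi> x) = pd i (f \<circ> inv_into U \<phi>) (\<phi> x)"
  proof (rule pd_cong)
    show "open (\<phi> ` W')" using chart_open_image[OF U(1) W'(1)] W'(3) by auto
    show "smooth_on (\<phi> ` W') (f \<circ> inv_into U \<phi>)" using smooth_fun_chart[OF U(1) W'(1)] W' by auto
    show "\<phi> x \<in> \<phi> ` W'" using W' by auto
    fix a assume "a \<in> \<phi> ` W'"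
    then obtain y where y: "y \<in> W'" "a = \<phi> y" by auto
    then have "inv_into U \<phi> a = y" using chart_inverse[OF U(1)] W'(3) by auto
    then show "(f \<circ> inv_into U \<phi>) a = (h \<circ> inv_into U \<phi>) a" using W(3) W'(3) y by auto
  qed
  then show "cvec U \<phi> i x f = cvec U \<phi> i x h" using fh by (simp add: cvec_def)
qed (simp add: cvec_def)

lemma cvec_coord:
  assumes U: "(U, \<phi>) \<in> A" "x \<in> U"
  shows "cvec U \<phi> i x (\<lambda>y. \<phi> y $ j) = (if i = j then 1 else 0)"
proof -
  have "pd i ((\<lambda>y. \<phi> y $ j) \<circ> inv_into U \<phi>) (\<phi> x) = pd i (\<lambda>a. a $ j) (\<phi> x)"
    by (rule pd_cong[OF chart_open(2)[OF U(1)]])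
       (use U in \<open>auto simp: chart_inverse[OF U(1)] intro: smooth_on_bounded_linear chart_open[OF U(1)] bounded_linear_vec_nth\<close>)
  also have "\<dots> = axis i 1 $ j"
    by (rule pd_has_derivative) (intro bounded_linear_imp_has_derivative bounded_linear_vec_nth)
  finally show ?thesis using smooth_near_coord[OF U] by (simp add: cvec_def axis_def)
qed

text \<open>Tangent vectors are derivations of germs, so that the expansion in coordinate vectors
  rests on Hadamard's lemma.\<close>

lemma tangent_expand:
  assumes U: "(U, \<phi>) \<in> A" "x \<in> U" and X: "X \<in> tangent_space A x"
  shows "X f = (\<Sum>i\<in>UNIV. X (\<lambda>y. \<phi> y $ i) * cvec U \<phi> i x f)"
proof (cases "smooth_near A x f")
  case False
  then show ?thesis using tangent_nonsmooth[OF X] by (simp add: cvec_def)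
next
  case f: True
  let ?a = "\<phi> x" and ?F = "f \<circ> inv_into U \<phi>"
  obtain r where r: "r > 0" "ball ?a r \<subseteq> \<phi> ` U" "smooth_on (ball ?a r) ?F"
    using chart_smooth_germ[OF U f] .
  obtain h where h: "\<And>b. smooth_on (ball ?a r) (h b)" "\<And>b. h b ?a = frechet_derivative ?F (at ?a) b"
    "\<And>y. y \<in> ball ?a r \<Longrightarrow> ?F y = ?F ?a + (\<Sum>b\<in>Basis. ((y - ?a) \<bullet> b) * h b y)"
    by (rule hadamard[OF r(3,1)]) (rule that)
  define k where "k i y = h (axis i 1) (\<phi> y)" for i y
  have ks: "smooth_near A x (k i)" for i
    unfolding k_def[abs_def] by (rule smooth_near_comp_coord[OF U open_ball _ h(1)]) (simp add: r)
  have cs: "smooth_near A x (\<lambda>y. \<phi> y $ i - ?a $ i)" for i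
    by (rule smooth_near_minus[OF smooth_near_coord[OF U] smooth_near_const])
  have "X f = X (\<lambda>y. f x + (\<Sum>i\<in>UNIV. (\<phi> y $ i - ?a $ i) * k i y))"
  proof (rule tangent_cong[OF X])
    show "open (U \<inter> \<phi> -` ball ?a r)"
      by (rule continuous_open_preimage[OF chart_continuous(1)[OF U(1)] chart_open(1)[OF U(1)] open_ball])
    show "x \<in> U \<inter> \<phi> -` ball ?a r" using U r by simp
    fix y assume "y \<in> U \<inter> \<phi> -` ball ?a r"
    then have y: "y \<in> U" "\<phi> y \<in> ball ?a r" by auto
    then show "f y = f x + (\<Sum>i\<in>UNIV. (\<phi> y $ i - ?a $ i) * k i y)"
      using h(3)[OF y(2)] U by (simp add: chart_inverse[OF U(1)] sum_Basis_axis inner_axis k_def)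
  qed
  also have "\<dots> = (\<Sum>i\<in>UNIV. X (\<lambda>y. (\<phi> y $ i - ?a $ i) * k i y))"
    using tangent_add[OF X smooth_near_const smooth_near_sum, of UNIV "\<lambda>i y. (\<phi> y $ i - ?a $ i) * k i y" "f x"]
      tangent_sum[OF X, of UNIV "\<lambda>i y. (\<phi> y $ i - ?a $ i) * k i y"] smooth_near_mult[OF cs ks] tangent_const[OF X]
    by simp
  also have "\<dots> = (\<Sum>i\<in>UNIV. X (\<lambda>y. \<phi> y $ i) * cvec U \<phi> i x f)"
  proof (rule sum.cong[OF refl])
    fix i
    have "X (\<lambda>y. \<phi> y $ i - ?a $ i) = X (\<lambda>y. \<phi> y $ i)"
      using tangent_minus[OF X smooth_near_coord[OF U, of i] smooth_near_const] X by (simp add: tangent_const)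
    then show "X (\<lambda>y. (\<phi> y $ i - ?a $ i) * k i y) = X (\<lambda>y. \<phi> y $ i) * cvec U \<phi> i x f"
      using tangent_mult[OF X cs ks, of i i] f by (simp add: k_def h(2) cvec_def pd_def)
  qed
  finally show ?thesis .
qed

section \<open>Smooth vector fields and their brackets\<close>

lemma vector_field_on_iff:
  assumes W: "open W"
  shows "vector_field_on A W V \<longleftrightarrow>
    (\<forall>x\<in>W. V x \<in> tangent_space A x) \<and> (\<forall>x\<in>W. \<forall>f. smooth_near A x f \<longrightarrow> smooth_near A x (\<lambda>y. V y f))"
proof safe
  fix x f assume V: "vector_field_on A W V" and x: "x \<in> W" and f: "smooth_near A x f"
  obtain W' where W': "open W'" "x \<in> W'" "W' \<subseteq> W" "smooth_fun_on A W' f"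
    using smooth_nearE[OF f W x] .
  then have "smooth_fun_on A W' (\<lambda>y. V y f)" using V unfolding vector_field_on_def by blast
  then show "smooth_near A x (\<lambda>y. V y f)" using W' by (auto simp: smooth_near_def)
next
  assume *: "\<forall>x\<in>W. V x \<in> tangent_space A x" "\<forall>x\<in>W. \<forall>f. smooth_near A x f \<longrightarrow> smooth_near A x (\<lambda>y. V y f)"
  show "vector_field_on A W V"
    unfolding vector_field_on_def using * by (auto simp: smooth_fun_on_iff subset_iff)
qed (auto simp: vector_field_on_def)

lemma vf_tangent: "vector_field_on A W V \<Longrightarrow> x \<in> W \<Longrightarrow> V x \<in> tangent_space A x"
  by (simp add: vector_field_on_def)

lemma vf_smooth: "vector_field_on A W V \<Longrightarrow> open W \<Longrightarrow> x \<in> W \<Longrightarrow> smooth_near A x f \<Longrightarrow> smooth_near A x (\<lambda>y. V y f)"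
  by (simp add: vector_field_on_iff)

lemma vf_subset: "vector_field_on A W V \<Longrightarrow> W' \<subseteq> W \<Longrightarrow> vector_field_on A W' V"
  unfolding vector_field_on_def by (meson subset_iff order_trans)

lemma vf_cong:
  assumes W: "open W" and V: "vector_field_on A W V" and eq: "\<And>x. x \<in> W \<Longrightarrow> V x = V' x"
  shows "vector_field_on A W V'"
  unfolding vector_field_on_iff[OF W]
proof (intro conjI ballI allI impI)
  fix x assume x: "x \<in> W"
  then show "V' x \<in> tangent_space A x" using vf_tangent[OF V] eq by metis
  fix f assume "smooth_near A x f"
  from vf_smooth[OF V W x this] show "smooth_near A x (\<lambda>y. V' y f)"
    by (rule smooth_near_cong[OF _ W x]) (simp add: eq)
qed

lemma vf_local:
  assumes W: "open W" and V: "\<And>x. x \<in> W \<Longrightarrow> \<exists>O'. open O' \<and> x \<in> O' \<and> vector_field_on A O' V"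
  shows "vector_field_on A W V"
  unfolding vector_field_on_iff[OF W] using V vf_tangent vf_smooth by meson

lemma vf_sum:
  assumes W: "open W" and V: "\<And>i. i \<in> I \<Longrightarrow> vector_field_on A W (V i)" and a: "\<And>i x. i \<in> I \<Longrightarrow> x \<in> W \<Longrightarrow> smooth_near A x (a i)"
  shows "vector_field_on A W (\<lambda>x f. \<Sum>i\<in>I. a i x * V i x f)"
  unfolding vector_field_on_iff[OF W]
  using V a by (auto intro!: tangent_space_sum smooth_near_sum smooth_near_mult vf_smooth[OF V W] vf_tangent[OF V])

lemma vf_scale:
  assumes "open W" "vector_field_on A W V" "\<And>x. x \<in> W \<Longrightarrow> smooth_near A x a"
  shows "vector_field_on A W (\<lambda>x f. a x * V x f)"
  using vf_sum[of W "{()}" "\<lambda>_. V" "\<lambda>_. a"] assms by simp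

lemma vf_lincomb:
  assumes W: "open W" and "vector_field_on A W V" "vector_field_on A W V'"
    "\<And>x. x \<in> W \<Longrightarrow> smooth_near A x a" "\<And>x. x \<in> W \<Longrightarrow> smooth_near A x b"
  shows "vector_field_on A W (\<lambda>x f. a x * V x f + b x * V' x f)"
  unfolding vector_field_on_iff[OF W]
proof (intro conjI ballI allI impI)
  fix x assume x: "x \<in> W"
  show "(\<lambda>f. a x * V x f + b x * V' x f) \<in> tangent_space A x"
    by (rule tangent_space_lincomb[OF vf_tangent[OF assms(2) x] vf_tangent[OF assms(3) x]])
  fix f assume f: "smooth_near A x f"
  show "smooth_near A x (\<lambda>y. a y * V y f + b y * V' y f)"
    by (rule smooth_near_add[OF smooth_near_mult[OF assms(4)[OF x] vf_smooth[OF assms(2) W x f]]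
          smooth_near_mult[OF assms(5)[OF x] vf_smooth[OF assms(3) W x f]]])
qed

lemma vf_cvec:
  assumes U: "(U, \<phi>) \<in> A"
  shows "vector_field_on A U (cvec U \<phi> i)"
  unfolding vector_field_on_iff[OF chart_open(1)[OF U]]
proof (intro conjI ballI allI impI)
  fix x assume x: "x \<in> U"
  then show "cvec U \<phi> i x \<in> tangent_space A x" by (rule cvec_tangent[OF U])
  fix f assume "smooth_near A x f"
  then obtain W where W: "open W" "x \<in> W" "W \<subseteq> U" "smooth_fun_on A W f"
    using smooth_nearE[OF _ chart_open(1)[OF U] x] by metis
  have s: "smooth_on (\<phi> ` W) (pd i (f \<circ> inv_into U \<phi>))"
    using smooth_fun_chart[OF U W(1,3)] W(4) by (simp add: smooth_on_pd)
  have "smooth_near A x (\<lambda>y. pd i (f \<circ> inv_into U \<phi>) (\<phi> y))"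
    by (rule smooth_near_comp_coord[OF U x chart_open_image[OF U W(1,3)] _ s]) (use W in auto)
  then show "smooth_near A x (\<lambda>y. cvec U \<phi> i y f)"
    by (rule smooth_near_cong[OF _ W(1,2)]) (use W(1,4) in \<open>simp add: cvec_def smooth_fun_on_iff\<close>)
qed

text \<open>The Lie bracket, set to 0 on nonsmooth functions like every tangent vector.\<close>

definition comm :: "'m field \<Rightarrow> 'm field \<Rightarrow> 'm field" where
  "comm V W x h = (if smooth_near A x h then V x (\<lambda>y. W y h) - W x (\<lambda>y. V y h) else 0)"

lemma vf_comm:
  assumes O: "open O'" and V: "vector_field_on A O' V" and W: "vector_field_on A O' W"
  shows "vector_field_on A O' (comm V W)"
  unfolding vector_field_on_iff[OF O]
proof (intro conjI ballI allI impI)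
  fix x assume x: "x \<in> O'"
  note s = vf_smooth[OF V O x] vf_smooth[OF W O x]
  note t = vf_tangent[OF V x] vf_tangent[OF W x]
  show "comm V W x \<in> tangent_space A x"
    unfolding tangent_space_def
  proof (intro CollectI conjI allI impI)
    fix f h a b assume fh: "smooth_near A x f" "smooth_near A x h"
    obtain N where N: "open N" "x \<in> N" "\<And>y. y \<in> N \<Longrightarrow> smooth_near A y f" using smooth_near_nhd[OF fh(1)] by metis
    obtain N' where N': "open N'" "x \<in> N'" "\<And>y. y \<in> N' \<Longrightarrow> smooth_near A y h" using smooth_near_nhd[OF fh(2)] by metis
    have M: "open (N \<inter> N' \<inter> O')" "x \<in> N \<inter> N' \<inter> O'" using N N' O x by auto
    have lin: "Z x (\<lambda>y. Z' y (\<lambda>y. a * f y + b * h y)) = a * Z x (\<lambda>y. Z' y f) + b * Z x (\<lambda>y. Z' y h)"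
      if Z: "vector_field_on A O' Z" "vector_field_on A O' Z'" for Z Z'
    proof -
      have "Z x (\<lambda>y. Z' y (\<lambda>y. a * f y + b * h y)) = Z x (\<lambda>y. a * Z' y f + b * Z' y h)"
        by (rule tangent_cong[OF vf_tangent[OF Z(1) x] M])
           (use N N' in \<open>auto intro!: tangent_lincomb vf_tangent[OF Z(2)]\<close>)
      then show ?thesis
        using tangent_lincomb[OF vf_tangent[OF Z(1) x] vf_smooth[OF Z(2) O x fh(1)] vf_smooth[OF Z(2) O x fh(2)]] by simp
    qed
    show "comm V W x (\<lambda>y. a * f y + b * h y) = a * comm V W x f + b * comm V W x h"
      using fh by (simp add: comm_def lin[OF V W] lin[OF W V] smooth_near_add smooth_near_scale algebra_simps)
  next
    fix f h assume fh: "smooth_near A x f" "smooth_near A x h"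
    obtain N where N: "open N" "x \<in> N" "\<And>y. y \<in> N \<Longrightarrow> smooth_near A y f" using smooth_near_nhd[OF fh(1)] by metis
    obtain N' where N': "open N'" "x \<in> N'" "\<And>y. y \<in> N' \<Longrightarrow> smooth_near A y h" using smooth_near_nhd[OF fh(2)] by metis
    have M: "open (N \<inter> N' \<inter> O')" "x \<in> N \<inter> N' \<inter> O'" using N N' O x by auto
    \<comment> \<open>The mixed terms \<open>Z' x h * Z x f\<close> and
      \<open>Z' x f * Z x h\<close> are exchanged when \<open>Z\<close> and \<open>Z'\<close> trade
      places, so they cancel in the bracket.\<close>
    have leib: "Z x (\<lambda>y. Z' y (\<lambda>y. f y * h y)) = f x * Z x (\<lambda>y. Z' y h) + Z' x h * Z x f + (h x * Z x (\<lambda>y. Z' y f) + Z' x f * Z x h)"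
      if Z: "vector_field_on A O' Z" "vector_field_on A O' Z'" for Z Z'
    proof -
      note zt = vf_tangent[OF Z(1) x] and zs = vf_smooth[OF Z(2) O x fh(1)] vf_smooth[OF Z(2) O x fh(2)]
      have "Z x (\<lambda>y. Z' y (\<lambda>y. f y * h y)) = Z x (\<lambda>y. f y * Z' y h + h y * Z' y f)"
        by (rule tangent_cong[OF vf_tangent[OF Z(1) x] M])
           (use N N' in \<open>auto intro!: tangent_mult vf_tangent[OF Z(2)]\<close>)
      then show ?thesis
        using tangent_add[OF zt smooth_near_mult[OF fh(1) zs(2)] smooth_near_mult[OF fh(2) zs(1)]]
          tangent_mult[OF zt fh(1) zs(2)] tangent_mult[OF zt fh(2) zs(1)] by simp
    qed
    show "comm V W x (\<lambda>y. f y * h y) = f x * comm V W x h + h x * comm V W x f"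
      using fh by (simp add: comm_def leib[OF V W] leib[OF W V] smooth_near_mult algebra_simps)
  next
    fix f h assume fh: "smooth_near A x f" "smooth_near A x h" and "eventually (\<lambda>y. f y = h y) (nhds x)"
    then obtain N where N: "open N" "x \<in> N" "\<And>y. y \<in> N \<Longrightarrow> f y = h y" by (auto simp: eventually_nhds)
    have M: "open (N \<inter> O')" "x \<in> N \<inter> O'" using N O x by auto
    have eq: "Z x (\<lambda>y. Z' y f) = Z x (\<lambda>y. Z' y h)" if Z: "vector_field_on A O' Z" "vector_field_on A O' Z'" for Z Z'
      by (rule tangent_cong[OF vf_tangent[OF Z(1) x] M]) (use N in \<open>auto intro: tangent_cong[OF vf_tangent[OF Z(2)]]\<close>)
    show "comm V W x f = comm V W x h" using fh by (simp add: comm_def eq[OF V W] eq[OF W V])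
  qed (simp add: comm_def)
  fix f assume f: "smooth_near A x f"
  then obtain N where N: "open N" "x \<in> N" "\<And>y. y \<in> N \<Longrightarrow> smooth_near A y f" using smooth_near_nhd by metis
  have "smooth_near A x (\<lambda>y. V y (\<lambda>z. W z f) - W y (\<lambda>z. V z f))"
    by (intro smooth_near_minus vf_smooth[OF V O x] vf_smooth[OF W O x] f)
  then show "smooth_near A x (\<lambda>y. comm V W y f)"
    by (rule smooth_near_cong[OF _ N(1,2)]) (simp add: comm_def N)
qed

end

section \<open>Orthonormal frames\<close>

locale riemannian = atlas A for A :: "('m::{t2_space,second_countable_topology}, 'k::finite) chart set" +
  fixes g :: "'m metric"
  assumes metric: "riemannian_metric A g"
begin

lemma g_sym: "X \<in> tangent_space A x \<Longrightarrow> Y \<in> tangent_space A x \<Longrightarrow> g x X Y = g x Y X"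
  using metric unfolding riemannian_metric_def by blast

lemma g_pos: "X \<in> tangent_space A x \<Longrightarrow> X \<noteq> (\<lambda>f. 0) \<Longrightarrow> g x X X > 0"
  using metric unfolding riemannian_metric_def by blast

lemma g_lin: "X \<in> tangent_space A x \<Longrightarrow> Y \<in> tangent_space A x \<Longrightarrow> Z \<in> tangent_space A x \<Longrightarrow>
    g x (\<lambda>f. a * X f + b * Y f) Z = a * g x X Z + b * g x Y Z"
  using metric unfolding riemannian_metric_def by blast

lemma g_smooth:
  assumes "open W" "vector_field_on A W V" "vector_field_on A W V'" "x \<in> W"
  shows "smooth_near A x (\<lambda>y. g y (V y) (V' y))"
  using metric assms smooth_fun_on_iff[OF assms(1)] unfolding riemannian_metric_def by metis

lemma g_zero: "Z \<in> tangent_space A x \<Longrightarrow> g x (\<lambda>f. 0) Z = 0"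
  using g_lin[of Z x Z Z 0 0] by simp

lemma g_sum:
  assumes "\<And>i. i \<in> I \<Longrightarrow> X i \<in> tangent_space A x" "Z \<in> tangent_space A x"
  shows "g x (\<lambda>f. \<Sum>i\<in>I. a i * X i f) Z = (\<Sum>i\<in>I. a i * g x (X i) Z)"
  using assms(1)
proof (induction I rule: infinite_finite_induct)
  case (insert i I)
  then have "g x (\<lambda>f. a i * X i f + 1 * (\<Sum>i\<in>I. a i * X i f)) Z = a i * g x (X i) Z + 1 * g x (\<lambda>f. \<Sum>i\<in>I. a i * X i f) Z"
    by (intro g_lin tangent_space_sum assms(2)) auto
  with insert show ?case by simp
qed (simp_all add: g_zero assms(2))

lemma g_add: "X \<in> tangent_space A x \<Longrightarrow> Y \<in> tangent_space A x \<Longrightarrow> Z \<in> tangent_space A x \<Longrightarrow>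
    g x (\<lambda>f. X f + Y f) Z = g x X Z + g x Y Z"
  using g_lin[of X x Y Z 1 1] by simp

lemma g_diff: "X \<in> tangent_space A x \<Longrightarrow> Y \<in> tangent_space A x \<Longrightarrow> Z \<in> tangent_space A x \<Longrightarrow>
    g x (\<lambda>f. X f - Y f) Z = g x X Z - g x Y Z"
  using g_lin[of X x Y Z 1 "-1"] by simp

lemma g_scale: "X \<in> tangent_space A x \<Longrightarrow> Z \<in> tangent_space A x \<Longrightarrow> g x (\<lambda>f. a * X f) Z = a * g x X Z"
  using g_lin[of X x X Z a 0] by simp

lemma tangent_space_diff: "X \<in> tangent_space A x \<Longrightarrow> Y \<in> tangent_space A x \<Longrightarrow> (\<lambda>f. X f - Y f) \<in> tangent_space A x"
  using tangent_space_lincomb[of X x Y 1 "-1"] by simp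

text \<open>In coordinates, orthonormality of \<open>n\<close> vectors says that a square matrix has a right inverse,
  which is then also a left inverse; hence \<open>n\<close> orthonormal vectors span.\<close>

lemma orthonormal_expand:
  assumes E: "\<And>i::'k. E i \<in> tangent_space A x" and on: "\<And>i j. g x (E i) (E j) = (if i = j then 1 else 0)"
    and X: "X \<in> tangent_space A x"
  shows "X f = (\<Sum>a\<in>UNIV. g x X (E a) * E a f)"
proof -
  obtain U \<phi> where U: "(U, \<phi>) \<in> A" "x \<in> U" by (rule chart_cover)
  let ?d = "\<lambda>i. cvec U \<phi> i x" and ?\<phi> = "\<lambda>i y. \<phi> y $ i"
  define M :: "real ^ 'k ^ 'k" where "M = (\<chi> a i. E a (?\<phi> i))"
  define N :: "real ^ 'k ^ 'k" where "N = (\<chi> i b. g x (?d i) (E b))"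
  have ex: "Y = (\<lambda>f. \<Sum>i\<in>UNIV. Y (?\<phi> i) * ?d i f)" if "Y \<in> tangent_space A x" for Y
    using tangent_expand[OF U that] by (rule ext)
  have gY: "g x Y (E b) = (\<Sum>i\<in>UNIV. Y (?\<phi> i) * g x (?d i) (E b))" if "Y \<in> tangent_space A x" for Y b
    by (subst ex[OF that]) (intro g_sum cvec_tangent[OF U] E)
  have "M ** N = mat 1"
    using gY[OF E] on by (simp add: vec_eq_iff matrix_matrix_mult_def M_def N_def mat_def)
  then have NM: "N ** M = mat 1" using matrix_left_right_inverse by blast
  define v :: "real ^ 'k" where "v = (\<chi> i. X (?\<phi> i))"
  define w :: "real ^ 'k" where "w = (\<chi> i. ?d i f)"
  have "(\<Sum>a\<in>UNIV. g x X (E a) * E a f) = (v v* N) \<bullet> (M *v w)"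
    unfolding inner_vec_def
  proof (rule sum.cong[OF refl])
    fix a
    have "E a f = (M *v w) $ a"
      using tangent_expand[OF U E, of a f] by (simp add: M_def w_def matrix_vector_mult_def)
    moreover have "g x X (E a) = (v v* N) $ a"
      using gY[OF X, of a] by (simp add: vector_matrix_mult_def v_def N_def mult.commute)
    ultimately show "g x X (E a) * E a f = (v v* N) $ a \<bullet> (M *v w) $ a" by simp
  qed
  also have "\<dots> = v \<bullet> w" by (simp add: dot_lmul_matrix matrix_vector_mul_assoc NM)
  also have "\<dots> = X f" using tangent_expand[OF U X, of f] by (simp add: v_def w_def inner_vec_def)
  finally show ?thesis by simp
qed

text \<open>Gram--Schmidt applied to the coordinate fields. The vanishing of the \<open>e\<^sub>j\<close> on the remaining
  coordinate functions ensures that the next projected coordinate field is nowhere zero.\<close>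

lemma gram_schmidt:
  fixes S :: "'k set"
  assumes U: "(U, \<phi>) \<in> A"
  shows "\<exists>e. (\<forall>j\<in>S. vector_field_on A U (e j)) \<and>
    (\<forall>x\<in>U. \<forall>i\<in>S. \<forall>j\<in>S. g x (e i x) (e j x) = (if i = j then 1 else 0)) \<and>
    (\<forall>x\<in>U. \<forall>j\<in>S. \<forall>k. k \<notin> S \<longrightarrow> e j x (\<lambda>y. \<phi> y $ k) = 0)"
  using finite[of S]
proof (induction S rule: finite_induct)
  case empty
  then show ?case by simp
next
  case (insert k S)
  then obtain e where e0: "\<forall>j\<in>S. vector_field_on A U (e j)"
    "\<forall>x\<in>U. \<forall>i\<in>S. \<forall>j\<in>S. g x (e i x) (e j x) = (if i = j then 1 else 0)"
    "\<forall>x\<in>U. \<forall>j\<in>S. \<forall>k. k \<notin> S \<longrightarrow> e j x (\<lambda>y. \<phi> y $ k) = 0" by blast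
  note e = e0(1)[rule_format] e0(2)[rule_format] e0(3)[rule_format]
  note oU = chart_open(1)[OF U]
  let ?d = "cvec U \<phi> k"
  let ?p = "\<lambda>x f. \<Sum>j\<in>S. g x (?d x) (e j x) * e j x f"
  define w where "w x f = 1 * ?d x f + (-1) * ?p x f" for x f
  have d: "vector_field_on A U ?d" by (rule vf_cvec[OF U])
  have p: "vector_field_on A U ?p"
    by (rule vf_sum[OF oU e(1)]) (auto intro: g_smooth[OF oU d e(1)])
  have w: "vector_field_on A U w"
    unfolding w_def[abs_def] by (rule vf_lincomb[OF oU d p]) (rule smooth_near_const)+
  have wt: "w x \<in> tangent_space A x" if "x \<in> U" for x by (rule vf_tangent[OF w that])
  have et: "e j x \<in> tangent_space A x" if "x \<in> U" "j \<in> S" for x j using vf_tangent[OF e(1)] that by blast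
  have wk: "w x (\<lambda>y. \<phi> y $ l) = (if k = l then 1 else 0)" if "x \<in> U" "l \<notin> S" for x l
    using cvec_coord[OF U that(1)] e(3)[OF that(1) _ that(2)] by (simp add: w_def)
  have wpos: "g x (w x) (w x) > 0" if "x \<in> U" for x
  proof (rule g_pos[OF wt[OF that]])
    show "w x \<noteq> (\<lambda>f. 0)" using wk[OF that, of k] insert.hyps by (metis zero_neq_one)
  qed
  have we: "g x (w x) (e i x) = 0" if x: "x \<in> U" and i: "i \<in> S" for x i
  proof -
    have "g x (w x) (e i x) = 1 * g x (?d x) (e i x) + (-1) * g x (?p x) (e i x)"
      unfolding w_def[abs_def]
      by (rule g_lin[OF vf_tangent[OF d x] vf_tangent[OF p x] et[OF x i]])
    also have "g x (?p x) (e i x) = (\<Sum>j\<in>S. g x (?d x) (e j x) * g x (e j x) (e i x))"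
      by (rule g_sum) (use et x i in auto)
    also have "\<dots> = (\<Sum>j\<in>S. if j = i then g x (?d x) (e j x) else 0)"
      by (intro sum.cong refl) (use e(2) x i in auto)
    also have "\<dots> = g x (?d x) (e i x)" using i insert.hyps by simp
    finally show ?thesis by simp
  qed
  \<comment> \<open>The reciprocal of the length of \<open>w\<close>, smooth because
    \<open>wpos\<close> keeps the base of the power positive.\<close>
  define n where "n x = g x (w x) (w x) powr (-1/2)" for x
  define e' where "e' = e(k := (\<lambda>x f. n x * w x f))"
  have ns: "smooth_near A x n" if x: "x \<in> U" for x
    unfolding n_def[abs_def]
    by (rule smooth_near_compose[OF g_smooth[OF oU w w x] _ smooth_on_powr]) (use wpos[OF x] in auto)
  have e'k: "vector_field_on A U (e' k)"
    unfolding e'_def by (simp, rule vf_scale[OF oU w ns])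
  have n2: "n x * (n x * g x (w x) (w x)) = 1" if "x \<in> U" for x
  proof -
    have "n x * n x = g x (w x) (w x) powr (-1)" unfolding n_def by (simp add: powr_add[symmetric])
    then show ?thesis using wpos[OF that] by (simp add: powr_minus mult.assoc[symmetric])
  qed
  have e'S: "e' j = e j" if "j \<in> S" for j using that insert.hyps by (auto simp: e'_def)
  have ew: "g x (e' k x) Y = n x * g x (w x) Y" if "x \<in> U" "Y \<in> tangent_space A x" for x Y
    unfolding e'_def using g_scale[OF wt[OF that(1)] that(2)] by simp
  have e't: "e' k x \<in> tangent_space A x" if "x \<in> U" for x by (rule vf_tangent[OF e'k that])
  have kk: "g x (e' k x) (e' k x) = 1" if x: "x \<in> U" for x
    using ew[OF x e't[OF x]] g_sym[OF wt[OF x] e't[OF x]] ew[OF x wt[OF x]] n2[OF x] by simp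
  have ki: "g x (e' k x) (e i x) = 0" "g x (e i x) (e' k x) = 0" if x: "x \<in> U" and i: "i \<in> S" for x i
    using ew[OF x et[OF x i]] we[OF x i] g_sym[OF e't[OF x] et[OF x i]] by simp_all
  have on: "g x (e' i x) (e' j x) = (if i = j then 1 else 0)" if "x \<in> U" "i \<in> insert k S" "j \<in> insert k S" for x i j
    using that kk ki e(2) e'S insert.hyps by (cases "i = k"; cases "j = k") auto
  have "e' j x (\<lambda>y. \<phi> y $ l) = 0" if "x \<in> U" "j \<in> insert k S" "l \<notin> insert k S" for x j l
    using that wk[of x l] e(3)[of x j l] e'S by (cases "j = k") (auto simp: e'_def)
  then show ?case
    using on e'k e(1) e'S by (intro exI[of _ e']) auto
qed

lemma frame_exists:
  obtains W e where "open W" "x \<in> W" "orthonormal_frame_on A g W e"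
proof -
  obtain U \<phi> where U: "(U, \<phi>) \<in> A" "x \<in> U" by (rule chart_cover)
  from gram_schmidt[OF U(1), of UNIV] obtain e :: "'k \<Rightarrow> 'm field" where "\<forall>j\<in>UNIV. vector_field_on A U (e j)"
    "\<forall>x\<in>U. \<forall>i\<in>UNIV. \<forall>j\<in>UNIV. g x (e i x) (e j x) = (if i = j then 1 else 0)" by blast
  then have "orthonormal_frame_on A g U e" by (simp add: orthonormal_frame_on_def)
  with U chart_open(1)[OF U(1)] show ?thesis using that by blast
qed

end

section \<open>The Levi-Civita connection\<close>

lemma sum_rotate: "(\<Sum>k\<in>K. \<Sum>i\<in>I. \<Sum>j\<in>J. F k i j) = (\<Sum>i\<in>I. \<Sum>j\<in>J. \<Sum>k\<in>K. F k i j)"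
  by (subst sum.swap, rule sum.cong[OF refl], rule sum.swap)

lemma (in atlas) smooth_fun_on_const: "smooth_fun_on A U (\<lambda>y. c)"
  by (rule smooth_fun_on_subset[of UNIV]) (simp_all add: smooth_fun_on_iff smooth_near_const)

context riemannian
begin

section \<open>Connections on one open set and their uniqueness\<close>

text \<open>\<open>levi_civita_connection\<close> quantifies over all open sets. A frame exists only
  locally, so the connection built from it can satisfy these conditions on the domain of the frame
  alone.\<close>

definition LC_on :: "'m set \<Rightarrow> ('m field \<Rightarrow> 'm field \<Rightarrow> 'm field) \<Rightarrow> bool" where
  "LC_on U D \<longleftrightarrow> (\<forall>V V' W f. vector_field_on A U V \<longrightarrow> vector_field_on A U V' \<longrightarrow>
        vector_field_on A U W \<longrightarrow> smooth_fun_on A U f \<longrightarrow>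
        vector_field_on A U (D V W) \<and>
        (\<forall>x\<in>U.
           D (\<lambda>y h. V y h + V' y h) W x = (\<lambda>h. D V W x h + D V' W x h) \<and>
           D (\<lambda>y h. f y * V y h) W x = (\<lambda>h. f x * D V W x h) \<and>
           D W (\<lambda>y h. V y h + V' y h) x = (\<lambda>h. D W V x h + D W V' x h) \<and>
           D V (\<lambda>y h. f y * W y h) x = (\<lambda>h. f x * D V W x h + V x f * W x h) \<and>
           (\<forall>h. smooth_near A x h \<longrightarrow>
              D V W x h - D W V x h = V x (\<lambda>y. W y h) - W x (\<lambda>y. V y h)) \<and>
           V x (\<lambda>y. g y (V' y) (W y)) = g x (D V V' x) (W x) + g x (V' x) (D V W x)))"

lemma LC_on_iff: "levi_civita_connection A g D \<longleftrightarrow> (\<forall>U. open U \<longrightarrow> LC_on U D)"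
  unfolding levi_civita_connection_def LC_on_def by meson

context
  fixes U D assumes D: "LC_on U D"
begin

lemma LC_vf: "vector_field_on A U V \<Longrightarrow> vector_field_on A U W \<Longrightarrow> vector_field_on A U (D V W)"
  using D smooth_fun_on_const unfolding LC_on_def by blast

context
  fixes x assumes x: "x \<in> U"
begin

lemma LC_add_left: "vector_field_on A U V \<Longrightarrow> vector_field_on A U V' \<Longrightarrow> vector_field_on A U W \<Longrightarrow>
    D (\<lambda>y h. V y h + V' y h) W x = (\<lambda>h. D V W x h + D V' W x h)"
  using D x smooth_fun_on_const unfolding LC_on_def by blast

lemma LC_scale_left: "vector_field_on A U V \<Longrightarrow> vector_field_on A U W \<Longrightarrow> smooth_fun_on A U f \<Longrightarrow>
    D (\<lambda>y h. f y * V y h) W x = (\<lambda>h. f x * D V W x h)"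
  using D x unfolding LC_on_def by blast

lemma LC_add_right: "vector_field_on A U V \<Longrightarrow> vector_field_on A U V' \<Longrightarrow> vector_field_on A U W \<Longrightarrow>
    D W (\<lambda>y h. V y h + V' y h) x = (\<lambda>h. D W V x h + D W V' x h)"
  using D x smooth_fun_on_const unfolding LC_on_def by blast

lemma LC_leibniz: "vector_field_on A U V \<Longrightarrow> vector_field_on A U W \<Longrightarrow> smooth_fun_on A U f \<Longrightarrow>
    D V (\<lambda>y h. f y * W y h) x = (\<lambda>h. f x * D V W x h + V x f * W x h)"
  using D x unfolding LC_on_def by blast

lemma LC_torsion: "vector_field_on A U V \<Longrightarrow> vector_field_on A U W \<Longrightarrow> smooth_near A x h \<Longrightarrow>
    D V W x h - D W V x h = V x (\<lambda>y. W y h) - W x (\<lambda>y. V y h)"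
  using D x smooth_fun_on_const unfolding LC_on_def by blast

lemma LC_metric: "vector_field_on A U V \<Longrightarrow> vector_field_on A U V' \<Longrightarrow> vector_field_on A U W \<Longrightarrow>
    V x (\<lambda>y. g y (V' y) (W y)) = g x (D V V' x) (W x) + g x (V' x) (D V W x)"
  using D x smooth_fun_on_const unfolding LC_on_def by blast

end

end

text \<open>The difference of two connections is a trilinear form \<open>\<tau>(V, W, Z)\<close> that is symmetric in
  the first two and antisymmetric in the last two arguments, hence zero.\<close>

lemma LC_unique:
  assumes U: "open U" "x \<in> U" and D: "LC_on U D" "LC_on U D'"
    and V: "vector_field_on A U V" and W: "vector_field_on A U W"
    and E: "orthonormal_frame_on A g U E"
  shows "D V W x = D' V W x"
proof -
  define \<tau> where "\<tau> V W Z = g x (\<lambda>f. D V W x f - D' V W x f) (Z x)" for V W Z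
  have t: "D V W x \<in> tangent_space A x" "D' V W x \<in> tangent_space A x"
    if "vector_field_on A U V" "vector_field_on A U W" for V W
    using LC_vf[OF D(1) that] LC_vf[OF D(2) that] U(2) vf_tangent by blast+
  have sym: "\<tau> V W Z = \<tau> W V Z" if VW: "vector_field_on A U V" "vector_field_on A U W" for V W Z
  proof -
    have "(\<lambda>f. D V W x f - D' V W x f) = (\<lambda>f. D W V x f - D' W V x f)"
    proof
      fix f show "D V W x f - D' V W x f = D W V x f - D' W V x f"
      proof (cases "smooth_near A x f")
        case True
        then show ?thesis
          using LC_torsion[OF D(1) U(2) VW True] LC_torsion[OF D(2) U(2) VW True] by simp
      next
        case False
        note z = tangent_nonsmooth[OF _ False]
        show ?thesis using z[OF t(1)[OF VW]] z[OF t(2)[OF VW]] z[OF t(1)[OF VW(2,1)]] z[OF t(2)[OF VW(2,1)]]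
          by simp
      qed
    qed
    then show ?thesis by (simp add: \<tau>_def)
  qed
  have anti: "\<tau> V W Z = - \<tau> V Z W"
    if VWZ: "vector_field_on A U V" "vector_field_on A U W" "vector_field_on A U Z" for V W Z
  proof -
    have z: "Z x \<in> tangent_space A x" "W x \<in> tangent_space A x" using VWZ vf_tangent U(2) by blast+
    have "g x (D V W x) (Z x) + g x (W x) (D V Z x) = g x (D' V W x) (Z x) + g x (W x) (D' V Z x)"
      using LC_metric[OF D(1) U(2) VWZ] LC_metric[OF D(2) U(2) VWZ] by simp
    then have "g x (D V W x) (Z x) - g x (D' V W x) (Z x) = - (g x (D V Z x) (W x) - g x (D' V Z x) (W x))"
      using g_sym[OF z(2) t(1)[OF VWZ(1,3)]] g_sym[OF z(2) t(2)[OF VWZ(1,3)]] by simp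
    then show ?thesis
      unfolding \<tau>_def using g_diff[OF t[OF VWZ(1,2)] z(1)] g_diff[OF t[OF VWZ(1,3)] z(2)] by simp
  qed
  have e: "vector_field_on A U (E k)" for k using E by (simp add: orthonormal_frame_on_def)
  \<comment> \<open>Six swaps, alternately antisymmetric and symmetric, bring the three arguments
    back to their places with the opposite sign.\<close>
  have zero: "\<tau> V W (E k) = 0" for k
    using anti[OF V W e, of k] sym[OF V e, of k W] anti[OF e V W, of k] sym[OF e W, of k V] anti[OF W e V, of k] sym[OF W V, of "E k"]
    by simp
  have "D V W x f - D' V W x f = 0" for f
  proof -
    have "D V W x f - D' V W x f = (\<Sum>a\<in>UNIV. g x (\<lambda>f. D V W x f - D' V W x f) (E a x) * E a x f)"
      using E U(2) vf_tangent[OF e U(2)]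
      by (intro orthonormal_expand tangent_space_diff t V W) (auto simp: orthonormal_frame_on_def)
    then show ?thesis using zero by (simp add: \<tau>_def)
  qed
  then show ?thesis by (simp add: fun_eq_iff)
qed

section \<open>The connection defined by an orthonormal frame\<close>

definition struct :: "('k \<Rightarrow> 'm field) \<Rightarrow> 'k \<Rightarrow> 'k \<Rightarrow> 'k \<Rightarrow> 'm \<Rightarrow> real" where
  "struct E i j k y = g y (comm (E i) (E j) y) (E k y)"

text \<open>Koszul's formula for the components of the connection. In an orthonormal frame the
  metric coefficients are constant, so only the three bracket terms remain, and the factor 1/2 is
  Koszul's.\<close>

definition conn_form :: "('k \<Rightarrow> 'm field) \<Rightarrow> 'k \<Rightarrow> 'k \<Rightarrow> 'k \<Rightarrow> 'm \<Rightarrow> real" where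
  "conn_form E i j k y = (1/2) * (struct E i j k y - struct E j k i y + struct E k i j y)"

definition fcoeff :: "('k \<Rightarrow> 'm field) \<Rightarrow> 'm field \<Rightarrow> 'k \<Rightarrow> 'm \<Rightarrow> real" where
  "fcoeff E V k y = g y (V y) (E k y)"

text \<open>Once the connection is known on the frame, the Leibniz rule leaves no choice: the
  coefficients of \<open>W\<close> are differentiated along \<open>V\<close>, and
  \<open>conn_form\<close> accounts for the frame fields.\<close>

definition frame_conn :: "('k \<Rightarrow> 'm field) \<Rightarrow> 'm field \<Rightarrow> 'm field \<Rightarrow> 'm field" where
  "frame_conn E V W y h = (\<Sum>k\<in>UNIV. (V y (fcoeff E W k) +
     (\<Sum>i\<in>UNIV. \<Sum>j\<in>UNIV. fcoeff E V i y * fcoeff E W j y * conn_form E i j k y)) * E k y h)"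

context
  fixes U E assumes U: "open U" and E: "orthonormal_frame_on A g U E"
begin

lemma frame_vf: "vector_field_on A U (E k)"
  using E by (simp add: orthonormal_frame_on_def)

lemma frame_on: "x \<in> U \<Longrightarrow> g x (E i x) (E j x) = (if i = j then 1 else 0)"
  using E by (simp add: orthonormal_frame_on_def)

lemma frame_tangent: "x \<in> U \<Longrightarrow> E k x \<in> tangent_space A x"
  by (rule vf_tangent[OF frame_vf])

lemma frame_expand: "x \<in> U \<Longrightarrow> X \<in> tangent_space A x \<Longrightarrow> X f = (\<Sum>a\<in>UNIV. g x X (E a x) * E a x f)"
  by (rule orthonormal_expand[OF frame_tangent frame_on])

lemma vf_expand: "vector_field_on A U V \<Longrightarrow> x \<in> U \<Longrightarrow> V x f = (\<Sum>a\<in>UNIV. fcoeff E V a x * E a x f)"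
  unfolding fcoeff_def by (rule frame_expand[OF _ vf_tangent])

lemma fcoeff_smooth: "vector_field_on A U V \<Longrightarrow> x \<in> U \<Longrightarrow> smooth_near A x (fcoeff E V k)"
  unfolding fcoeff_def[abs_def] by (rule g_smooth[OF U _ frame_vf])

lemma g_expand:
  assumes "x \<in> U" "X \<in> tangent_space A x" "Y \<in> tangent_space A x"
  shows "g x X Y = (\<Sum>a\<in>UNIV. g x X (E a x) * g x Y (E a x))"
proof -
  have "X = (\<lambda>f. \<Sum>a\<in>UNIV. g x X (E a x) * E a x f)" using frame_expand[OF assms(1,2)] by (rule ext)
  then have "g x X Y = g x (\<lambda>f. \<Sum>a\<in>UNIV. g x X (E a x) * E a x f) Y" by simp
  also have "\<dots> = (\<Sum>a\<in>UNIV. g x X (E a x) * g x (E a x) Y)"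
    by (rule g_sum[OF frame_tangent[OF assms(1)] assms(3)])
  also have "\<dots> = (\<Sum>a\<in>UNIV. g x X (E a x) * g x Y (E a x))"
    using g_sym[OF frame_tangent[OF assms(1)] assms(3)] by simp
  finally show ?thesis .
qed

lemma struct_anti: "x \<in> U \<Longrightarrow> struct E i j k x = - struct E j i k x"
proof -
  assume x: "x \<in> U"
  have "comm (E i) (E j) x = (\<lambda>f. (-1) * comm (E j) (E i) x f)" by (auto simp: comm_def fun_eq_iff)
  then show ?thesis
    unfolding struct_def
    using g_scale[OF vf_tangent[OF vf_comm[OF U frame_vf frame_vf] x] frame_tangent[OF x], of "-1" j i k] by simp
qed

lemma conn_form_torsion: "x \<in> U \<Longrightarrow> conn_form E i j k x - conn_form E j i k x = struct E i j k x"
  using struct_anti[of x j i k] struct_anti[of x i k j] struct_anti[of x k j i]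
  by (simp add: conn_form_def field_simps)

lemma conn_form_metric: "x \<in> U \<Longrightarrow> conn_form E i j k x + conn_form E i k j x = 0"
  using struct_anti[of x i k j] struct_anti[of x k j i] struct_anti[of x j i k]
  by (simp add: conn_form_def field_simps)

lemma conn_form_smooth: "x \<in> U \<Longrightarrow> smooth_near A x (conn_form E i j k)"
  unfolding conn_form_def[abs_def] struct_def
  by (intro smooth_near_scale smooth_near_add smooth_near_minus g_smooth[OF U] vf_comm U frame_vf)

lemma fcoeff_frame_conn:
  assumes "x \<in> U"
  shows "fcoeff E (frame_conn E V W) k x = V x (fcoeff E W k) +
     (\<Sum>i\<in>UNIV. \<Sum>j\<in>UNIV. fcoeff E V i x * fcoeff E W j x * conn_form E i j k x)"
proof -
  let ?c = "\<lambda>k. V x (fcoeff E W k) + (\<Sum>i\<in>UNIV. \<Sum>j\<in>UNIV. fcoeff E V i x * fcoeff E W j x * conn_form E i j k x)"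
  have "fcoeff E (frame_conn E V W) k x = g x (\<lambda>h. \<Sum>k\<in>UNIV. ?c k * E k x h) (E k x)"
    unfolding fcoeff_def[of E "frame_conn E V W"] by (simp add: frame_conn_def[abs_def])
  also have "\<dots> = (\<Sum>l\<in>UNIV. ?c l * g x (E l x) (E k x))"
    by (rule g_sum[OF frame_tangent[OF assms] frame_tangent[OF assms]])
  also have "\<dots> = (\<Sum>l\<in>UNIV. if l = k then ?c l else 0)"
    by (intro sum.cong refl) (simp add: frame_on[OF assms])
  finally show ?thesis by simp
qed

lemma frame_conn_vf:
  assumes V: "vector_field_on A U V" and W: "vector_field_on A U W"
  shows "vector_field_on A U (frame_conn E V W)"
  unfolding frame_conn_def[abs_def]
proof (rule vf_sum[OF U frame_vf])
  fix k x assume x: "x \<in> U"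
  show "smooth_near A x (\<lambda>y. V y (fcoeff E W k) + (\<Sum>i\<in>UNIV. \<Sum>j\<in>UNIV. fcoeff E V i y * fcoeff E W j y * conn_form E i j k y))"
    using x by (intro smooth_near_add smooth_near_sum smooth_near_mult vf_smooth[OF V U] fcoeff_smooth V W conn_form_smooth)
qed

text \<open>Separates the derivatives of the coefficients from second derivatives along the frame.
  It serves the torsion identity and, with coordinate fields for \<open>V\<close> and
  \<open>W\<close>, the passage from frames to charts.\<close>

lemma frame_conn_nested:
  assumes V: "vector_field_on A U V" and W: "vector_field_on A U W" and x: "x \<in> U" and h: "smooth_near A x h"
  shows "V x (\<lambda>y. W y h) = (\<Sum>k\<in>UNIV. V x (fcoeff E W k) * E k x h) +
     (\<Sum>i\<in>UNIV. \<Sum>j\<in>UNIV. fcoeff E V i x * fcoeff E W j x * E i x (\<lambda>y. E j y h))"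
proof -
  note t = vf_tangent[OF V x]
  have s: "smooth_near A x (\<lambda>y. E j y h)" for j by (rule vf_smooth[OF frame_vf U x h])
  have "V x (\<lambda>y. W y h) = V x (\<lambda>y. \<Sum>j\<in>UNIV. fcoeff E W j y * E j y h)"
    by (rule tangent_cong[OF t U x]) (rule vf_expand[OF W])
  also have "\<dots> = (\<Sum>j\<in>UNIV. V x (\<lambda>y. fcoeff E W j y * E j y h))"
    by (rule tangent_sum[OF t]) (intro smooth_near_mult fcoeff_smooth W x s)
  also have "\<dots> = (\<Sum>j\<in>UNIV. fcoeff E W j x * V x (\<lambda>y. E j y h) + E j x h * V x (fcoeff E W j))"
    by (intro sum.cong refl tangent_mult[OF t] fcoeff_smooth W x s)
  also have "\<dots> = (\<Sum>j\<in>UNIV. fcoeff E W j x * (\<Sum>i\<in>UNIV. fcoeff E V i x * E i x (\<lambda>y. E j y h)) + E j x h * V x (fcoeff E W j))"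
    by (subst vf_expand[OF V x]) simp
  also have "\<dots> = (\<Sum>k\<in>UNIV. V x (fcoeff E W k) * E k x h) +
     (\<Sum>j\<in>UNIV. \<Sum>i\<in>UNIV. fcoeff E V i x * fcoeff E W j x * E i x (\<lambda>y. E j y h))"
    by (simp add: sum.distrib sum_distrib_left algebra_simps)
  also have "(\<Sum>j\<in>UNIV. \<Sum>i\<in>UNIV. fcoeff E V i x * fcoeff E W j x * E i x (\<lambda>y. E j y h)) =
     (\<Sum>i\<in>UNIV. \<Sum>j\<in>UNIV. fcoeff E V i x * fcoeff E W j x * E i x (\<lambda>y. E j y h))"
    by (rule sum.swap)
  finally show ?thesis .
qed

lemma fcoeff_add: "x \<in> U \<Longrightarrow> vector_field_on A U V \<Longrightarrow> vector_field_on A U V' \<Longrightarrow>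
    fcoeff E (\<lambda>y h. V y h + V' y h) k x = fcoeff E V k x + fcoeff E V' k x"
  unfolding fcoeff_def by (intro g_add vf_tangent[of U] frame_vf)

lemma fcoeff_scale: "x \<in> U \<Longrightarrow> vector_field_on A U V \<Longrightarrow> fcoeff E (\<lambda>y h. f y * V y h) k x = f x * fcoeff E V k x"
  unfolding fcoeff_def by (intro g_scale vf_tangent[of U] frame_vf)

text \<open>The derivatives of the coefficients agree on both sides. On the left there remains the
  antisymmetric part of \<open>conn_form\<close>, which is the structure function; on the right
  there remain the brackets of the frame fields, which the structure functions expand.\<close>

lemma frame_conn_torsion:
  assumes V: "vector_field_on A U V" and W: "vector_field_on A U W" and x: "x \<in> U" and h: "smooth_near A x h"
  shows "frame_conn E V W x h - frame_conn E W V x h = V x (\<lambda>y. W y h) - W x (\<lambda>y. V y h)"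
proof -
  let ?S = "\<lambda>F. \<Sum>i\<in>UNIV. \<Sum>j\<in>UNIV. fcoeff E V i x * fcoeff E W j x * F i j"
  have swap: "(\<Sum>i\<in>UNIV. \<Sum>j\<in>UNIV. fcoeff E W i x * fcoeff E V j x * F i j) = ?S (\<lambda>i j. F j i)" for F
    by (subst sum.swap) (simp add: mult_ac)
  have diff: "?S F - ?S G = ?S (\<lambda>i j. F i j - G i j)" for F G
    by (simp add: sum_subtractf right_diff_distrib)
  have alg: "(a + s1) * e - (b + s2) * e = (a - b) * e + s3 * e" if "s1 - s2 = s3" for a b e s1 s2 s3 :: real
    unfolding that[symmetric] by (simp add: algebra_simps)
  have "frame_conn E V W x h - frame_conn E W V x h =
    (\<Sum>k\<in>UNIV. (V x (fcoeff E W k) - W x (fcoeff E V k)) * E k x h + ?S (\<lambda>i j. conn_form E i j k x - conn_form E j i k x) * E k x h)"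
    unfolding frame_conn_def swap sum_subtractf[symmetric]
    by (intro sum.cong refl alg diff)
  also have "\<dots> = (\<Sum>k\<in>UNIV. (V x (fcoeff E W k) - W x (fcoeff E V k)) * E k x h) + (\<Sum>k\<in>UNIV. ?S (\<lambda>i j. struct E i j k x) * E k x h)"
    by (simp add: conn_form_torsion[OF x] sum.distrib)
  also have "(\<Sum>k\<in>UNIV. ?S (\<lambda>i j. struct E i j k x) * E k x h) = ?S (\<lambda>i j. \<Sum>k\<in>UNIV. struct E i j k x * E k x h)"
    unfolding sum_distrib_left sum_distrib_right
    by (subst sum_rotate) (simp add: mult_ac)
  also have "\<dots> = ?S (\<lambda>i j. E i x (\<lambda>y. E j y h) - E j x (\<lambda>y. E i y h))"
  proof (intro sum.cong refl arg_cong2[where f="(*)"])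
    fix i j
    have "comm (E i) (E j) x h = (\<Sum>k\<in>UNIV. struct E i j k x * E k x h)"
      unfolding struct_def by (rule frame_expand[OF x vf_tangent[OF vf_comm[OF U frame_vf frame_vf] x]])
    then show "(\<Sum>k\<in>UNIV. struct E i j k x * E k x h) = E i x (\<lambda>y. E j y h) - E j x (\<lambda>y. E i y h)"
      using h by (simp add: comm_def)
  qed
  finally show ?thesis
    unfolding frame_conn_nested[OF V W x h] frame_conn_nested[OF W V x h] swap diff[symmetric]
    by (simp add: sum_subtractf left_diff_distrib)
qed

lemma frame_conn_metric:
  assumes V: "vector_field_on A U V" and V': "vector_field_on A U V'" and W: "vector_field_on A U W" and x: "x \<in> U"
  shows "V x (\<lambda>y. g y (V' y) (W y)) = g x (frame_conn E V V' x) (W x) + g x (V' x) (frame_conn E V W x)"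
proof -
  note t = vf_tangent[OF V x] vf_tangent[OF V' x] vf_tangent[OF W x]
    vf_tangent[OF frame_conn_vf[OF V V'] x] vf_tangent[OF frame_conn_vf[OF V W] x]
  let ?F = "\<lambda>k W. \<Sum>i\<in>UNIV. \<Sum>j\<in>UNIV. fcoeff E V i x * fcoeff E W j x * conn_form E i j k x"
  have "V x (\<lambda>y. g y (V' y) (W y)) = V x (\<lambda>y. \<Sum>k\<in>UNIV. fcoeff E V' k y * fcoeff E W k y)"
    by (rule tangent_cong[OF t(1) U x]) (unfold fcoeff_def, intro g_expand vf_tangent[OF V'] vf_tangent[OF W])
  also have "\<dots> = (\<Sum>k\<in>UNIV. V x (\<lambda>y. fcoeff E V' k y * fcoeff E W k y))"
    by (intro tangent_sum[OF t(1)] smooth_near_mult fcoeff_smooth V' W x)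
  also have "\<dots> = (\<Sum>k\<in>UNIV. fcoeff E V' k x * V x (fcoeff E W k) + fcoeff E W k x * V x (fcoeff E V' k))"
    by (intro sum.cong refl tangent_mult[OF t(1)] fcoeff_smooth V' W x)
  finally have L: "V x (\<lambda>y. g y (V' y) (W y)) = (\<Sum>k\<in>UNIV. fcoeff E V' k x * V x (fcoeff E W k) + fcoeff E W k x * V x (fcoeff E V' k))" .
  have "g x (frame_conn E V V' x) (W x) + g x (V' x) (frame_conn E V W x) =
     (\<Sum>k\<in>UNIV. fcoeff E (frame_conn E V V') k x * fcoeff E W k x) + (\<Sum>k\<in>UNIV. fcoeff E V' k x * fcoeff E (frame_conn E V W) k x)"
    unfolding fcoeff_def by (intro arg_cong2[where f="(+)"] g_expand x t)
  also have "\<dots> = (\<Sum>k\<in>UNIV. fcoeff E V' k x * V x (fcoeff E W k) + fcoeff E W k x * V x (fcoeff E V' k)) +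
      (\<Sum>k\<in>UNIV. ?F k V' * fcoeff E W k x + fcoeff E V' k x * ?F k W)"
    unfolding fcoeff_frame_conn[OF x] by (simp add: sum.distrib algebra_simps)
  \<comment> \<open>Renaming the summation indices in the second sum pairs
    \<open>conn_form E i j k\<close> with \<open>conn_form E i k j\<close>, which cancel by
    \<open>conn_form_metric\<close>.\<close>
  also have "(\<Sum>k\<in>UNIV. ?F k V' * fcoeff E W k x + fcoeff E V' k x * ?F k W) = 0"
  proof -
    have "(\<Sum>k\<in>UNIV. ?F k V' * fcoeff E W k x) =
      (\<Sum>i\<in>UNIV. \<Sum>j\<in>UNIV. \<Sum>k\<in>UNIV. fcoeff E V i x * fcoeff E V' j x * fcoeff E W k x * conn_form E i j k x)"
      unfolding sum_distrib_right
      by (subst sum_rotate) (simp add: mult_ac)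
    moreover have "(\<Sum>k\<in>UNIV. fcoeff E V' k x * ?F k W) =
      (\<Sum>i\<in>UNIV. \<Sum>k\<in>UNIV. \<Sum>j\<in>UNIV. fcoeff E V i x * fcoeff E V' k x * fcoeff E W j x * conn_form E i j k x)"
      unfolding sum_distrib_left
      by (subst sum.swap) (simp add: mult_ac)
    ultimately have "(\<Sum>k\<in>UNIV. ?F k V' * fcoeff E W k x + fcoeff E V' k x * ?F k W) =
      (\<Sum>i\<in>UNIV. \<Sum>j\<in>UNIV. \<Sum>k\<in>UNIV. fcoeff E V i x * fcoeff E V' j x * fcoeff E W k x * conn_form E i j k x +
        fcoeff E V i x * fcoeff E V' j x * fcoeff E W k x * conn_form E i k j x)"
      by (simp only: sum.distrib)
    then show ?thesis by (simp only: distrib_left[symmetric] conn_form_metric[OF x]) simp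
  qed
  finally show ?thesis using L by simp
qed

lemma frame_conn_LC: "LC_on U (frame_conn E)"
  unfolding LC_on_def
proof (intro allI impI conjI ballI)
  fix V V' W f assume V: "vector_field_on A U V" and V': "vector_field_on A U V'" and W: "vector_field_on A U W"
    and f: "smooth_fun_on A U f"
  have fs: "smooth_near A x f" if "x \<in> U" for x using f that smooth_fun_on_iff[OF U] by blast
  show "vector_field_on A U (frame_conn E V W)" by (rule frame_conn_vf[OF V W])
  fix x assume x: "x \<in> U"
  note t = vf_tangent[OF V x] vf_tangent[OF V' x] vf_tangent[OF W x]
  show "frame_conn E (\<lambda>y h. V y h + V' y h) W x = (\<lambda>h. frame_conn E V W x h + frame_conn E V' W x h)"
    unfolding frame_conn_def fcoeff_add[OF x V V']
    by (rule ext) (simp add: algebra_simps sum.distrib sum_distrib_left)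
  show "frame_conn E (\<lambda>y h. f y * V y h) W x = (\<lambda>h. f x * frame_conn E V W x h)"
    unfolding frame_conn_def
    by (rule ext) (simp add: fcoeff_scale[OF x V] algebra_simps sum.distrib sum_distrib_left)
  show "frame_conn E W (\<lambda>y h. V y h + V' y h) x = (\<lambda>h. frame_conn E W V x h + frame_conn E W V' x h)"
  proof -
    have Wk: "W x (fcoeff E (\<lambda>y h. V y h + V' y h) k) = W x (fcoeff E V k) + W x (fcoeff E V' k)" for k
    proof -
      have "W x (fcoeff E (\<lambda>y h. V y h + V' y h) k) = W x (\<lambda>y. fcoeff E V k y + fcoeff E V' k y)"
        by (rule tangent_cong[OF t(3) U x]) (rule fcoeff_add[OF _ V V'])
      then show ?thesis using tangent_add[OF t(3) fcoeff_smooth[OF V x] fcoeff_smooth[OF V' x]] by simp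
    qed
    show ?thesis
      unfolding frame_conn_def fcoeff_add[OF x V V'] Wk
      by (intro ext) (simp add: algebra_simps sum.distrib sum_distrib_left)
  qed
  show "frame_conn E V (\<lambda>y h. f y * W y h) x = (\<lambda>h. f x * frame_conn E V W x h + V x f * W x h)"
  proof
    fix h
    have "V x (fcoeff E (\<lambda>y h. f y * W y h) k) = f x * V x (fcoeff E W k) + fcoeff E W k x * V x f" for k
    proof -
      have "V x (fcoeff E (\<lambda>y h. f y * W y h) k) = V x (\<lambda>y. f y * fcoeff E W k y)"
        by (rule tangent_cong[OF t(1) U x]) (rule fcoeff_scale[OF _ W])
      then show ?thesis using tangent_mult[OF t(1) fs[OF x] fcoeff_smooth[OF W x]] by simp
    qed
    then have "frame_conn E V (\<lambda>y h. f y * W y h) x h = f x * frame_conn E V W x h + V x f * (\<Sum>k\<in>UNIV. fcoeff E W k x * E k x h)"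
      unfolding frame_conn_def
      by (simp add: fcoeff_scale[OF x W] algebra_simps sum.distrib sum_distrib_left)
    then show "frame_conn E V (\<lambda>y h. f y * W y h) x h = f x * frame_conn E V W x h + V x f * W x h"
      using vf_expand[OF W x, of h] by simp
  qed
  show "frame_conn E V W x h - frame_conn E W V x h = V x (\<lambda>y. W y h) - W x (\<lambda>y. V y h)" if "smooth_near A x h" for h
    by (rule frame_conn_torsion[OF V W x that])
  show "V x (\<lambda>y. g y (V' y) (W y)) = g x (frame_conn E V V' x) (W x) + g x (V' x) (frame_conn E V W x)"
    by (rule frame_conn_metric[OF V V' W x])
qed

end

section \<open>Gluing the local connections\<close>

lemma frame_subset: "orthonormal_frame_on A g W e \<Longrightarrow> W' \<subseteq> W \<Longrightarrow> orthonormal_frame_on A g W' e"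
  unfolding orthonormal_frame_on_def using vf_subset by blast

text \<open>At each point \<open>x\<close> the frame chosen around \<open>x\<close> defines
  \<open>D\<close>. The pointwise conditions at \<open>x\<close> follow at once from this frame;
  only the smoothness of \<open>D V W\<close> compares different frames, and
  \<open>LC_unique\<close> makes them agree on overlaps.\<close>

lemma levi_civita_exists: "\<exists>D. levi_civita_connection A g D"
proof -
  have "\<exists>W e. open W \<and> x \<in> W \<and> orthonormal_frame_on A g W e" for x using frame_exists[of x] by metis
  then obtain N F where NF: "\<And>x. open (N x)" "\<And>x. x \<in> N x" "\<And>x. orthonormal_frame_on A g (N x) (F x)"
    by metis
  define D where "D V W x = frame_conn (F x) V W x" for V W x
  have agree: "D V W y = frame_conn (F x) V W y"
    if "open U" "y \<in> U" "y \<in> N x" "vector_field_on A U V" "vector_field_on A U W" for U V W x y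
  proof -
    let ?O = "U \<inter> N x \<inter> N y"
    have O: "open ?O" "y \<in> ?O" using that NF by auto
    have f: "orthonormal_frame_on A g ?O (F x)" "orthonormal_frame_on A g ?O (F y)"
      using frame_subset[OF NF(3), of ?O] by auto
    have v: "vector_field_on A ?O V" "vector_field_on A ?O W"
      using vf_subset[OF that(4), of ?O] vf_subset[OF that(5), of ?O] by auto
    show ?thesis
      unfolding D_def
      by (rule LC_unique[OF O frame_conn_LC[OF O(1) f(2)] frame_conn_LC[OF O(1) f(1)] v f(1)])
  qed
  have "LC_on U D" if U: "open U" for U
    unfolding LC_on_def
  proof (intro allI impI)
    fix V V' W f assume V: "vector_field_on A U V" and V': "vector_field_on A U V'" and W: "vector_field_on A U W"
      and f: "smooth_fun_on A U f"
    have "vector_field_on A U (D V W)"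
    proof (rule vf_local[OF U])
      fix x assume x: "x \<in> U"
      let ?O = "U \<inter> N x"
      have O: "open ?O" "x \<in> ?O" using U x NF by auto
      have fr: "orthonormal_frame_on A g ?O (F x)" using frame_subset[OF NF(3), of ?O] by auto
      have v: "vector_field_on A ?O V" "vector_field_on A ?O W"
        using vf_subset[OF V, of ?O] vf_subset[OF W, of ?O] by auto
      have "vector_field_on A ?O (D V W)"
        by (rule vf_cong[OF O(1) frame_conn_vf[OF O(1) fr v]]) (use agree[OF U _ _ V W] in auto)
      then show "\<exists>O'. open O' \<and> x \<in> O' \<and> vector_field_on A O' (D V W)" using O by blast
    qed
    moreover have "D (\<lambda>y h. V y h + V' y h) W x = (\<lambda>h. D V W x h + D V' W x h) \<and>
           D (\<lambda>y h. f y * V y h) W x = (\<lambda>h. f x * D V W x h) \<and>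
           D W (\<lambda>y h. V y h + V' y h) x = (\<lambda>h. D W V x h + D W V' x h) \<and>
           D V (\<lambda>y h. f y * W y h) x = (\<lambda>h. f x * D V W x h + V x f * W x h) \<and>
           (\<forall>h. smooth_near A x h \<longrightarrow>
              D V W x h - D W V x h = V x (\<lambda>y. W y h) - W x (\<lambda>y. V y h)) \<and>
           V x (\<lambda>y. g y (V' y) (W y)) = g x (D V V' x) (W x) + g x (V' x) (D V W x)" if x: "x \<in> U" for x
    proof -
      have v: "vector_field_on A (U \<inter> N x) V" "vector_field_on A (U \<inter> N x) V'" "vector_field_on A (U \<inter> N x) W"
        "smooth_fun_on A (U \<inter> N x) f"
        using vf_subset[OF V, of "U \<inter> N x"] vf_subset[OF V', of "U \<inter> N x"] vf_subset[OF W, of "U \<inter> N x"]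
          smooth_fun_on_subset[OF f, of "U \<inter> N x"] by auto
      have "LC_on (U \<inter> N x) (frame_conn (F x))"
        by (rule frame_conn_LC[OF open_Int[OF U NF(1)] frame_subset[OF NF(3)]]) auto
      note this[unfolded LC_on_def, THEN spec, THEN spec, THEN spec, THEN spec, THEN mp, OF v(1), THEN mp, OF v(2),
        THEN mp, OF v(3), THEN mp, OF v(4), THEN conjunct2, THEN bspec, OF IntI[OF x NF(2)]]
      then show ?thesis unfolding D_def .
    qed
    ultimately show "vector_field_on A U (D V W) \<and>
        (\<forall>x\<in>U.
           D (\<lambda>y h. V y h + V' y h) W x = (\<lambda>h. D V W x h + D V' W x h) \<and>
           D (\<lambda>y h. f y * V y h) W x = (\<lambda>h. f x * D V W x h) \<and>
           D W (\<lambda>y h. V y h + V' y h) x = (\<lambda>h. D W V x h + D W V' x h) \<and>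
           D V (\<lambda>y h. f y * W y h) x = (\<lambda>h. f x * D V W x h + V x f * W x h) \<and>
           (\<forall>h. smooth_near A x h \<longrightarrow>
              D V W x h - D W V x h = V x (\<lambda>y. W y h) - W x (\<lambda>y. V y h)) \<and>
           V x (\<lambda>y. g y (V' y) (W y)) = g x (D V V' x) (W x) + g x (V' x) (D V W x))"
      by blast
  qed
  then show ?thesis using LC_on_iff by blast
qed

lemma levi_civita: "levi_civita_connection A g (levi_civita A g)"
  unfolding levi_civita_def using levi_civita_exists by (rule someI_ex)

end

section \<open>The product manifold\<close>

definition cons_vec :: "real \<Rightarrow> real ^ 'n::finite \<Rightarrow> real ^ 'n option" where
  "cons_vec t b = (\<chi> k. case k of None \<Rightarrow> t | Some i \<Rightarrow> b $ i)"

definition rest_vec :: "real ^ 'n::finite option \<Rightarrow> real ^ 'n" where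
  "rest_vec a = (\<chi> i. a $ Some i)"

definition pchart :: "('m \<Rightarrow> real ^ 'n::finite) \<Rightarrow> real \<times> 'm \<Rightarrow> real ^ 'n option" where
  "pchart \<phi> p = cons_vec (fst p) (\<phi> (snd p))"

lemma product_atlas_eq: "product_atlas A = (\<lambda>(U, \<phi>). (UNIV \<times> U, pchart \<phi>)) ` A"
proof -
  have "(\<lambda>(t, x). \<chi> k. case k of None \<Rightarrow> t | Some i \<Rightarrow> \<phi> x $ i) = pchart \<phi>" for \<phi> :: "'a \<Rightarrow> real ^ 'b"
    by (auto simp: pchart_def cons_vec_def fun_eq_iff)
  then show ?thesis unfolding product_atlas_def by simp
qed

lemma cons_vec_nth [simp]: "cons_vec t b $ None = t" "cons_vec t b $ Some i = b $ i"
  by (simp_all add: cons_vec_def)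

lemma rest_vec_nth [simp]: "rest_vec a $ i = a $ Some i"
  by (simp add: rest_vec_def)

lemma rest_cons [simp]: "rest_vec (cons_vec t b) = b"
  by (simp add: vec_eq_iff)

lemma cons_rest [simp]: "cons_vec (a $ None) (rest_vec a) = a"
  by (simp add: vec_eq_iff cons_vec_def split: option.split)

lemma pchart_nth [simp]: "pchart \<phi> p $ None = fst p" "pchart \<phi> p $ Some i = \<phi> (snd p) $ i"
  "rest_vec (pchart \<phi> p) = \<phi> (snd p)"
  by (simp_all add: pchart_def)

lemma bounded_linear_rest: "bounded_linear rest_vec"
  by (rule linear_conv_bounded_linear[THEN iffD1], rule linearI) (auto simp: vec_eq_iff)

lemma smooth_on_cons: "smooth_on UNIV (cons_vec t)"
proof (rule smooth_on_vec[OF open_UNIV])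
  fix k :: "'a option"
  show "smooth_on UNIV (\<lambda>b. cons_vec t b $ k)"
    by (cases k) (auto intro: smooth_on_const smooth_on_bounded_linear bounded_linear_vec_nth)
qed

lemma pchart_image: "pchart \<phi> ` (UNIV \<times> W) = rest_vec -` (\<phi> ` W)"
proof (intro equalityI subsetI)
  fix a assume "a \<in> rest_vec -` (\<phi> ` W)"
  then obtain x where "x \<in> W" "rest_vec a = \<phi> x" by auto
  then have "a = pchart \<phi> (a $ None, x)" by (metis cons_rest fst_conv pchart_def snd_conv)
  with \<open>x \<in> W\<close> show "a \<in> pchart \<phi> ` (UNIV \<times> W)" by blast
qed auto

context atlas
begin

context
  fixes U \<phi> assumes U: "(U, \<phi>) \<in> A"
begin

lemma pchart_inj: "inj_on (pchart \<phi>) (UNIV \<times> U)"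
proof (rule inj_onI)
  fix p q assume pq: "p \<in> UNIV \<times> U" "q \<in> UNIV \<times> U" "pchart \<phi> p = pchart \<phi> q"
  have eq: "fst p = fst q" "\<phi> (snd p) = \<phi> (snd q)"
    using arg_cong[OF pq(3), of "\<lambda>a. a $ None"] arg_cong[OF pq(3), of rest_vec] by simp_all
  have "snd p \<in> U" "snd q \<in> U" using pq(1,2) by (simp_all add: mem_Times_iff)
  then show "p = q" by (rule prod_eqI[OF eq(1) inj_onD[OF chart_inj[OF U] eq(2)]])
qed

lemma pchart_inv: "x \<in> U \<Longrightarrow> inv_into (UNIV \<times> U) (pchart \<phi>) (cons_vec t (\<phi> x)) = (t, x)"
  using inv_into_f_f[OF pchart_inj, of "(t, x)"] by (simp add: pchart_def)

lemma pchart_inv': "rest_vec a \<in> \<phi> ` U \<Longrightarrow> inv_into (UNIV \<times> U) (pchart \<phi>) a = (a $ None, inv_into U \<phi> (rest_vec a))"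
proof -
  assume "rest_vec a \<in> \<phi> ` U"
  then obtain x where x: "x \<in> U" "rest_vec a = \<phi> x" by auto
  then have "a = cons_vec (a $ None) (\<phi> x)" by (metis cons_rest)
  then show ?thesis using pchart_inv[OF x(1), of "a $ None"] x chart_inverse[OF U] by metis
qed

lemma pchart_open: "open (rest_vec -` (\<phi> ` U))"
  by (rule open_vimage[OF chart_open(2)[OF U] bounded_linear.continuous_on[OF bounded_linear_rest continuous_on_id]])

lemma pchart_continuous: "continuous_on (UNIV \<times> U) (pchart \<phi>)"
proof -
  have "continuous_on (UNIV \<times> U) (\<lambda>p. \<phi> (snd p))"
    by (rule continuous_on_compose2[OF chart_continuous(1)[OF U]]) (auto intro: continuous_intros)
  then have "continuous_on (UNIV \<times> U) (\<lambda>p. pchart \<phi> p $ k)" for k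
    by (cases k) (auto intro!: continuous_intros)
  then have "continuous_on (UNIV \<times> U) (\<lambda>p. \<chi> k. pchart \<phi> p $ k)" by (intro continuous_on_vec_lambda)
  then show ?thesis by simp
qed

lemma pchart_homeomorphism:
  "homeomorphism (UNIV \<times> U) (pchart \<phi> ` (UNIV \<times> U)) (pchart \<phi>) (inv_into (UNIV \<times> U) (pchart \<phi>))"
  unfolding homeomorphism_def
proof (intro conjI ballI)
  show "continuous_on (pchart \<phi> ` (UNIV \<times> U)) (inv_into (UNIV \<times> U) (pchart \<phi>))"
  proof (rule continuous_on_eq)
    have "continuous_on (rest_vec -` (\<phi> ` U)) (\<lambda>a. inv_into U \<phi> (rest_vec a))"
      by (rule continuous_on_compose2[OF chart_continuous(2)[OF U] bounded_linear.continuous_on[OF bounded_linear_rest continuous_on_id]]) auto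
    then show "continuous_on (pchart \<phi> ` (UNIV \<times> U)) (\<lambda>a. (a $ None, inv_into U \<phi> (rest_vec a)))"
      unfolding pchart_image by (intro continuous_intros)
  qed (simp add: pchart_image pchart_inv')
qed (use pchart_inj pchart_continuous in \<open>auto simp: inv_into_into f_inv_into_f image_iff\<close>)

end

text \<open>A transition between product charts is the identity in the first coordinate and a
  transition of the given atlas in the others.\<close>

lemma product_smooth_atlas: "smooth_atlas (product_atlas A)"
  unfolding smooth_atlas_def
proof (intro conjI)
  show "\<forall>(U, \<phi>)\<in>product_atlas A. open U \<and> open (\<phi> ` U) \<and> homeomorphism U (\<phi> ` U) \<phi> (inv_into U \<phi>)"
    using pchart_homeomorphism pchart_open chart_open
    by (auto simp: product_atlas_eq pchart_image open_Times)
  show "(\<Union>(U, \<phi>)\<in>product_atlas A. U) = UNIV"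
  proof -
    have "p \<in> (\<Union>(U, \<phi>)\<in>product_atlas A. U)" for p
    proof -
      obtain U \<phi> where "(U, \<phi>) \<in> A" "snd p \<in> U" by (rule chart_cover)
      then have "(UNIV \<times> U, pchart \<phi>) \<in> product_atlas A" "p \<in> UNIV \<times> U"
        by (auto simp: product_atlas_eq mem_Times_iff)
      then show ?thesis by blast
    qed
    then show ?thesis by blast
  qed
  show "\<forall>(U, \<phi>)\<in>product_atlas A. \<forall>(V, \<psi>)\<in>product_atlas A. smooth_on (\<phi> ` (U \<inter> V)) (\<psi> \<circ> inv_into U \<phi>)"
  proof (clarsimp simp: product_atlas_eq simp del: o_apply)
    fix U \<phi> V \<psi> assume U: "(U, \<phi>) \<in> A" and V: "(V, \<psi>) \<in> A"
    have UV: "UNIV \<times> U \<inter> UNIV \<times> V = UNIV \<times> (U \<inter> V)" by auto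
    have o: "open (\<phi> ` (U \<inter> V))" using chart_open_image[OF U, of "U \<inter> V"] chart_open[OF U] chart_open[OF V] by auto
    have S: "open (rest_vec -` (\<phi> ` (U \<inter> V)))"
      by (rule open_vimage[OF o bounded_linear.continuous_on[OF bounded_linear_rest continuous_on_id]])
    have tr: "smooth_on (\<phi> ` (U \<inter> V)) (\<psi> \<circ> inv_into U \<phi>)"
      using smooth_transition[OF V U] by simp
    have "smooth_on (rest_vec -` (\<phi> ` (U \<inter> V))) (pchart \<psi> \<circ> inv_into (UNIV \<times> U) (pchart \<phi>))"
    proof (rule smooth_on_vec[OF S])
      fix k
      show "smooth_on (rest_vec -` (\<phi> ` (U \<inter> V))) (\<lambda>a. (pchart \<psi> \<circ> inv_into (UNIV \<times> U) (pchart \<phi>)) a $ k)"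
      proof (cases k)
        case None
        have "smooth_on (rest_vec -` (\<phi> ` (U \<inter> V))) (\<lambda>a. a $ None)"
          by (rule smooth_on_bounded_linear[OF S bounded_linear_vec_nth])
        then show ?thesis
          by (rule smooth_on_cong[OF S, rotated]) (auto simp: None pchart_inv'[OF U])
      next
        case (Some i)
        have "smooth_on (rest_vec -` (\<phi> ` (U \<inter> V))) (\<lambda>a. (\<lambda>b. (\<psi> \<circ> inv_into U \<phi>) b $ i) (rest_vec a))"
          by (rule smooth_on_compose[OF S o _ smooth_on_bounded_linear[OF S bounded_linear_rest] smooth_on_vec_nth[OF o tr]]) auto
        then show ?thesis
          by (rule smooth_on_cong[OF S, rotated]) (auto simp: Some pchart_inv'[OF U])
      qed
    qed
    then show "smooth_on (pchart \<phi> ` (UNIV \<times> U \<inter> UNIV \<times> V)) (pchart \<psi> \<circ> inv_into (UNIV \<times> U) (pchart \<phi>))"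
      unfolding UV pchart_image .
  qed
qed

end

section \<open>Functions and tangent vectors on the product\<close>

locale product_manifold = M: riemannian A g
  for A :: "('m::{t2_space,second_countable_topology}, 'n::finite) chart set" and g :: "'m metric"
begin

sublocale P: atlas "product_atlas A"
  by unfold_locales (rule M.product_smooth_atlas)

lemma pchart_mem: "(U, \<phi>) \<in> A \<Longrightarrow> (UNIV \<times> U, pchart \<phi>) \<in> product_atlas A"
  by (auto simp: product_atlas_eq)

lemma pchart_ex:
  obtains U \<phi> where "(U, \<phi>) \<in> A" "snd p \<in> U" "(UNIV \<times> U, pchart \<phi>) \<in> product_atlas A" "p \<in> UNIV \<times> U"
proof -
  obtain U \<phi> where "(U, \<phi>) \<in> A" "snd p \<in> U" by (rule M.chart_cover)
  then show ?thesis using that pchart_mem by (simp add: mem_Times_iff)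
qed

lemma smooth_near_fst: "smooth_near (product_atlas A) p fst"
proof -
  obtain U \<phi> where U: "(UNIV \<times> U, pchart \<phi>) \<in> product_atlas A" "p \<in> UNIV \<times> U" by (rule pchart_ex)
  show ?thesis using P.smooth_near_coord[OF U, of None] by simp
qed

lemma smooth_near_snd:
  assumes f: "smooth_near A (snd p) f"
  shows "smooth_near (product_atlas A) p (f \<circ> snd)"
proof -
  obtain U \<phi> where U: "(U, \<phi>) \<in> A" "snd p \<in> U" and PU: "(UNIV \<times> U, pchart \<phi>) \<in> product_atlas A" "p \<in> UNIV \<times> U"
    by (rule pchart_ex)
  obtain r where r: "r > 0" "ball (\<phi> (snd p)) r \<subseteq> \<phi> ` U" "smooth_on (ball (\<phi> (snd p)) r) (f \<circ> inv_into U \<phi>)"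
    using M.chart_smooth_germ[OF U f] .
  let ?S = "rest_vec -` ball (\<phi> (snd p)) r :: (real ^ 'n option) set"
  have S: "open ?S"
    by (rule open_vimage[OF open_ball bounded_linear.continuous_on[OF bounded_linear_rest continuous_on_id]])
  have "smooth_on ?S (\<lambda>a. (f \<circ> inv_into U \<phi>) (rest_vec a))"
    by (rule smooth_on_compose[OF S open_ball _ smooth_on_bounded_linear[OF S bounded_linear_rest] r(3)]) auto
  then have "smooth_near (product_atlas A) p (\<lambda>q. (f \<circ> inv_into U \<phi>) (rest_vec (pchart \<phi> q)))"
    by (rule P.smooth_near_comp_coord[OF PU S, rotated]) (simp add: r)
  then show ?thesis
    by (rule P.smooth_near_cong[OF _ P.chart_open(1)[OF PU(1)] PU(2)]) (auto simp: M.chart_inverse[OF U(1)])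
qed

lemma smooth_near_slice:
  assumes u: "smooth_near (product_atlas A) (t, x) u"
  shows "smooth_near A x (\<lambda>y. u (t, y))"
proof -
  obtain U \<phi> where U: "(U, \<phi>) \<in> A" "x \<in> U" and PU: "(UNIV \<times> U, pchart \<phi>) \<in> product_atlas A" "(t, x) \<in> UNIV \<times> U"
    using pchart_ex[of "(t, x)"] by auto
  let ?F = "u \<circ> inv_into (UNIV \<times> U) (pchart \<phi>)"
  obtain r where r: "r > 0" "ball (pchart \<phi> (t, x)) r \<subseteq> pchart \<phi> ` (UNIV \<times> U)" "smooth_on (ball (pchart \<phi> (t, x)) r) ?F"
    using P.chart_smooth_germ[OF PU u] .
  let ?S = "cons_vec t -` ball (pchart \<phi> (t, x)) r"
  have S: "open ?S"
    by (rule open_vimage[OF open_ball smooth_on_imp_continuous_on[OF smooth_on_cons]])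
  have "smooth_on ?S (\<lambda>b. ?F (cons_vec t b))"
    by (rule smooth_on_compose[OF S open_ball _ smooth_on_subset[OF smooth_on_cons] r(3)]) auto
  then have "smooth_near A x (\<lambda>y. ?F (cons_vec t (\<phi> y)))"
    by (rule M.smooth_near_comp_coord[OF U S, rotated]) (use r in \<open>simp add: pchart_def\<close>)
  then show ?thesis
    by (rule M.smooth_near_cong[OF _ M.chart_open(1)[OF U(1)] U(2)]) (simp add: M.pchart_inv[OF U(1)])
qed

text \<open>Both directions matter for the push-forward: tangent vectors vanish on nonsmooth
  functions, and this default has to survive composition with \<open>snd\<close>.\<close>

lemma smooth_near_snd_iff: "smooth_near (product_atlas A) p (f \<circ> snd) \<longleftrightarrow> smooth_near A (snd p) f"
  using smooth_near_snd[of p f] smooth_near_slice[of "fst p" "snd p" "f \<circ> snd"] by auto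

text \<open>Identifies the \<open>deriv\<close> in \<open>bar_frame\<close> with a coordinate vector
  of the product chart, for which smoothness and the derivation property are known.\<close>

lemma pd_None:
  assumes U: "(U, \<phi>) \<in> A" "x \<in> U" and u: "smooth_near (product_atlas A) (t, x) u"
  shows "deriv (\<lambda>s. u (s, x)) t = P.cvec (UNIV \<times> U) (pchart \<phi>) None (t, x) u"
proof -
  let ?F = "u \<circ> inv_into (UNIV \<times> U) (pchart \<phi>)" and ?a = "pchart \<phi> (t, x)"
  have D: "(?F has_derivative frechet_derivative ?F (at ?a)) (at ?a)"
    by (rule P.chart_has_derivative[OF pchart_mem[OF U(1)] _ u]) (simp add: U)
  interpret L: bounded_linear "frechet_derivative ?F (at ?a)" by (rule has_derivative_bounded_linear[OF D])
  have c: "cons_vec s (\<phi> x) = ?a + (s - t) *\<^sub>R axis None 1" for s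
    by (auto simp: vec_eq_iff pchart_def cons_vec_def axis_def split: option.split)
  have "((\<lambda>s. ?a + (s - t) *\<^sub>R axis None 1) has_derivative (\<lambda>s. s *\<^sub>R axis None 1)) (at t)"
    by (auto intro!: derivative_eq_intros)
  moreover have "(?F has_derivative frechet_derivative ?F (at ?a)) (at (?a + (t - t) *\<^sub>R axis None 1))" using D by simp
  ultimately have "((\<lambda>s. ?F (?a + (s - t) *\<^sub>R axis None 1)) has_derivative (\<lambda>s. frechet_derivative ?F (at ?a) (s *\<^sub>R axis None 1))) (at t)"
    by (rule has_derivative_compose)
  moreover have "?F (?a + (s - t) *\<^sub>R axis None 1) = u (s, x)" for s
    unfolding c[symmetric] by (simp add: M.pchart_inv[OF U])
  ultimately have "((\<lambda>s. u (s, x)) has_derivative (\<lambda>s. s * pd None ?F ?a)) (at t)"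
    by (simp add: L.scaleR pd_def)
  then have "((\<lambda>s. u (s, x)) has_real_derivative pd None ?F ?a) (at t)"
    by (simp add: has_field_derivative_def mult_commute_abs)
  then show ?thesis using u by (simp add: DERIV_imp_deriv P.cvec_def)
qed

lemma pd_Some:
  assumes U: "(U, \<phi>) \<in> A" "x \<in> U" and u: "smooth_near (product_atlas A) (t, x) u"
  shows "M.cvec U \<phi> i x (\<lambda>y. u (t, y)) = P.cvec (UNIV \<times> U) (pchart \<phi>) (Some i) (t, x) u"
proof -
  let ?F = "u \<circ> inv_into (UNIV \<times> U) (pchart \<phi>)" and ?a = "pchart \<phi> (t, x)"
  have D: "(?F has_derivative frechet_derivative ?F (at ?a)) (at ?a)"
    by (rule P.chart_has_derivative[OF pchart_mem[OF U(1)] _ u]) (simp add: U)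
  have D': "(?F has_derivative frechet_derivative ?F (at ?a)) (at (cons_vec t (\<phi> x)))"
  proof -
    have "?a = cons_vec t (\<phi> x)" by (simp add: pchart_def)
    then show ?thesis using D by metis
  qed
  define L :: "real ^ 'n \<Rightarrow> real ^ 'n option" where "L v = cons_vec 0 v" for v
  have L: "bounded_linear L"
    by (rule linear_conv_bounded_linear[THEN iffD1], rule linearI)
       (auto simp: vec_eq_iff L_def cons_vec_def split: option.split)
  have c: "cons_vec t b = cons_vec t 0 + L b" for b :: "real ^ 'n"
    by (auto simp: vec_eq_iff L_def cons_vec_def split: option.split)
  have "((\<lambda>b. cons_vec t 0 + L b) has_derivative L) (at (\<phi> x))"
    using has_derivative_add[OF has_derivative_const bounded_linear_imp_has_derivative[OF L]] by simp
  then have "(cons_vec t has_derivative L) (at (\<phi> x))" by (simp only: c[symmetric])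
  then have "((\<lambda>b. ?F (cons_vec t b)) has_derivative (\<lambda>v. frechet_derivative ?F (at ?a) (L v))) (at (\<phi> x))"
    by (rule has_derivative_compose[where f="cons_vec t", OF _ D'])
  then have "(((\<lambda>y. u (t, y)) \<circ> inv_into U \<phi>) has_derivative (\<lambda>v. frechet_derivative ?F (at ?a) (L v))) (at (\<phi> x))"
    by (rule has_derivative_transform_within_open[OF _ M.chart_open(2)[OF U(1)]])
       (use U in \<open>auto simp: M.pchart_inv[OF U(1)] M.chart_inverse[OF U(1)]\<close>)
  from pd_has_derivative[OF this, of i]
  have "pd i ((\<lambda>y. u (t, y)) \<circ> inv_into U \<phi>) (\<phi> x) = frechet_derivative ?F (at ?a) (L (axis i 1))" .
  also have "L (axis i 1) = axis (Some i) 1"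
    by (auto simp: vec_eq_iff L_def cons_vec_def axis_def split: option.split)
  finally show ?thesis
    by (simp only: M.cvec_def P.cvec_def u smooth_near_slice[OF u] if_True pd_def[symmetric])
qed

definition push :: "(real \<times> 'm) tangent \<Rightarrow> 'm tangent" where
  "push X = (\<lambda>f. X (f \<circ> snd))"

lemma product_metric_eq: "product_metric g p X Y = X fst * Y fst + g (snd p) (push X) (push Y)"
  by (simp add: product_metric_def push_def split: prod.split)

lemma push_tangent:
  assumes X: "X \<in> tangent_space (product_atlas A) p"
  shows "push X \<in> tangent_space A (snd p)"
  unfolding tangent_space_def
proof (intro CollectI conjI allI impI)
  fix f h a b assume fh: "smooth_near A (snd p) f" "smooth_near A (snd p) h"
  note s = smooth_near_snd[OF fh(1)] smooth_near_snd[OF fh(2)]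
  show "push X (\<lambda>y. a * f y + b * h y) = a * push X f + b * push X h"
    using P.tangent_lincomb[OF X s, of a b] by (simp add: push_def o_def)
  show "push X (\<lambda>y. f y * h y) = f (snd p) * push X h + h (snd p) * push X f"
    using P.tangent_mult[OF X s] by (simp add: push_def o_def)
  assume "eventually (\<lambda>y. f y = h y) (nhds (snd p))"
  then obtain N where N: "open N" "snd p \<in> N" "\<And>y. y \<in> N \<Longrightarrow> f y = h y" by (auto simp: eventually_nhds)
  show "push X f = push X h"
    unfolding push_def
    by (rule P.tangent_cong[OF X, of "UNIV \<times> N"]) (use N in \<open>auto simp: mem_Times_iff open_Times\<close>)
next
  fix f assume "\<not> smooth_near A (snd p) f"
  then show "push X f = 0" unfolding push_def by (intro P.tangent_nonsmooth[OF X]) (simp add: smooth_near_snd_iff)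
qed

lemma product_expand:
  assumes U: "(U, \<phi>) \<in> A" "snd p \<in> U" and X: "X \<in> tangent_space (product_atlas A) p"
  shows "X f = X fst * P.cvec (UNIV \<times> U) (pchart \<phi>) None p f +
    (\<Sum>i\<in>UNIV. push X (\<lambda>y. \<phi> y $ i) * P.cvec (UNIV \<times> U) (pchart \<phi>) (Some i) p f)"
proof -
  have "p \<in> UNIV \<times> U" using U by (simp add: mem_Times_iff)
  from P.tangent_expand[OF pchart_mem[OF U(1)] this X, of f] show ?thesis
    by (simp add: sum_UNIV_option push_def o_def)
qed

end

context riemannian
begin

lemma g_sum2:
  assumes "\<And>i. i \<in> I \<Longrightarrow> X i \<in> tangent_space A x" "\<And>j. j \<in> J \<Longrightarrow> Y j \<in> tangent_space A x"
  shows "g x (\<lambda>f. \<Sum>i\<in>I. a i * X i f) (\<lambda>f. \<Sum>j\<in>J. b j * Y j f) =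
    (\<Sum>i\<in>I. \<Sum>j\<in>J. a i * b j * g x (X i) (Y j))"
proof -
  let ?Y = "\<lambda>f. \<Sum>j\<in>J. b j * Y j f"
  have Y: "?Y \<in> tangent_space A x" by (rule tangent_space_sum[OF assms(2)])
  have Yi: "g x (X i) ?Y = (\<Sum>j\<in>J. b j * g x (X i) (Y j))" if i: "i \<in> I" for i
  proof -
    have "g x (X i) ?Y = g x ?Y (X i)" by (rule g_sym[OF assms(1)[OF i] Y])
    also have "\<dots> = (\<Sum>j\<in>J. b j * g x (Y j) (X i))" by (rule g_sum[OF assms(2) assms(1)[OF i]])
    also have "\<dots> = (\<Sum>j\<in>J. b j * g x (X i) (Y j))"
      by (intro sum.cong refl) (simp add: g_sym[OF assms(2) assms(1)[OF i]])
    finally show ?thesis .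
  qed
  have "g x (\<lambda>f. \<Sum>i\<in>I. a i * X i f) ?Y = (\<Sum>i\<in>I. a i * g x (X i) ?Y)"
    by (rule g_sum[OF assms(1) Y])
  also have "\<dots> = (\<Sum>i\<in>I. a i * (\<Sum>j\<in>J. b j * g x (X i) (Y j)))"
    by (intro sum.cong refl arg_cong2[where f="(*)"] Yi)
  finally show ?thesis by (simp add: sum_distrib_left mult.assoc)
qed

end

context product_manifold
begin

lemma push_lincomb: "push (\<lambda>f. a * X f + b * Y f) = (\<lambda>f. a * push X f + b * push Y f)"
  by (simp add: push_def)

section \<open>The product metric and the frames adapted to it\<close>

text \<open>The push-forward of a field on the product varies with the real coordinate too and is no
  field on the manifold, so smoothness of \<open>g\<close> does not apply to it directly. After an
  expansion in coordinate fields, \<open>g\<close> is evaluated on those only.\<close>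

lemma product_metric_smooth:
  assumes W: "open W" and V: "vector_field_on (product_atlas A) W V" and V': "vector_field_on (product_atlas A) W V'"
    and p: "p \<in> W"
  shows "smooth_near (product_atlas A) p (\<lambda>q. product_metric g q (V q) (V' q))"
proof -
  obtain U \<phi> where U: "(U, \<phi>) \<in> A" "snd p \<in> U" and PU: "(UNIV \<times> U, pchart \<phi>) \<in> product_atlas A" "p \<in> UNIV \<times> U"
    by (rule pchart_ex)
  let ?d = "\<lambda>i. M.cvec U \<phi> i"
  let ?c = "\<lambda>V i q. V q ((\<lambda>y. \<phi> y $ i) \<circ> snd)"
  have O: "open (W \<inter> UNIV \<times> U)" using W P.chart_open(1)[OF PU(1)] by blast
  have cs: "smooth_near (product_atlas A) p (?c V i)" "smooth_near (product_atlas A) p (?c V' i)" for i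
    using P.vf_smooth[OF V W p smooth_near_snd[OF M.smooth_near_coord[OF U]]]
      P.vf_smooth[OF V' W p smooth_near_snd[OF M.smooth_near_coord[OF U]]] by blast+
  have gs: "smooth_near (product_atlas A) p ((\<lambda>y. g y (?d i y) (?d j y)) \<circ> snd)" for i j
    by (rule smooth_near_snd[OF M.g_smooth[OF M.chart_open(1)[OF U(1)] M.vf_cvec[OF U(1)] M.vf_cvec[OF U(1)] U(2)]])
  have "smooth_near (product_atlas A) p (\<lambda>q. V q fst * V' q fst +
      (\<Sum>i\<in>UNIV. \<Sum>j\<in>UNIV. ?c V i q * ?c V' j q * ((\<lambda>y. g y (?d i y) (?d j y)) \<circ> snd) q))"
    by (intro P.smooth_near_add P.smooth_near_sum P.smooth_near_mult cs gs P.vf_smooth[OF V W p] P.vf_smooth[OF V' W p] smooth_near_fst)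
  then show ?thesis
  proof (rule P.smooth_near_cong[OF _ O])
    show "p \<in> W \<inter> UNIV \<times> U" using p PU by blast
    fix q assume q: "q \<in> W \<inter> UNIV \<times> U"
    then have qU: "snd q \<in> U" and qW: "q \<in> W" by (auto simp: mem_Times_iff)
    have ex: "push X = (\<lambda>f. \<Sum>i\<in>UNIV. X ((\<lambda>y. \<phi> y $ i) \<circ> snd) * ?d i (snd q) f)"
      if "X \<in> tangent_space (product_atlas A) q" for X
    proof
      fix f show "push X f = (\<Sum>i\<in>UNIV. X ((\<lambda>y. \<phi> y $ i) \<circ> snd) * ?d i (snd q) f)"
        using M.tangent_expand[OF U(1) qU push_tangent[OF that], of f] by (simp only: push_def)
    qed
    show "V q fst * V' q fst + (\<Sum>i\<in>UNIV. \<Sum>j\<in>UNIV. ?c V i q * ?c V' j q * ((\<lambda>y. g y (?d i y) (?d j y)) \<circ> snd) q) =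
      product_metric g q (V q) (V' q)"
      unfolding product_metric_eq ex[OF P.vf_tangent[OF V qW]] ex[OF P.vf_tangent[OF V' qW]]
      by (subst M.g_sum2) (auto intro: M.cvec_tangent[OF U(1) qU])
  qed
qed

lemma product_riemannian: "riemannian_metric (product_atlas A) (product_metric g)"
  unfolding riemannian_metric_def
proof (intro conjI allI ballI impI)
  fix p X Y
  assume X: "X \<in> tangent_space (product_atlas A) p" and Y: "Y \<in> tangent_space (product_atlas A) p"
  note t = push_tangent[OF X] push_tangent[OF Y]
  show "product_metric g p X Y = product_metric g p Y X"
    unfolding product_metric_eq by (subst M.g_sym[OF t]) simp
  show "product_metric g p X X > 0" if X0: "X \<noteq> (\<lambda>f. 0)"
  proof (cases "push X = (\<lambda>f. 0)")
    case True
    obtain U \<phi> where U: "(U, \<phi>) \<in> A" "snd p \<in> U" by (rule M.chart_cover)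
    \<comment> \<open>With zero push-forward only the component along the real line is left, so it
      cannot vanish as well.\<close>
    have "X fst \<noteq> 0"
    proof
      assume "X fst = 0"
      then have "X f = 0" for f using product_expand[OF U X, of f] True by simp
      then show False using X0 by blast
    qed
    moreover have "g (snd p) (push X) (push X) = 0" using M.g_zero[OF t(1)] True by simp
    ultimately show ?thesis unfolding product_metric_eq by (simp add: zero_less_mult_iff) linarith
  next
    case False
    then show ?thesis unfolding product_metric_eq using M.g_pos[OF t(1)]
      by (intro add_nonneg_pos) auto
  qed
  fix Z a b assume Z: "Z \<in> tangent_space (product_atlas A) p"
  show "product_metric g p (\<lambda>f. a * X f + b * Y f) Z = a * product_metric g p X Z + b * product_metric g p Y Z"
    unfolding product_metric_eq push_lincomb M.g_lin[OF t push_tangent[OF Z]] by (simp add: algebra_simps)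
next
  fix W V V' assume W: "open W" "vector_field_on (product_atlas A) W V" "vector_field_on (product_atlas A) W V'"
  show "smooth_fun_on (product_atlas A) W (\<lambda>x. product_metric g x (V x) (V' x))"
    unfolding P.smooth_fun_on_iff[OF W(1)] using product_metric_smooth[OF W] by blast
qed

sublocale R: riemannian "product_atlas A" "product_metric g"
  by unfold_locales (rule product_riemannian)

lemma bar_frame_None:
  assumes "(U, \<phi>) \<in> A" "x \<in> U"
  shows "bar_frame A e None (t, x) = P.cvec (UNIV \<times> U) (pchart \<phi>) None (t, x)"
proof
  fix u show "bar_frame A e None (t, x) u = P.cvec (UNIV \<times> U) (pchart \<phi>) None (t, x) u"
  proof (cases "smooth_near (product_atlas A) (t, x) u")
    case True
    then show ?thesis using pd_None[OF assms True] by (simp add: bar_frame_def)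
  qed (simp add: bar_frame_def P.cvec_def)
qed

lemma bar_frame_Some:
  assumes U: "(U, \<phi>) \<in> A" "x \<in> U" and e: "e i x \<in> tangent_space A x"
  shows "bar_frame A e (Some i) (t, x) =
    (\<lambda>u. \<Sum>j\<in>UNIV. e i x (\<lambda>y. \<phi> y $ j) * P.cvec (UNIV \<times> U) (pchart \<phi>) (Some j) (t, x) u)"
proof
  fix u show "bar_frame A e (Some i) (t, x) u =
    (\<Sum>j\<in>UNIV. e i x (\<lambda>y. \<phi> y $ j) * P.cvec (UNIV \<times> U) (pchart \<phi>) (Some j) (t, x) u)"
  proof (cases "smooth_near (product_atlas A) (t, x) u")
    case True
    then show ?thesis
      using M.tangent_expand[OF U e, of "\<lambda>y. u (t, y)"] pd_Some[OF U True] by (simp add: bar_frame_def)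
  qed (simp add: bar_frame_def P.cvec_def)
qed

lemma bar_frame_vf:
  assumes W: "open W" and e: "\<And>i. vector_field_on A W (e i)"
  shows "vector_field_on (product_atlas A) (UNIV \<times> W) (bar_frame A e k)"
proof (rule P.vf_local)
  show "open ((UNIV :: real set) \<times> W)" using W by (simp add: open_Times)
  fix p :: "real \<times> 'm" assume p: "p \<in> UNIV \<times> W"
  obtain U \<phi> where U: "(U, \<phi>) \<in> A" "snd p \<in> U" and PU: "(UNIV \<times> U, pchart \<phi>) \<in> product_atlas A" "p \<in> UNIV \<times> U"
    by (rule pchart_ex)
  let ?O = "(UNIV :: real set) \<times> (U \<inter> W)"
  have O: "open ?O" using W M.chart_open(1)[OF U(1)] by (simp add: open_Times open_Int)
  have c: "vector_field_on (product_atlas A) ?O (P.cvec (UNIV \<times> U) (pchart \<phi>) l)" for l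
    by (rule P.vf_subset[OF P.vf_cvec[OF PU(1)]]) auto
  have "vector_field_on (product_atlas A) ?O (bar_frame A e k)"
  proof (cases k)
    case None
    show ?thesis unfolding None
    proof (rule P.vf_cong[OF O c[of None]])
      fix q assume "q \<in> ?O"
      then have "snd q \<in> U" by auto
      from bar_frame_None[OF U(1) this, of e "fst q"]
      show "P.cvec (UNIV \<times> U) (pchart \<phi>) None q = bar_frame A e None q" by simp
    qed
  next
    case (Some i)
    have "vector_field_on (product_atlas A) ?O
      (\<lambda>q u. \<Sum>j\<in>UNIV. ((\<lambda>x. e i x (\<lambda>y. \<phi> y $ j)) \<circ> snd) q * P.cvec (UNIV \<times> U) (pchart \<phi>) (Some j) q u)"
    proof (rule P.vf_sum[OF O c])
      fix j and q :: "real \<times> 'm" assume "q \<in> ?O"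
      then have q: "snd q \<in> U" "snd q \<in> W" by auto
      show "smooth_near (product_atlas A) q ((\<lambda>x. e i x (\<lambda>y. \<phi> y $ j)) \<circ> snd)"
        by (rule smooth_near_snd[OF M.vf_smooth[OF e W q(2) M.smooth_near_coord[OF U(1) q(1)]]])
    qed
    then show ?thesis unfolding Some
    proof (rule P.vf_cong[OF O])
      fix q assume "q \<in> ?O"
      then have q: "snd q \<in> U" "snd q \<in> W" by auto
      from bar_frame_Some[OF U(1) q(1), of e i "fst q"] M.vf_tangent[OF e q(2)]
      show "(\<lambda>u. \<Sum>j\<in>UNIV. ((\<lambda>x. e i x (\<lambda>y. \<phi> y $ j)) \<circ> snd) q * P.cvec (UNIV \<times> U) (pchart \<phi>) (Some j) q u) = bar_frame A e (Some i) q"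
        by simp
    qed
  qed
  moreover have "p \<in> ?O" using p U by auto
  ultimately show "\<exists>O'. open O' \<and> p \<in> O' \<and> vector_field_on (product_atlas A) O' (bar_frame A e k)"
    using O by blast
qed

lemma bar_frame_orthonormal:
  assumes W: "open W" and e: "orthonormal_frame_on A g W e"
  shows "orthonormal_frame_on (product_atlas A) (product_metric g) (UNIV \<times> W) (bar_frame A e)"
  unfolding orthonormal_frame_on_def
proof (intro conjI allI ballI)
  have ev: "vector_field_on A W (e i)" for i using e by (simp add: orthonormal_frame_on_def)
  show "vector_field_on (product_atlas A) (UNIV \<times> W) (bar_frame A e k)" for k by (rule bar_frame_vf[OF W ev])
  fix p :: "real \<times> 'm" and k l assume p: "p \<in> UNIV \<times> W"
  obtain t x where tx: "p = (t, x)" "x \<in> W" using p by auto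
  then have sp: "snd p = x" by simp
  note et = M.vf_tangent[OF ev tx(2)]
  have smooth_snd: "smooth_near (product_atlas A) (t, x) (f \<circ> snd) \<longleftrightarrow> smooth_near A x f" for f :: "'m \<Rightarrow> real"
    using smooth_near_snd_iff[of "(t, x)" f] by simp
  have fN: "bar_frame A e None p fst = 1" "bar_frame A e (Some i) p fst = 0" for i
    using smooth_near_fst[of p] M.tangent_const[OF et] by (simp_all add: bar_frame_def tx)
  have pN: "push (bar_frame A e None p) = (\<lambda>f. 0)"
    by (auto simp: push_def bar_frame_def tx fun_eq_iff)
  have pS: "push (bar_frame A e (Some i) p) = e i x" for i
    using M.tangent_nonsmooth[OF et] by (auto simp: push_def bar_frame_def tx fun_eq_iff smooth_snd)
  have on: "g x (e i x) (e j x) = (if i = j then 1 else 0)" for i j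
    using e tx(2) by (simp add: orthonormal_frame_on_def)
  have z: "g x (\<lambda>f. 0) Z = 0" "g x Z (\<lambda>f. 0) = 0" if "Z \<in> tangent_space A x" for Z
    using M.g_zero[OF that] M.g_sym[OF that M.tangent_space_zero] by simp_all
  show "product_metric g p (bar_frame A e k p) (bar_frame A e l p) = (if k = l then 1 else 0)"
    by (cases k; cases l)
       (simp_all add: product_metric_eq fN pN pS on z[OF et] z[OF M.tangent_space_zero] sp)
qed

end

section \<open>The Riemannian Hessian\<close>

lemma (in atlas) smooth_near_isCont:
  assumes "smooth_near A x f"
  shows "isCont f x"
proof -
  obtain U \<phi> where U: "(U, \<phi>) \<in> A" "x \<in> U" by (rule chart_cover)
  obtain W where W: "open W" "x \<in> W" "W \<subseteq> U" "smooth_on (\<phi> ` W) (f \<circ> inv_into U \<phi>)"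
    using assms smooth_near_chart[OF U] by auto
  have "continuous_on W (\<lambda>y. (f \<circ> inv_into U \<phi>) (\<phi> y))"
    by (rule continuous_on_compose2[OF smooth_on_imp_continuous_on[OF W(4)] continuous_on_subset[OF chart_continuous(1)[OF U(1)] W(3)]]) simp
  then have "continuous_on W f"
    by (rule continuous_on_eq) (use W(3) in \<open>auto simp: chart_inverse[OF U(1)]\<close>)
  then show ?thesis using W by (simp add: continuous_on_eq_continuous_at)
qed

lemma (in atlas) tangent_zero_product:
  assumes "X \<in> tangent_space A x" "smooth_near A x f" "smooth_near A x h" "f x = 0" "h x = 0"
  shows "X (\<lambda>y. f y * h y) = 0"
  using tangent_mult[OF assms(1-3)] assms by simp

context riemannian
begin

section \<open>Locality of the connection, tensoriality of the Hessian\<close>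

abbreviation "LC \<equiv> levi_civita A g"

lemma LC_on_open: "open U \<Longrightarrow> LC_on U LC"
  using levi_civita LC_on_iff by blast

lemma smooth_fun_on_outside: "open U \<Longrightarrow> smooth_fun_on A U (\<lambda>y. if y \<in> U then 0 else 1)"
proof -
  assume U: "open U"
  have "smooth_near A x (\<lambda>y. if y \<in> U then 0 else 1)" if "x \<in> U" for x
    by (rule smooth_near_cong[OF smooth_near_const[of x 0] U that]) simp
  then show ?thesis by (simp add: smooth_fun_on_iff[OF U])
qed

text \<open>Function linearity with the indicator function of the complement of \<open>U\<close>, which is smooth
  on \<open>U\<close>, shows that the connection on \<open>U\<close> does not see the values outside \<open>U\<close>.\<close>

lemma LC_cong_left:
  assumes U: "open U" "x \<in> U" and V: "vector_field_on A U V" and W: "vector_field_on A U W"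
    and eq: "\<And>y. y \<in> U \<Longrightarrow> V y = V' y"
  shows "LC V W x = LC V' W x"
proof -
  note D = LC_on_open[OF U(1)]
  have V': "vector_field_on A U V'" by (rule vf_cong[OF U(1) V eq])
  let ?f = "\<lambda>y. if y \<in> U then 0 else 1 :: real"
  define Z where "Z = (\<lambda>y h. 1 * V' y h + (-1) * V y h)"
  have Z: "vector_field_on A U Z"
    unfolding Z_def by (rule vf_lincomb[OF U(1) V' V]) (rule smooth_near_const)+
  have "(\<lambda>y h. ?f y * Z y h) = Z" using eq by (auto simp: Z_def fun_eq_iff)
  then have "LC Z W x = (\<lambda>h. 0)"
    using LC_scale_left[OF D U(2) Z W smooth_fun_on_outside[OF U(1)]] U(2) by simp
  moreover have "(\<lambda>y h. V y h + Z y h) = V'" by (simp add: Z_def)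
  ultimately show ?thesis using LC_add_left[OF D U(2) V Z W] by simp
qed

text \<open>Compared with the left argument, the Leibniz rule adds the term
  \<open>V x f * Z x h\<close>, which vanishes because \<open>Z\<close> is zero at
  \<open>x\<close>.\<close>

lemma LC_cong_right:
  assumes U: "open U" "x \<in> U" and V: "vector_field_on A U V" and W: "vector_field_on A U W"
    and eq: "\<And>y. y \<in> U \<Longrightarrow> W y = W' y"
  shows "LC V W x = LC V W' x"
proof -
  note D = LC_on_open[OF U(1)]
  have W': "vector_field_on A U W'" by (rule vf_cong[OF U(1) W eq])
  let ?f = "\<lambda>y. if y \<in> U then 0 else 1 :: real"
  define Z where "Z = (\<lambda>y h. 1 * W' y h + (-1) * W y h)"
  have Z: "vector_field_on A U Z"
    unfolding Z_def by (rule vf_lincomb[OF U(1) W' W]) (rule smooth_near_const)+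
  have "(\<lambda>y h. ?f y * Z y h) = Z" using eq by (auto simp: Z_def fun_eq_iff)
  moreover have "Z x h = 0" for h using eq[OF U(2)] by (simp add: Z_def)
  ultimately have "LC V Z x = (\<lambda>h. 0)"
    using LC_leibniz[OF D U(2) V Z smooth_fun_on_outside[OF U(1)]] U(2) by simp
  moreover have "(\<lambda>y h. W y h + Z y h) = W'" by (simp add: Z_def)
  ultimately show ?thesis using LC_add_right[OF D U(2) W Z V] by simp
qed

lemma Hess_cong:
  assumes U: "open U" "x \<in> U" and V: "vector_field_on A U V" and W: "vector_field_on A U W"
    and eq: "\<And>y. y \<in> U \<Longrightarrow> V y = V' y" "\<And>y. y \<in> U \<Longrightarrow> W y = W' y"
  shows "Hess A g u x V W = Hess A g u x V' W'"
proof -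
  have "LC V W x = LC V' W' x"
    using LC_cong_left[OF U V W eq(1)] LC_cong_right[OF U vf_cong[OF U(1) V eq(1)] W eq(2)] by simp
  moreover have "V x (\<lambda>y. W y u) = V' x (\<lambda>y. W' y u)"
    using tangent_cong[OF vf_tangent[OF V U(2)] U(1) U(2), of "\<lambda>y. W y u" "\<lambda>y. W' y u"] eq U(2) by simp
  ultimately show ?thesis by (simp add: Hess_def)
qed

context
  fixes U :: "'m set" and x assumes U: "open U" "x \<in> U"
begin

lemma LC_zero_left: "vector_field_on A U W \<Longrightarrow> LC (\<lambda>y h. 0) W x = (\<lambda>h. 0)"
  using LC_scale_left[OF LC_on_open[OF U(1)] U(2), of W W "\<lambda>y. 0"] smooth_fun_on_const[of U 0]
  by simp

lemma LC_zero_right: "vector_field_on A U V \<Longrightarrow> LC V (\<lambda>y h. 0) x = (\<lambda>h. 0)"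
  using LC_leibniz[OF LC_on_open[OF U(1)] U(2), of V V "\<lambda>y. 0"] smooth_fun_on_const[of U 0]
    tangent_const[OF vf_tangent[OF _ U(2)], of V 0]
  by simp

lemma Hess_sum_left:
  assumes F: "\<And>i. i \<in> I \<Longrightarrow> vector_field_on A U (F i)" and W: "vector_field_on A U W"
    and a: "\<And>i y. i \<in> I \<Longrightarrow> y \<in> U \<Longrightarrow> smooth_near A y (a i)"
  shows "Hess A g u x (\<lambda>y h. \<Sum>i\<in>I. a i y * F i y h) W = (\<Sum>i\<in>I. a i x * Hess A g u x (F i) W)"
proof -
  note D = LC_on_open[OF U(1)]
  have "LC (\<lambda>y h. \<Sum>i\<in>I. a i y * F i y h) W x = (\<lambda>h. \<Sum>i\<in>I. a i x * LC (F i) W x h)"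
    using F a
  proof (induction I rule: infinite_finite_induct)
    case (insert j I)
    have Fj: "vector_field_on A U (F j)" and aj: "smooth_fun_on A U (a j)"
      using insert.prems by (auto simp: smooth_fun_on_iff[OF U(1)])
    have aF: "vector_field_on A U (\<lambda>y h. a j y * F j y h)"
      by (rule vf_scale[OF U(1) Fj]) (use insert.prems in auto)
    have S: "vector_field_on A U (\<lambda>y h. \<Sum>i\<in>I. a i y * F i y h)"
      by (rule vf_sum[OF U(1)]) (use insert.prems in auto)
    have IH: "LC (\<lambda>y h. \<Sum>i\<in>I. a i y * F i y h) W x = (\<lambda>h. \<Sum>i\<in>I. a i x * LC (F i) W x h)"
      by (rule insert.IH) (use insert.prems in auto)
    show ?case
      using insert.hyps LC_add_left[OF D U(2) aF S W] LC_scale_left[OF D U(2) Fj W aj] IH by simp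
  qed (simp_all add: LC_zero_left[OF W])
  then show ?thesis by (simp add: Hess_def right_diff_distrib sum_subtractf)
qed

text \<open>The derivatives \<open>V x (a i)\<close> of the coefficients occur both in the iterated
  derivative and in the connection term, and cancel in the difference.\<close>

lemma Hess_sum_right:
  assumes F: "\<And>i. i \<in> I \<Longrightarrow> vector_field_on A U (F i)" and V: "vector_field_on A U V"
    and a: "\<And>i y. i \<in> I \<Longrightarrow> y \<in> U \<Longrightarrow> smooth_near A y (a i)" and u: "smooth_near A x u"
  shows "Hess A g u x V (\<lambda>y h. \<Sum>i\<in>I. a i y * F i y h) = (\<Sum>i\<in>I. a i x * Hess A g u x V (F i))"
proof -
  note D = LC_on_open[OF U(1)] and t = vf_tangent[OF V U(2)]
  have "LC V (\<lambda>y h. \<Sum>i\<in>I. a i y * F i y h) x = (\<lambda>h. \<Sum>i\<in>I. a i x * LC V (F i) x h + V x (a i) * F i x h)"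
    using F a
  proof (induction I rule: infinite_finite_induct)
    case (insert j I)
    have Fj: "vector_field_on A U (F j)" and aj: "smooth_fun_on A U (a j)"
      using insert.prems by (auto simp: smooth_fun_on_iff[OF U(1)])
    have aF: "vector_field_on A U (\<lambda>y h. a j y * F j y h)"
      by (rule vf_scale[OF U(1) Fj]) (use insert.prems in auto)
    have S: "vector_field_on A U (\<lambda>y h. \<Sum>i\<in>I. a i y * F i y h)"
      by (rule vf_sum[OF U(1)]) (use insert.prems in auto)
    have IH: "LC V (\<lambda>y h. \<Sum>i\<in>I. a i y * F i y h) x = (\<lambda>h. \<Sum>i\<in>I. a i x * LC V (F i) x h + V x (a i) * F i x h)"
      by (rule insert.IH) (use insert.prems in auto)
    show ?case
      using insert.hyps LC_add_right[OF D U(2) aF S V] LC_leibniz[OF D U(2) V Fj aj] IH by simp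
  qed (simp_all add: LC_zero_right[OF V])
  moreover have "V x (\<lambda>y. \<Sum>i\<in>I. a i y * F i y u) = (\<Sum>i\<in>I. a i x * V x (\<lambda>y. F i y u) + F i x u * V x (a i))"
  proof -
    have s: "smooth_near A x (a i)" "smooth_near A x (\<lambda>y. F i y u)" if "i \<in> I" for i
      using a[OF that U(2)] vf_smooth[OF F[OF that] U u] by blast+
    have "V x (\<lambda>y. \<Sum>i\<in>I. a i y * F i y u) = (\<Sum>i\<in>I. V x (\<lambda>y. a i y * F i y u))"
      by (rule tangent_sum[OF t]) (intro smooth_near_mult s)
    also have "\<dots> = (\<Sum>i\<in>I. a i x * V x (\<lambda>y. F i y u) + F i x u * V x (a i))"
      by (intro sum.cong refl tangent_mult[OF t] s)
    finally show ?thesis .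
  qed
  ultimately show ?thesis
    by (simp add: Hess_def right_diff_distrib sum_subtractf sum.distrib mult.commute)
qed

context
  fixes V W assumes V: "vector_field_on A U V" and W: "vector_field_on A U W"
begin

lemma Hess_sym: "smooth_near A x u \<Longrightarrow> Hess A g u x V W = Hess A g u x W V"
  using LC_torsion[OF LC_on_open[OF U(1)] U(2) V W, of u] by (simp add: Hess_def)

lemma nested_lincomb:
  assumes u: "smooth_near A x u" and v: "smooth_near A x v"
  shows "V x (\<lambda>y. W y (\<lambda>z. a * u z + b * v z)) = a * V x (\<lambda>y. W y u) + b * V x (\<lambda>y. W y v)"
proof -
  obtain N where N: "open N" "x \<in> N" "\<And>y. y \<in> N \<Longrightarrow> smooth_near A y u" using smooth_near_nhd[OF u] by metis
  obtain N' where N': "open N'" "x \<in> N'" "\<And>y. y \<in> N' \<Longrightarrow> smooth_near A y v" using smooth_near_nhd[OF v] by metis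
  have M: "open (N \<inter> N' \<inter> U)" "x \<in> N \<inter> N' \<inter> U" using N N' U by auto
  have "V x (\<lambda>y. W y (\<lambda>z. a * u z + b * v z)) = V x (\<lambda>y. a * W y u + b * W y v)"
    by (rule tangent_cong[OF vf_tangent[OF V U(2)] M])
       (use N N' in \<open>auto intro!: tangent_lincomb vf_tangent[OF W]\<close>)
  then show ?thesis
    using tangent_lincomb[OF vf_tangent[OF V U(2)] vf_smooth[OF W U u] vf_smooth[OF W U v]] by simp
qed

lemma Hess_lincomb:
  assumes u: "smooth_near A x u" and v: "smooth_near A x v"
  shows "Hess A g (\<lambda>z. a * u z + b * v z) x V W = a * Hess A g u x V W + b * Hess A g v x V W"
  using nested_lincomb[OF u v] tangent_lincomb[OF vf_tangent[OF LC_vf[OF LC_on_open[OF U(1)] V W] U(2)] u v]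
  by (simp add: Hess_def algebra_simps)

lemma Hess_const: "Hess A g (\<lambda>z. c) x V W = 0"
proof -
  have "V x (\<lambda>y. W y (\<lambda>z. c)) = V x (\<lambda>y. 0)"
    by (rule tangent_cong[OF vf_tangent[OF V U(2)] U]) (rule tangent_const[OF vf_tangent[OF W]])
  then show ?thesis
    using tangent_const[OF vf_tangent[OF V U(2)]] tangent_const[OF vf_tangent[OF LC_vf[OF LC_on_open[OF U(1)] V W] U(2)]]
    by (simp add: Hess_def)
qed

lemma Hess_sum:
  assumes "\<And>i. i \<in> I \<Longrightarrow> smooth_near A x (f i)"
  shows "Hess A g (\<lambda>z. \<Sum>i\<in>I. c i * f i z) x V W = (\<Sum>i\<in>I. c i * Hess A g (f i) x V W)"
  using assms
proof (induction I rule: infinite_finite_induct)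
  case (insert j I)
  then have s: "smooth_near A x (f j)" "smooth_near A x (\<lambda>z. \<Sum>i\<in>I. c i * f i z)"
    by (auto intro!: smooth_near_sum smooth_near_scale)
  show ?case using insert Hess_lincomb[OF s, of "c j" 1] by simp
qed (simp_all add: Hess_const)

text \<open>At a common zero every term with an undifferentiated factor drops out, the connection
  term included. In \<open>realize_jet\<close> such products adjust the Hessian without touching
  value and gradient.\<close>

lemma Hess_mult_vanishing:
  assumes f: "smooth_near A x f" "f x = 0" and h: "smooth_near A x h" "h x = 0"
  shows "Hess A g (\<lambda>z. f z * h z) x V W = V x f * W x h + V x h * W x f"
proof -
  obtain N where N: "open N" "x \<in> N" "\<And>y. y \<in> N \<Longrightarrow> smooth_near A y f" using smooth_near_nhd[OF f(1)] by metis
  obtain N' where N': "open N'" "x \<in> N'" "\<And>y. y \<in> N' \<Longrightarrow> smooth_near A y h" using smooth_near_nhd[OF h(1)] by metis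
  have M: "open (N \<inter> N' \<inter> U)" "x \<in> N \<inter> N' \<inter> U" using N N' U by auto
  note t = vf_tangent[OF V U(2)] and s = vf_smooth[OF W U f(1)] vf_smooth[OF W U h(1)]
  have "V x (\<lambda>y. W y (\<lambda>z. f z * h z)) = V x (\<lambda>y. f y * W y h + h y * W y f)"
    by (rule tangent_cong[OF t M]) (use N N' in \<open>auto intro!: tangent_mult vf_tangent[OF W]\<close>)
  also have "\<dots> = W x h * V x f + W x f * V x h"
    using tangent_add[OF t smooth_near_mult[OF f(1) s(2)] smooth_near_mult[OF h(1) s(1)]]
      tangent_mult[OF t f(1) s(2)] tangent_mult[OF t h(1) s(1)] f(2) h(2) by simp
  finally show ?thesis
    using tangent_zero_product[OF vf_tangent[OF LC_vf[OF LC_on_open[OF U(1)] V W] U(2)] f(1) h(1) f(2) h(2)]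
    by (simp add: Hess_def mult.commute)
qed

end

end

end

section \<open>Jets in orthonormal frames\<close>

context riemannian
begin

definition gradm :: "('k \<Rightarrow> 'm field) \<Rightarrow> ('m \<Rightarrow> real) \<Rightarrow> 'm \<Rightarrow> real ^ 'k" where
  "gradm E u x = (\<chi> a. E a x u)"

definition hessm :: "('k \<Rightarrow> 'm field) \<Rightarrow> ('m \<Rightarrow> real) \<Rightarrow> 'm \<Rightarrow> real ^ 'k ^ 'k" where
  "hessm E u x = (\<chi> a b. Hess A g u x (E a) (E b))"

text \<open>With coordinate fields in place of partial derivatives, the frame calculus applies to
  jets. The inner field is cut off at each point separately, so the two expressions are compared on
  a neighbourhood where \<open>u\<close> is smooth.\<close>

lemma jet_coords_eq:
  assumes U: "(U, \<phi>) \<in> A" "x \<in> U" and u: "smooth_near A x u"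
  shows "jet_coords (U, \<phi>) x u =
    (u x, (\<chi> i. cvec U \<phi> i x u), (\<chi> i j. cvec U \<phi> i x (\<lambda>y. cvec U \<phi> j y u)))"
proof -
  have "pd i (pd j (u \<circ> inv_into U \<phi>)) (\<phi> x) = cvec U \<phi> i x (\<lambda>y. cvec U \<phi> j y u)" for i j
  proof -
    obtain W where W: "open W" "x \<in> W" "W \<subseteq> U" "smooth_fun_on A W u"
      using smooth_nearE[OF u chart_open(1)[OF U(1)] U(2)] .
    have s: "smooth_on (\<phi> ` W) (pd j (u \<circ> inv_into U \<phi>))"
      using smooth_fun_chart[OF U(1) W(1,3)] W(4) by (simp add: smooth_on_pd)
    have "pd i ((\<lambda>y. cvec U \<phi> j y u) \<circ> inv_into U \<phi>) (\<phi> x) = pd i (pd j (u \<circ> inv_into U \<phi>)) (\<phi> x)"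
    proof (rule pd_cong[OF chart_open_image[OF U(1) W(1,3)] _ _ s])
      show "\<phi> x \<in> \<phi> ` W" using W by blast
      fix a assume "a \<in> \<phi> ` W"
      then obtain y where y: "y \<in> W" "a = \<phi> y" by blast
      have "smooth_near A y u" using W y smooth_fun_on_iff[OF W(1)] by blast
      then show "pd j (u \<circ> inv_into U \<phi>) a = ((\<lambda>y. cvec U \<phi> j y u) \<circ> inv_into U \<phi>) a"
        using y W(3) chart_inverse[OF U(1), of y] by (auto simp: cvec_def)
    qed
    moreover have "smooth_near A x (\<lambda>y. cvec U \<phi> j y u)"
      by (rule vf_smooth[OF vf_cvec[OF U(1)] chart_open(1)[OF U(1)] U(2) u])
    ultimately show ?thesis by (simp add: cvec_def)
  qed
  then show ?thesis using u by (simp add: jet_coords_def Let_def cvec_def)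
qed

text \<open>The passage from frame data \<open>(u, E\<^sub>a u, Hess u(E\<^sub>a, E\<^sub>b))\<close> to the coordinates of a 2-jet and back,
  both with coefficients that depend continuously on the base point.\<close>

definition christoffel :: "('k \<Rightarrow> 'm field) \<Rightarrow> 'k \<Rightarrow> 'k \<Rightarrow> 'k \<Rightarrow> 'm \<Rightarrow> real" where
  "christoffel E a b c y = fcoeff E (LC (E a) (E b)) c y"

definition frame_to_coords :: "'m set \<Rightarrow> ('m \<Rightarrow> real ^ 'k) \<Rightarrow> ('k \<Rightarrow> 'm field) \<Rightarrow>
    'm \<times> real \<times> (real ^ 'k) \<times> (real ^ 'k ^ 'k) \<Rightarrow> real \<times> (real ^ 'k) \<times> (real ^ 'k ^ 'k)" where
  "frame_to_coords U \<phi> E = (\<lambda>(y, r, \<xi>, H). (r,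
     (\<chi> i. \<Sum>a\<in>UNIV. fcoeff E (cvec U \<phi> i) a y * \<xi> $ a),
     (\<chi> i j. (\<Sum>k\<in>UNIV. cvec U \<phi> i y (fcoeff E (cvec U \<phi> j) k) * \<xi> $ k) +
       (\<Sum>a\<in>UNIV. \<Sum>b\<in>UNIV. fcoeff E (cvec U \<phi> i) a y * fcoeff E (cvec U \<phi> j) b y *
          (H $ a $ b + (\<Sum>c\<in>UNIV. christoffel E a b c y * \<xi> $ c)))))) "

definition coords_to_frame :: "'m set \<Rightarrow> ('m \<Rightarrow> real ^ 'k) \<Rightarrow> ('k \<Rightarrow> 'm field) \<Rightarrow>
    'm \<times> real \<times> (real ^ 'k) \<times> (real ^ 'k ^ 'k) \<Rightarrow> real \<times> (real ^ 'k) \<times> (real ^ 'k ^ 'k)" where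
  "coords_to_frame U \<phi> E = (\<lambda>(y, r, b, m). (r,
     (\<chi> a. \<Sum>i\<in>UNIV. E a y (\<lambda>z. \<phi> z $ i) * b $ i),
     (\<chi> a c. (\<Sum>j\<in>UNIV. E a y (\<lambda>z. E c z (\<lambda>z. \<phi> z $ j)) * b $ j) +
       (\<Sum>i\<in>UNIV. \<Sum>j\<in>UNIV. E a y (\<lambda>z. \<phi> z $ i) * E c y (\<lambda>z. \<phi> z $ j) * m $ i $ j) -
       (\<Sum>d\<in>UNIV. christoffel E a c d y * (\<Sum>i\<in>UNIV. E d y (\<lambda>z. \<phi> z $ i) * b $ i)))))"

context
  fixes N E assumes N: "open N" and E: "orthonormal_frame_on A g N E"
begin

lemma christoffel_smooth: "x \<in> N \<Longrightarrow> smooth_near A x (christoffel E a b c)"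
  unfolding christoffel_def[abs_def]
  by (rule fcoeff_smooth[OF N E LC_vf[OF LC_on_open[OF N] frame_vf[OF N E] frame_vf[OF N E]]])

lemma hessm_nested:
  assumes "x \<in> N"
  shows "E a x (\<lambda>y. E b y u) = hessm E u x $ a $ b + (\<Sum>c\<in>UNIV. christoffel E a b c x * gradm E u x $ c)"
  using vf_expand[OF N E LC_vf[OF LC_on_open[OF N] frame_vf[OF N E, of a] frame_vf[OF N E, of b]] assms, of u]
  by (simp add: hessm_def Hess_def gradm_def christoffel_def)

context
  fixes U \<phi> assumes U: "(U, \<phi>) \<in> A"
begin

lemma frame_to_coords:
  assumes x: "x \<in> U" "x \<in> N" and u: "smooth_near A x u"
  shows "jet_coords (U, \<phi>) x u = frame_to_coords U \<phi> E (x, u x, gradm E u x, hessm E u x)"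
proof -
  let ?O = "U \<inter> N"
  have O: "open ?O" "x \<in> ?O" using N chart_open(1)[OF U] x by auto
  have fr: "orthonormal_frame_on A g ?O E" by (rule frame_subset[OF E]) auto
  have d: "vector_field_on A ?O (cvec U \<phi> i)" for i by (rule vf_subset[OF vf_cvec[OF U]]) auto
  have 1: "cvec U \<phi> i x u = (\<Sum>a\<in>UNIV. fcoeff E (cvec U \<phi> i) a x * gradm E u x $ a)" for i
    using vf_expand[OF O(1) fr d O(2), of i u] by (simp add: gradm_def)
  have 2: "cvec U \<phi> i x (\<lambda>y. cvec U \<phi> j y u) = (\<Sum>k\<in>UNIV. cvec U \<phi> i x (fcoeff E (cvec U \<phi> j) k) * gradm E u x $ k) +
       (\<Sum>a\<in>UNIV. \<Sum>b\<in>UNIV. fcoeff E (cvec U \<phi> i) a x * fcoeff E (cvec U \<phi> j) b x *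
          (hessm E u x $ a $ b + (\<Sum>c\<in>UNIV. christoffel E a b c x * gradm E u x $ c)))" for i j
    unfolding hessm_nested[OF x(2), symmetric] frame_conn_nested[OF O(1) fr d d O(2) u] by (simp add: gradm_def)
  show ?thesis
    unfolding jet_coords_eq[OF U x(1) u] by (simp add: frame_to_coords_def 1 2)
qed

lemma coords_to_frame:
  assumes x: "x \<in> U" "x \<in> N" and u: "smooth_near A x u"
  shows "(u x, gradm E u x, hessm E u x) =
    coords_to_frame U \<phi> E (x, jet_coords (U, \<phi>) x u)"
proof -
  let ?O = "U \<inter> N" and ?d = "cvec U \<phi>"
  have O: "open ?O" "x \<in> ?O" using N chart_open(1)[OF U] x by auto
  have ex: "E a y u = (\<Sum>i\<in>UNIV. E a y (\<lambda>z. \<phi> z $ i) * ?d i y u)" if "y \<in> ?O" for a y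
    using that by (intro tangent_expand[OF U] vf_tangent[OF frame_vf[OF N E]]) auto
  have 1: "gradm E u x $ a = (\<Sum>i\<in>UNIV. E a x (\<lambda>z. \<phi> z $ i) * ?d i x u)" for a
    using ex[OF O(2)] by (simp add: gradm_def)
  have 2: "E a x (\<lambda>y. E b y u) = (\<Sum>j\<in>UNIV. E a x (\<lambda>z. E b z (\<lambda>z. \<phi> z $ j)) * ?d j x u) +
       (\<Sum>i\<in>UNIV. \<Sum>j\<in>UNIV. E a x (\<lambda>z. \<phi> z $ i) * E b x (\<lambda>z. \<phi> z $ j) * ?d i x (\<lambda>y. ?d j y u))" for a b
  proof -
    note t = frame_tangent[OF N E x(2), of a]
    have s1: "smooth_near A x (\<lambda>z. E b z (\<lambda>z. \<phi> z $ j))" for j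
      by (rule vf_smooth[OF frame_vf[OF N E] N x(2) smooth_near_coord[OF U x(1)]])
    have s2: "smooth_near A x (\<lambda>y. ?d j y u)" for j
      by (rule vf_smooth[OF vf_cvec[OF U] chart_open(1)[OF U] x(1) u])
    have "E a x (\<lambda>y. E b y u) = E a x (\<lambda>y. \<Sum>j\<in>UNIV. E b y (\<lambda>z. \<phi> z $ j) * ?d j y u)"
      by (rule tangent_cong[OF t O]) (rule ex)
    also have "\<dots> = (\<Sum>j\<in>UNIV. E a x (\<lambda>y. E b y (\<lambda>z. \<phi> z $ j) * ?d j y u))"
      by (rule tangent_sum[OF t]) (intro smooth_near_mult s1 s2)
    also have "\<dots> = (\<Sum>j\<in>UNIV. E b x (\<lambda>z. \<phi> z $ j) * E a x (\<lambda>y. ?d j y u) + ?d j x u * E a x (\<lambda>z. E b z (\<lambda>z. \<phi> z $ j)))"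
      by (intro sum.cong refl tangent_mult[OF t s1 s2])
    also have "\<dots> = (\<Sum>j\<in>UNIV. E b x (\<lambda>z. \<phi> z $ j) * (\<Sum>i\<in>UNIV. E a x (\<lambda>z. \<phi> z $ i) * ?d i x (\<lambda>y. ?d j y u)) + ?d j x u * E a x (\<lambda>z. E b z (\<lambda>z. \<phi> z $ j)))"
      by (intro sum.cong refl arg_cong2[where f="(+)"] arg_cong2[where f="(*)"] tangent_expand[OF U x(1) t])
    also have "\<dots> = (\<Sum>j\<in>UNIV. E a x (\<lambda>z. E b z (\<lambda>z. \<phi> z $ j)) * ?d j x u) +
       (\<Sum>j\<in>UNIV. \<Sum>i\<in>UNIV. E a x (\<lambda>z. \<phi> z $ i) * E b x (\<lambda>z. \<phi> z $ j) * ?d i x (\<lambda>y. ?d j y u))"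
      by (simp add: sum.distrib sum_distrib_left mult_ac)
    also have "(\<Sum>j\<in>UNIV. \<Sum>i\<in>UNIV. E a x (\<lambda>z. \<phi> z $ i) * E b x (\<lambda>z. \<phi> z $ j) * ?d i x (\<lambda>y. ?d j y u)) =
       (\<Sum>i\<in>UNIV. \<Sum>j\<in>UNIV. E a x (\<lambda>z. \<phi> z $ i) * E b x (\<lambda>z. \<phi> z $ j) * ?d i x (\<lambda>y. ?d j y u))"
      by (rule sum.swap)
    finally show ?thesis .
  qed
  have 3: "hessm E u x $ a $ b = E a x (\<lambda>y. E b y u) - (\<Sum>c\<in>UNIV. christoffel E a b c x * gradm E u x $ c)" for a b
    by (simp add: hessm_nested[OF x(2)])
  have "gradm E u x = (\<chi> a. \<Sum>i\<in>UNIV. E a x (\<lambda>z. \<phi> z $ i) * ?d i x u)" by (simp add: vec_eq_iff 1)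
  moreover have "hessm E u x = (\<chi> a c. (\<Sum>j\<in>UNIV. E a x (\<lambda>z. E c z (\<lambda>z. \<phi> z $ j)) * ?d j x u) +
       (\<Sum>i\<in>UNIV. \<Sum>j\<in>UNIV. E a x (\<lambda>z. \<phi> z $ i) * E c x (\<lambda>z. \<phi> z $ j) * ?d i x (\<lambda>y. ?d j y u)) -
       (\<Sum>d\<in>UNIV. christoffel E a c d x * (\<Sum>i\<in>UNIV. E d x (\<lambda>z. \<phi> z $ i) * ?d i x u)))"
    unfolding vec_eq_iff 3 2 1 by simp
  ultimately show ?thesis
    unfolding jet_coords_eq[OF U x(1) u] by (simp add: coords_to_frame_def)
qed

lemma continuous_on_smooth_fst:
  assumes "\<And>x. x \<in> S \<Longrightarrow> smooth_near A x f"
  shows "continuous_on (S \<times> T) (\<lambda>p. f (fst p))"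
proof (rule continuous_on_compose2[where f=fst and t=S])
  show "continuous_on S f" by (rule continuous_at_imp_continuous_on) (use assms smooth_near_isCont in blast)
qed (auto intro: continuous_intros)

lemma continuous_frame_to_coords: "continuous_on ((U \<inter> N) \<times> UNIV) (frame_to_coords U \<phi> E)"
proof -
  let ?O = "U \<inter> N"
  have O: "open ?O" using N chart_open(1)[OF U] by auto
  have fr: "orthonormal_frame_on A g ?O E" by (rule frame_subset[OF E]) auto
  have d: "vector_field_on A ?O (cvec U \<phi> i)" for i by (rule vf_subset[OF vf_cvec[OF U]]) auto
  have c: "smooth_near A x (fcoeff E (cvec U \<phi> i) a)" if "x \<in> ?O" for x i a by (rule fcoeff_smooth[OF O fr d that])
  have "frame_to_coords U \<phi> E = (\<lambda>p. (fst (snd p),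
     (\<chi> i. \<Sum>a\<in>UNIV. fcoeff E (cvec U \<phi> i) a (fst p) * fst (snd (snd p)) $ a),
     (\<chi> i j. (\<Sum>k\<in>UNIV. cvec U \<phi> i (fst p) (fcoeff E (cvec U \<phi> j) k) * fst (snd (snd p)) $ k) +
       (\<Sum>a\<in>UNIV. \<Sum>b\<in>UNIV. fcoeff E (cvec U \<phi> i) a (fst p) * fcoeff E (cvec U \<phi> j) b (fst p) *
          (snd (snd (snd p)) $ a $ b + (\<Sum>c\<in>UNIV. christoffel E a b c (fst p) * fst (snd (snd p)) $ c))))))"
    by (auto simp: frame_to_coords_def fun_eq_iff)
  moreover have "continuous_on (?O \<times> UNIV) (\<lambda>p. cvec U \<phi> i (fst p) (fcoeff E (cvec U \<phi> j) k))" for i j k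
    by (rule continuous_on_smooth_fst[where f="\<lambda>y. cvec U \<phi> i y (fcoeff E (cvec U \<phi> j) k)"]) (rule vf_smooth[OF d O _ c])
  moreover have "continuous_on (?O \<times> UNIV) (\<lambda>p. fcoeff E (cvec U \<phi> i) a (fst p))" for i a
    by (rule continuous_on_smooth_fst) (rule c)
  moreover have "continuous_on (?O \<times> UNIV) (\<lambda>p. christoffel E a b e (fst p))" for a b e
    by (rule continuous_on_smooth_fst) (simp add: christoffel_smooth)
  ultimately show ?thesis
    by (simp only:) (intro continuous_intros continuous_on_vec_lambda)
qed

lemma continuous_coords_to_frame: "continuous_on ((U \<inter> N) \<times> UNIV) (coords_to_frame U \<phi> E)"
proof -
  let ?O = "U \<inter> N"
  have c: "smooth_near A x (\<lambda>z. E a z (\<lambda>z. \<phi> z $ i))" if "x \<in> ?O" for x i a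
    using that by (intro vf_smooth[OF frame_vf[OF N E] N] smooth_near_coord[OF U]) auto
  have c2: "smooth_near A x (\<lambda>z. E a z (\<lambda>z. E b z (\<lambda>z. \<phi> z $ i)))" if "x \<in> ?O" for x i a b
    using that by (intro vf_smooth[OF frame_vf[OF N E] N] c) auto
  have "coords_to_frame U \<phi> E = (\<lambda>p. (fst (snd p),
     (\<chi> a. \<Sum>i\<in>UNIV. E a (fst p) (\<lambda>z. \<phi> z $ i) * fst (snd (snd p)) $ i),
     (\<chi> a c. (\<Sum>j\<in>UNIV. E a (fst p) (\<lambda>z. E c z (\<lambda>z. \<phi> z $ j)) * fst (snd (snd p)) $ j) +
       (\<Sum>i\<in>UNIV. \<Sum>j\<in>UNIV. E a (fst p) (\<lambda>z. \<phi> z $ i) * E c (fst p) (\<lambda>z. \<phi> z $ j) * snd (snd (snd p)) $ i $ j) -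
       (\<Sum>d\<in>UNIV. christoffel E a c d (fst p) * (\<Sum>i\<in>UNIV. E d (fst p) (\<lambda>z. \<phi> z $ i) * fst (snd (snd p)) $ i)))))"
    by (auto simp: coords_to_frame_def fun_eq_iff)
  moreover have "continuous_on (?O \<times> UNIV) (\<lambda>p. E a (fst p) (\<lambda>z. \<phi> z $ i))" for i a
    by (rule continuous_on_smooth_fst[where f="\<lambda>z. E a z (\<lambda>z. \<phi> z $ i)"]) (rule c)
  moreover have "continuous_on (?O \<times> UNIV) (\<lambda>p. E a (fst p) (\<lambda>z. E b z (\<lambda>z. \<phi> z $ i)))" for i a b
    by (rule continuous_on_smooth_fst[where f="\<lambda>z. E a z (\<lambda>z. E b z (\<lambda>z. \<phi> z $ i))"]) (rule c2)
  moreover have "continuous_on (?O \<times> UNIV) (\<lambda>p. christoffel E a b e (fst p))" for a b e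
    by (rule continuous_on_smooth_fst) (simp add: christoffel_smooth)
  ultimately show ?thesis
    by (simp only:) (intro continuous_intros continuous_on_vec_lambda)
qed

end

section \<open>Jets determined by frame data, and realized from them\<close>

lemma gradm_lincomb:
  assumes "x \<in> N" "smooth_near A x u" "smooth_near A x v"
  shows "gradm E (\<lambda>z. a * u z + b * v z) x = a *\<^sub>R gradm E u x + b *\<^sub>R gradm E v x"
  by (simp add: gradm_def vec_eq_iff tangent_lincomb[OF frame_tangent[OF N E assms(1)] assms(2,3)])

lemma hessm_lincomb:
  assumes "x \<in> N" "smooth_near A x u" "smooth_near A x v"
  shows "hessm E (\<lambda>z. a * u z + b * v z) x = a *\<^sub>R hessm E u x + b *\<^sub>R hessm E v x"
  by (simp add: hessm_def vec_eq_iff Hess_lincomb[OF N assms(1) frame_vf[OF N E] frame_vf[OF N E] assms(2,3)])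

lemma hessm_Sym: "x \<in> N \<Longrightarrow> smooth_near A x u \<Longrightarrow> hessm E u x \<in> Sym"
  using Hess_sym[OF N _ frame_vf[OF N E] frame_vf[OF N E]] by (simp add: mem_Sym hessm_def)

text \<open>At a fixed base point \<open>frame_to_coords\<close> and \<open>coords_to_frame\<close>
  are linear in the remaining data, so each takes zero to zero.\<close>

lemma vanishes_iff:
  assumes x: "x \<in> N" and w: "smooth_near A x w"
  shows "vanishes_to_order_3 A x w \<longleftrightarrow> w x = 0 \<and> gradm E w x = 0 \<and> hessm E w x = 0"
proof
  assume v: "vanishes_to_order_3 A x w"
  obtain U \<phi> where U: "(U, \<phi>) \<in> A" "x \<in> U" by (rule chart_cover)
  have "jet_coords (U, \<phi>) x w = 0" using v U by (auto simp: vanishes_to_order_3_def)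
  then have "(w x, gradm E w x, hessm E w x) = coords_to_frame U \<phi> E (x, 0, 0, 0)"
    using coords_to_frame[OF U x w] by (simp add: zero_prod_def)
  also have "\<dots> = (0, 0, 0)" by (simp add: coords_to_frame_def vec_eq_iff)
  finally show "w x = 0 \<and> gradm E w x = 0 \<and> hessm E w x = 0" by simp
next
  assume z: "w x = 0 \<and> gradm E w x = 0 \<and> hessm E w x = 0"
  have "jet_coords (U, \<phi>) x w = 0" if U: "(U, \<phi>) \<in> A" "x \<in> U" for U \<phi>
    using frame_to_coords[OF U x w] z by (simp add: frame_to_coords_def zero_prod_def vec_eq_iff)
  then show "vanishes_to_order_3 A x w" by (auto simp: vanishes_to_order_3_def)
qed

lemma vanishes_diff_iff:
  assumes x: "x \<in> N" and u: "smooth_near A x u" and v: "smooth_near A x v"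
  shows "vanishes_to_order_3 A x (\<lambda>y. v y - u y) \<longleftrightarrow> v x = u x \<and> gradm E v x = gradm E u x \<and> hessm E v x = hessm E u x"
  using vanishes_iff[OF x smooth_near_minus[OF v u]] gradm_lincomb[OF x v u, of 1 "-1"] hessm_lincomb[OF x v u, of 1 "-1"]
  by simp

lemma jet2_eq_iff:
  assumes x: "x \<in> N" and u: "smooth_near A x u" and v: "smooth_near A x v"
  shows "jet2 A x u = jet2 A x v \<longleftrightarrow> u x = v x \<and> gradm E u x = gradm E v x \<and> hessm E u x = hessm E v x"
proof
  assume "jet2 A x u = jet2 A x v"
  moreover have "u \<in> snd (jet2 A x u)" using u vanishes_diff_iff[OF x u u] by (simp add: jet2_def)
  ultimately have "u \<in> snd (jet2 A x v)" by simp
  then show "u x = v x \<and> gradm E u x = gradm E v x \<and> hessm E u x = hessm E v x"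
    using vanishes_diff_iff[OF x v u] by (simp add: jet2_def)
next
  assume "u x = v x \<and> gradm E u x = gradm E v x \<and> hessm E u x = hessm E v x"
  then have "smooth_near A x z \<and> vanishes_to_order_3 A x (\<lambda>y. z y - u y) \<longleftrightarrow>
      smooth_near A x z \<and> vanishes_to_order_3 A x (\<lambda>y. z y - v y)" for z
    using vanishes_diff_iff[OF x u, of z] vanishes_diff_iff[OF x v, of z] by auto
  then show "jet2 A x u = jet2 A x v" by (simp add: jet2_def)
qed

text \<open>The Hessian is tensorial, so only the coefficients of the fields at \<open>x\<close>
  matter. Hence changes of frame act on \<open>hessm\<close> by congruence, and conditions on
  arbitrary fields reduce to the matrix.\<close>

lemma Hess_frame:
  assumes M: "open M" "x \<in> M" "x \<in> N" and V: "vector_field_on A M V" and W: "vector_field_on A M W" and u: "smooth_near A x u"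
  shows "Hess A g u x V W = (\<Sum>a\<in>UNIV. \<Sum>b\<in>UNIV. fcoeff E V a x * fcoeff E W b x * hessm E u x $ a $ b)"
proof -
  let ?O = "M \<inter> N"
  have O: "open ?O" "x \<in> ?O" using M N by auto
  have fr: "orthonormal_frame_on A g ?O E" by (rule frame_subset[OF E]) auto
  have v: "vector_field_on A ?O V" "vector_field_on A ?O W" using vf_subset[OF V, of ?O] vf_subset[OF W, of ?O] by auto
  note e = frame_vf[OF O(1) fr]
  have s: "smooth_near A y (fcoeff E V a)" "smooth_near A y (fcoeff E W a)" if "y \<in> ?O" for y a
    using fcoeff_smooth[OF O(1) fr v(1) that] fcoeff_smooth[OF O(1) fr v(2) that] by blast+
  let ?V = "\<lambda>y h. \<Sum>a\<in>UNIV. fcoeff E V a y * E a y h" and ?W = "\<lambda>y h. \<Sum>a\<in>UNIV. fcoeff E W a y * E a y h"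
  have W': "vector_field_on A ?O ?W" by (rule vf_sum[OF O(1) e s(2)])
  have "Hess A g u x V W = Hess A g u x ?V ?W"
    by (rule Hess_cong[OF O v]) (rule ext, rule vf_expand[OF O(1) fr], use v in auto)+
  also have "\<dots> = (\<Sum>a\<in>UNIV. fcoeff E V a x * Hess A g u x (E a) ?W)"
    by (rule Hess_sum_left[OF O e W' s(1)])
  also have "\<dots> = (\<Sum>a\<in>UNIV. fcoeff E V a x * (\<Sum>b\<in>UNIV. fcoeff E W b x * Hess A g u x (E a) (E b)))"
    by (intro sum.cong refl arg_cong2[where f="(*)"] Hess_sum_right[OF O e e s(2) u])
  finally show ?thesis by (simp add: hessm_def sum_distrib_left mult.assoc)
qed

text \<open>The part \<open>l\<close>, affine in the coordinates, fixes value and gradient but may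
  have a Hessian of its own, coming from the connection. The quadratic part \<open>q\<close>
  corrects it and vanishes to first order.\<close>

lemma realize_jet:
  assumes x: "x \<in> N" and H: "H \<in> Sym"
  obtains u where "smooth_near A x u" "u x = r" "gradm E u x = \<xi>" "hessm E u x = H"
proof -
  obtain U \<phi> where U: "(U, \<phi>) \<in> A" "x \<in> U" by (rule chart_cover)
  \<comment> \<open>Combinations of coordinates that are dual to the frame at \<open>x\<close>: by
    \<open>Ep\<close> the derivative of \<open>p a\<close> along \<open>E c\<close> is 1 for
    \<open>c = a\<close> and 0 otherwise.\<close>
  define p where "p a y = (\<Sum>i\<in>UNIV. g x (cvec U \<phi> i x) (E a x) * (\<phi> y $ i - \<phi> x $ i))" for a y
  have s1: "smooth_near A x (\<lambda>y. \<phi> y $ i - \<phi> x $ i)" for i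
    by (rule smooth_near_minus[OF smooth_near_coord[OF U] smooth_near_const])
  have ps: "smooth_near A x (p a)" for a
    unfolding p_def[abs_def] by (intro smooth_near_sum smooth_near_scale s1)
  have px: "p a x = 0" for a by (simp add: p_def)
  have Ep: "E c x (p a) = (if c = a then 1 else 0)" for c a
  proof -
    note t = frame_tangent[OF N E x, of c]
    have "E c x (p a) = (\<Sum>i\<in>UNIV. E c x (\<lambda>y. g x (cvec U \<phi> i x) (E a x) * (\<phi> y $ i - \<phi> x $ i)))"
      unfolding p_def[abs_def] by (rule tangent_sum[OF t]) (intro smooth_near_scale s1)
    also have "\<dots> = (\<Sum>i\<in>UNIV. E c x (\<lambda>y. \<phi> y $ i) * g x (cvec U \<phi> i x) (E a x))"
      using tangent_minus[OF t smooth_near_coord[OF U] smooth_near_const] tangent_const[OF t]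
      by (intro sum.cong refl) (simp add: tangent_scale[OF t s1])
    also have "\<dots> = g x (\<lambda>f. \<Sum>i\<in>UNIV. E c x (\<lambda>y. \<phi> y $ i) * cvec U \<phi> i x f) (E a x)"
      by (rule g_sum[symmetric]) (rule cvec_tangent[OF U], rule frame_tangent[OF N E x])
    also have "(\<lambda>f. \<Sum>i\<in>UNIV. E c x (\<lambda>y. \<phi> y $ i) * cvec U \<phi> i x f) = E c x"
      by (rule ext) (rule tangent_expand[OF U t, symmetric])
    also have "g x (E c x) (E a x) = (if c = a then 1 else 0)" by (rule frame_on[OF N E x])
    finally show ?thesis .
  qed
  define l where "l y = r + (\<Sum>a\<in>UNIV. \<xi> $ a * p a y)" for y
  have ls: "smooth_near A x l"
    unfolding l_def[abs_def] by (intro smooth_near_add smooth_near_const smooth_near_sum smooth_near_scale ps)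
  \<comment> \<open>The factor 1/2 compensates that the product of \<open>p a\<close> and
    \<open>p b\<close> contributes to the Hessian entries at (a, b) and at (b, a).\<close>
  define K where "K = (1/2) *\<^sub>R (H - hessm E l x)"
  have K: "K $ a $ b = K $ b $ a" for a b
    using H hessm_Sym[OF x ls] by (simp add: K_def mem_Sym)
  define q where "q y = (\<Sum>a\<in>UNIV. 1 * (\<Sum>b\<in>UNIV. K $ a $ b * (p a y * p b y)))" for y
  have pps: "smooth_near A x (\<lambda>y. p a y * p b y)" for a b by (rule smooth_near_mult[OF ps ps])
  have qs1: "smooth_near A x (\<lambda>y. \<Sum>b\<in>UNIV. K $ a $ b * (p a y * p b y))" for a
    by (intro smooth_near_sum smooth_near_scale pps)
  have qs: "smooth_near A x q"
    unfolding q_def[abs_def] by (intro smooth_near_sum smooth_near_scale pps)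
  have Eq: "E c x q = 0" for c
  proof -
    note t = frame_tangent[OF N E x, of c]
    have "E c x q = (\<Sum>a\<in>UNIV. E c x (\<lambda>y. 1 * (\<Sum>b\<in>UNIV. K $ a $ b * (p a y * p b y))))"
      unfolding q_def[abs_def] by (rule tangent_sum[OF t]) (intro smooth_near_scale qs1)
    also have "\<dots> = (\<Sum>a\<in>UNIV. \<Sum>b\<in>UNIV. K $ a $ b * E c x (\<lambda>y. p a y * p b y))"
      using tangent_sum[OF t, of UNIV "\<lambda>b y. K $ a $ b * (p a y * p b y)" for a] smooth_near_scale[OF pps]
      by (simp add: tangent_scale[OF t pps])
    also have "\<dots> = 0" by (simp add: tangent_zero_product[OF t ps ps px px])
    finally show ?thesis .
  qed
  note He = frame_vf[OF N E]
  have El: "E c x l = \<xi> $ c" for c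
  proof -
    note t = frame_tangent[OF N E x, of c]
    have s: "smooth_near A x (\<lambda>y. \<Sum>a\<in>UNIV. \<xi> $ a * p a y)" by (intro smooth_near_sum smooth_near_scale ps)
    have "E c x l = E c x (\<lambda>y. \<Sum>a\<in>UNIV. \<xi> $ a * p a y)"
      unfolding l_def[abs_def] using tangent_add[OF t smooth_near_const s, of r] tangent_const[OF t] by simp
    also have "\<dots> = (\<Sum>a\<in>UNIV. E c x (\<lambda>y. \<xi> $ a * p a y))"
      by (rule tangent_sum[OF t]) (intro smooth_near_scale ps)
    also have "\<dots> = (\<Sum>a\<in>UNIV. if c = a then \<xi> $ a else 0)"
      by (intro sum.cong refl) (simp add: tangent_scale[OF t ps] Ep)
    finally show ?thesis by simp
  qed
  have Hq: "hessm E q x = H - hessm E l x"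
  proof -
    have "hessm E q x $ c $ d = (H - hessm E l x) $ c $ d" for c d
    proof -
      have "Hess A g (\<lambda>y. p a y * p b y) x (E c) (E d) = (if c = a then 1 else 0) * (if d = b then 1 else 0) +
         (if c = b then 1 else 0) * (if d = a then 1 else 0)" for a b
        unfolding Hess_mult_vanishing[OF N x He He ps px ps px] Ep ..
      then have pp: "Hess A g (\<lambda>y. p a y * p b y) x (E c) (E d) =
         (if b = d then if a = c then 1 else 0 else 0) + (if b = c then if a = d then 1 else 0 else 0)" for a b
        by (simp add: eq_commute)
      have "Hess A g q x (E c) (E d) = (\<Sum>a\<in>UNIV. 1 * Hess A g (\<lambda>y. \<Sum>b\<in>UNIV. K $ a $ b * (p a y * p b y)) x (E c) (E d))"
        unfolding q_def[abs_def] by (rule Hess_sum[OF N x He He qs1])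
      also have "\<dots> = (\<Sum>a\<in>UNIV. 1 * (\<Sum>b\<in>UNIV. K $ a $ b * Hess A g (\<lambda>y. p a y * p b y) x (E c) (E d)))"
        by (intro sum.cong refl arg_cong2[where f="(*)"] Hess_sum[OF N x He He pps])
      also have "\<dots> = K $ c $ d + K $ d $ c"
        unfolding pp
        by (simp add: distrib_left sum.distrib if_distrib[where f="\<lambda>x. _ * x"] cong: if_cong)
      also have "\<dots> = (H - hessm E l x) $ c $ d" unfolding K[of d c] by (simp add: K_def)
      finally show ?thesis unfolding hessm_def[of E q x] by simp
    qed
    then show ?thesis by (simp add: vec_eq_iff)
  qed
  show ?thesis
  proof (rule that[of "\<lambda>y. 1 * l y + 1 * q y"])
    show "smooth_near A x (\<lambda>y. 1 * l y + 1 * q y)" by (intro smooth_near_add smooth_near_scale ls qs)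
    show "1 * l x + 1 * q x = r" by (simp add: l_def q_def px)
    show "gradm E (\<lambda>y. 1 * l y + 1 * q y) x = \<xi>"
      unfolding gradm_lincomb[OF x ls qs] by (simp add: gradm_def vec_eq_iff El Eq)
    show "hessm E (\<lambda>y. 1 * l y + 1 * q y) x = H"
      unfolding hessm_lincomb[OF x ls qs] by (simp add: Hq)
  qed
qed

end

end

section \<open>The jet topology and subequations given by matrix sets\<close>

context riemannian
begin

section \<open>Neighbourhoods of jets in frame coordinates\<close>

definition frame_jets :: "('k \<Rightarrow> 'm field) \<Rightarrow> 'm set \<Rightarrow> ('m \<times> real \<times> (real ^ 'k) \<times> (real ^ 'k ^ 'k)) set \<Rightarrow> 'm jet set" where
  "frame_jets E N R = {jet2 A x u |x u. x \<in> N \<and> smooth_near A x u \<and> (x, u x, gradm E u x, hessm E u x) \<in> R}"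

lemma jet2_base: "jet2 A x u = jet2 A y v \<Longrightarrow> x = y"
  by (simp add: jet2_def)

lemma openin_chart_jets:
  assumes "(U, \<phi>) \<in> A" "open Q"
  shows "openin (jet_topology A) {jet2 A x u |x u. x \<in> U \<and> smooth_near A x u \<and> (\<phi> x, jet_coords (U, \<phi>) x u) \<in> Q}"
  unfolding jet_topology_def by (rule topology_generated_by_Basis) (use assms in blast)

context
  fixes N E assumes N: "open N" and E: "orthonormal_frame_on A g N E"
begin

lemma mem_frame_jets:
  assumes "x \<in> N" "smooth_near A x u"
  shows "jet2 A x u \<in> frame_jets E N R \<longleftrightarrow> (x, u x, gradm E u x, hessm E u x) \<in> R"
proof
  assume "jet2 A x u \<in> frame_jets E N R"
  then obtain y v where v: "jet2 A x u = jet2 A y v" "smooth_near A y v" "(y, v y, gradm E v y, hessm E v y) \<in> R"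
    unfolding frame_jets_def by blast
  have y: "y = x" using jet2_base[OF v(1)] by simp
  show "(x, u x, gradm E u x, hessm E u x) \<in> R"
    using jet2_eq_iff[OF N E assms(1,2), of v] v unfolding y by simp
qed (use assms in \<open>auto simp: frame_jets_def\<close>)

text \<open>In each chart the passage from coordinates to frame data is continuous, so the preimage
  of \<open>R\<close> is open; \<open>frame_jets E N R\<close> is the union of the corresponding
  basic sets over the atlas.\<close>

lemma open_frame_jets:
  assumes R: "open R"
  shows "openin (jet_topology A) (frame_jets E N R)"
proof -
  \<comment> \<open>The condition on \<open>a\<close> forces the base point into \<open>N\<close>,
    since charts are injective.\<close>
  define Q where "Q U \<phi> = {(a, d). a \<in> \<phi> ` (U \<inter> N) \<and>
     (inv_into U \<phi> a, coords_to_frame U \<phi> E (inv_into U \<phi> a, d)) \<in> R}" for U and \<phi> :: "'m \<Rightarrow> real ^ 'k"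
  define G where "G c = (case c of (U, \<phi>) \<Rightarrow>
     {jet2 A x u |x u. x \<in> U \<and> smooth_near A x u \<and> (\<phi> x, jet_coords (U, \<phi>) x u) \<in> Q U \<phi>})" for c
  have Q: "open (Q U \<phi>)" if U: "(U, \<phi>) \<in> A" for U \<phi>
  proof -
    let ?S = "\<phi> ` (U \<inter> N) \<times> (UNIV :: (real \<times> (real ^ 'k) \<times> (real ^ 'k ^ 'k)) set)"
    let ?\<psi> = "inv_into U \<phi>"
    have oS: "open ?S" using chart_open_image[OF U, of "U \<inter> N"] chart_open[OF U] N by (simp add: open_Times open_Int)
    have c1: "continuous_on ?S (\<lambda>p. ?\<psi> (fst p))"
      by (rule continuous_on_compose2[OF chart_continuous(2)[OF U]]) (auto intro: continuous_intros)
    have c2: "continuous_on ?S (\<lambda>p. coords_to_frame U \<phi> E (?\<psi> (fst p), snd p))"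
      by (rule continuous_on_compose2[OF continuous_coords_to_frame[OF N E U]])
         (use c1 in \<open>auto intro!: continuous_intros simp: chart_inverse[OF U]\<close>)
    have "continuous_on ?S (\<lambda>p. (?\<psi> (fst p), coords_to_frame U \<phi> E (?\<psi> (fst p), snd p)))"
      by (rule continuous_on_Pair[OF c1 c2])
    from continuous_open_preimage[OF this oS R]
    have "open (?S \<inter> (\<lambda>p. (?\<psi> (fst p), coords_to_frame U \<phi> E (?\<psi> (fst p), snd p))) -` R)" .
    also have "?S \<inter> (\<lambda>p. (?\<psi> (fst p), coords_to_frame U \<phi> E (?\<psi> (fst p), snd p))) -` R = Q U \<phi>"
      by (auto simp: Q_def)
    finally show ?thesis .
  qed
  have "frame_jets E N R = (\<Union>c\<in>A. G c)"
  proof (intro equalityI subsetI)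
    fix j assume "j \<in> frame_jets E N R"
    then obtain x u where j: "j = jet2 A x u" "x \<in> N" "smooth_near A x u" "(x, u x, gradm E u x, hessm E u x) \<in> R"
      unfolding frame_jets_def by blast
    obtain U \<phi> where U: "(U, \<phi>) \<in> A" "x \<in> U" by (rule chart_cover)
    have "(\<phi> x, jet_coords (U, \<phi>) x u) \<in> Q U \<phi>"
      using U j coords_to_frame[OF N E U(1,2) j(2,3)] by (auto simp: Q_def chart_inverse[OF U])
    then have "j \<in> G (U, \<phi>)" using j U by (auto simp: G_def)
    then show "j \<in> (\<Union>c\<in>A. G c)" using U by blast
  next
    fix j assume "j \<in> (\<Union>c\<in>A. G c)"
    then obtain U \<phi> where U: "(U, \<phi>) \<in> A" and "j \<in> G (U, \<phi>)" by auto
    then obtain x u where j: "j = jet2 A x u" "x \<in> U" "smooth_near A x u" "(\<phi> x, jet_coords (U, \<phi>) x u) \<in> Q U \<phi>"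
      by (auto simp: G_def)
    then obtain y where y: "y \<in> U" "y \<in> N" "\<phi> x = \<phi> y" by (auto simp: Q_def)
    then have "x \<in> N" using chart_inj[OF U] j(2) by (metis inj_onD)
    then have "(x, u x, gradm E u x, hessm E u x) \<in> R"
      using j coords_to_frame[OF N E U j(2) _ j(3)] by (auto simp: Q_def chart_inverse[OF U])
    then show "j \<in> frame_jets E N R"
      using j(1) mem_frame_jets[OF \<open>x \<in> N\<close> j(3)] by simp
  qed
  moreover have "openin (jet_topology A) (G c)" if "c \<in> A" for c
    using openin_chart_jets[OF _ Q] that by (cases c) (auto simp: G_def)
  ultimately show ?thesis by auto
qed

text \<open>The counterpart of \<open>open_frame_jets\<close>: at basic sets it uses the continuous
  passage from frame data to charts, and induction over the generated topology does the rest.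
  Together the two lemmas describe the bundle topology over \<open>N\<close> by frame data.\<close>

lemma frame_jets_nhd:
  assumes S: "openin (jet_topology A) S"
    and j: "jet2 A x u \<in> S" "x \<in> N" "smooth_near A x u"
  obtains R where "open R" "(x, u x, gradm E u x, hessm E u x) \<in> R" "frame_jets E N R \<subseteq> S"
proof -
  let ?B = "{{jet2 A x u |x u. x \<in> U \<and> smooth_near A x u \<and> (\<phi> x, jet_coords (U, \<phi>) x u) \<in> Q} |U \<phi> Q.
        (U, \<phi>) \<in> A \<and> open Q}"
  have "generate_topology_on ?B S"
    using S by (simp add: jet_topology_def openin_topology_generated_by_iff)
  then have "jet2 A x u \<in> S \<longrightarrow>
    (\<exists>R. open R \<and> (x, u x, gradm E u x, hessm E u x) \<in> R \<and> frame_jets E N R \<subseteq> S)"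
  proof (induction S rule: generate_topology_on.induct)
    case Empty
    then show ?case by simp
  next
    case (Int S T)
    show ?case
    proof
      assume "jet2 A x u \<in> S \<inter> T"
      then obtain R R' where R: "open R" "(x, u x, gradm E u x, hessm E u x) \<in> R" "frame_jets E N R \<subseteq> S"
        "open R'" "(x, u x, gradm E u x, hessm E u x) \<in> R'" "frame_jets E N R' \<subseteq> T"
        using Int.IH by auto
      have "frame_jets E N (R \<inter> R') \<subseteq> S \<inter> T"
        using R(3,6) unfolding frame_jets_def by blast
      then show "\<exists>R. open R \<and> (x, u x, gradm E u x, hessm E u x) \<in> R \<and> frame_jets E N R \<subseteq> S \<inter> T"
        using R by (intro exI[of _ "R \<inter> R'"]) auto
    qed
  next
    case (UN K)
    show ?case
    proof
      assume "jet2 A x u \<in> \<Union>K"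
      then obtain k where k: "k \<in> K" "jet2 A x u \<in> k" by blast
      then obtain R where "open R" "(x, u x, gradm E u x, hessm E u x) \<in> R" "frame_jets E N R \<subseteq> k"
        using UN.IH by blast
      with k show "\<exists>R. open R \<and> (x, u x, gradm E u x, hessm E u x) \<in> R \<and> frame_jets E N R \<subseteq> \<Union>K"
        by (intro exI[of _ R]) auto
    qed
  next
    case (Basis S)
    then obtain U \<phi> Q where U: "(U, \<phi>) \<in> A" and Q: "open Q"
      and S: "S = {jet2 A x u |x u. x \<in> U \<and> smooth_near A x u \<and> (\<phi> x, jet_coords (U, \<phi>) x u) \<in> Q}" by blast
    show ?case
    proof
      assume "jet2 A x u \<in> S"
      then obtain y v where v: "jet2 A x u = jet2 A y v" "y \<in> U" "smooth_near A y v" "(\<phi> y, jet_coords (U, \<phi>) y v) \<in> Q"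
        unfolding S by blast
      have y: "y = x" using jet2_base[OF v(1)] by simp
      note v = v[unfolded y]
      let ?S = "(U \<inter> N) \<times> (UNIV :: (real \<times> (real ^ 'k) \<times> (real ^ 'k ^ 'k)) set)"
      define R where "R = {(y, d). y \<in> U \<inter> N \<and> (\<phi> y, frame_to_coords U \<phi> E (y, d)) \<in> Q}"
      have oS: "open ?S" using chart_open[OF U] N by (simp add: open_Times open_Int)
      have c1: "continuous_on ?S (\<lambda>p. \<phi> (fst p))"
        by (rule continuous_on_compose2[OF chart_continuous(1)[OF U]]) (auto intro: continuous_intros)
      have "continuous_on ?S (\<lambda>p. (\<phi> (fst p), frame_to_coords U \<phi> E p))"
        by (rule continuous_on_Pair[OF c1 continuous_frame_to_coords[OF N E U]])
      from continuous_open_preimage[OF this oS Q]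
      have "open (?S \<inter> (\<lambda>p. (\<phi> (fst p), frame_to_coords U \<phi> E p)) -` Q)" .
      also have "?S \<inter> (\<lambda>p. (\<phi> (fst p), frame_to_coords U \<phi> E p)) -` Q = R"
        by (auto simp: R_def)
      finally have "open R" .
      moreover have "(x, u x, gradm E u x, hessm E u x) \<in> R"
        using v frame_to_coords[OF N E U v(2) j(2) v(3)] jet2_eq_iff[OF N E j(2,3) v(3)] j(2) by (auto simp: R_def)
      moreover have "frame_jets E N R \<subseteq> S"
        unfolding frame_jets_def S R_def using frame_to_coords[OF N E U] by fastforce
      ultimately show "\<exists>R. open R \<and> (x, u x, gradm E u x, hessm E u x) \<in> R \<and> frame_jets E N R \<subseteq> S" by blast
    qed
  qed
  then show ?thesis using that j(1) by blast
qed

end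

lemma topspace_jet_topology: "topspace (jet_topology A) = J2 A"
proof (intro equalityI subsetI)
  fix j assume "j \<in> topspace (jet_topology A)"
  then show "j \<in> J2 A" by (auto simp: jet_topology_def J2_def topology_generated_by_topspace)
next
  fix j assume "j \<in> J2 A"
  then obtain x u where j: "j = jet2 A x u" "smooth_near A x u" by (auto simp: J2_def)
  obtain N E where N: "open N" "x \<in> N" "orthonormal_frame_on A g N E" by (rule frame_exists)
  have "j \<in> frame_jets E N UNIV" using j N by (auto simp: frame_jets_def)
  then show "j \<in> topspace (jet_topology A)" using openin_subset[OF open_frame_jets[OF N(1,3) open_UNIV]] by blast
qed

section \<open>Subequations defined by sets of matrices\<close>

lemma psd_jet_P:
  assumes N: "open N" "orthonormal_frame_on A g N E" and x: "x \<in> N" and v: "smooth_near A x v" "jet2 A x v \<in> jet_P A g"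
  shows "psd (hessm E v x)"
  unfolding psd_def
proof
  fix c :: "real ^ 'k"
  obtain y w where w0: "jet2 A x v = jet2 A y w" "smooth_near A y w"
    "\<forall>W V. open W \<longrightarrow> y \<in> W \<longrightarrow> vector_field_on A W V \<longrightarrow> Hess A g w y V V \<ge> 0"
    using v(2) unfolding jet_P_def by (elim CollectE exE conjE) (rule that; assumption)
  have y: "y = x" using jet2_base[OF w0(1)] by simp
  note w = w0(1,2)[unfolded y] w0(3)[unfolded y, rule_format]
  have eq: "hessm E v x = hessm E w x" using jet2_eq_iff[OF N x v(1) w(2)] w(1) by simp
  \<comment> \<open>Constant coefficients turn the quadratic form of the Hessian matrix at
    \<open>c\<close> into the Hessian of a single field.\<close>
  let ?V = "\<lambda>y h. \<Sum>a\<in>UNIV. c $ a * E a y h"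
  have V: "vector_field_on A N ?V"
    by (rule vf_sum[OF N(1) frame_vf[OF N] smooth_near_const])
  have c: "fcoeff E ?V a x = c $ a" for a
    using g_sum[of UNIV "\<lambda>b. E b x" x "E a x" "\<lambda>b. c $ b", OF frame_tangent[OF N x] frame_tangent[OF N x]]
    by (simp add: fcoeff_def frame_on[OF N x] if_distrib[where f="\<lambda>x. _ * x"] cong: if_cong)
  have "c \<bullet> (hessm E w x *v c) = Hess A g w x ?V ?V"
    unfolding Hess_frame[OF N N(1) x x V V w(2)] c
    by (simp add: inner_vec_def matrix_vector_mult_def sum_distrib_left mult_ac)
  then show "0 \<le> c \<bullet> (hessm E v x *v c)" using w(3)[OF N(1) x V] eq by simp
qed

lemma zero_jet_N:
  assumes N: "open N" "orthonormal_frame_on A g N E" and x: "x \<in> N" and v: "smooth_near A x v" "jet2 A x v \<in> jet_N A g"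
  shows "hessm E v x = 0"
proof -
  obtain y w where w0: "jet2 A x v = jet2 A y w" "smooth_near A y w"
    "\<forall>W V V'. open W \<longrightarrow> y \<in> W \<longrightarrow> vector_field_on A W V \<longrightarrow> vector_field_on A W V' \<longrightarrow> Hess A g w y V V' = 0"
    using v(2) unfolding jet_N_def by (elim CollectE exE conjE) (rule that; assumption)
  have y: "y = x" using jet2_base[OF w0(1)] by simp
  note w = w0(1,2)[unfolded y] w0(3)[unfolded y, rule_format]
  have "hessm E v x = hessm E w x" using jet2_eq_iff[OF N x v(1) w(2)] w(1) by simp
  then show ?thesis using w(3)[OF N(1) x frame_vf[OF N] frame_vf[OF N]] by (simp add: hessm_def vec_eq_iff)
qed

text \<open>A closed set \<open>S\<close> of symmetric matrices that is stable under adding positive semidefinite ones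
  has \<open>H + \<epsilon>I\<close> in its interior for all \<open>H \<in> S\<close> and \<open>\<epsilon> > 0\<close>. Invariance of \<open>S\<close> under the frame
  changes of a covering family of frames transports this to the jet bundle.\<close>

lemma subequation_of_matrix_set:
  fixes \<F> :: "('m set \<times> ('k \<Rightarrow> 'm field)) set" and S :: "(real ^ 'k ^ 'k) set"
  assumes fr: "\<And>N E. (N, E) \<in> \<F> \<Longrightarrow> open N" "\<And>N E. (N, E) \<in> \<F> \<Longrightarrow> orthonormal_frame_on A g N E"
    and cover: "\<And>x. \<exists>(N, E)\<in>\<F>. x \<in> N"
    and inv: "\<And>N E N' E' x u. (N, E) \<in> \<F> \<Longrightarrow> (N', E') \<in> \<F> \<Longrightarrow> x \<in> N \<Longrightarrow> x \<in> N' \<Longrightarrow> smooth_near A x u \<Longrightarrow>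
        hessm E u x \<in> S \<Longrightarrow> hessm E' u x \<in> S"
    and closed: "closed S"
    and mono: "\<And>H K. H \<in> S \<Longrightarrow> K \<in> Sym \<Longrightarrow> psd (K - H) \<Longrightarrow> K \<in> S"
  defines "F \<equiv> {jet2 A x u |x u. smooth_near A x u \<and> (\<exists>(N, E)\<in>\<F>. x \<in> N \<and> hessm E u x \<in> S)}"
  shows "subequation A g F"
proof -
  let ?T = "jet_topology A"
  have mem: "jet2 A x u \<in> F \<longleftrightarrow> hessm E u x \<in> S"
    if NE: "(N, E) \<in> \<F>" and x: "x \<in> N" and u: "smooth_near A x u" for N E x u
  proof
    assume "jet2 A x u \<in> F"
    then obtain y v N' E' where v: "jet2 A x u = jet2 A y v" "smooth_near A y v" "(N', E') \<in> \<F>" "y \<in> N'" "hessm E' v y \<in> S"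
      unfolding F_def by blast
    have y: "y = x" using jet2_base[OF v(1)] by simp
    note v = v[unfolded y]
    have "hessm E v x \<in> S" by (rule inv[OF v(3) NE v(4) x v(2,5)])
    then show "hessm E u x \<in> S" using jet2_eq_iff[OF fr[OF NE] x u v(2)] v(1) by simp
  qed (use that in \<open>auto simp: F_def\<close>)
  have FJ: "F \<subseteq> J2 A" by (auto simp: F_def J2_def)
  have jet: "\<exists>x u N E. j = jet2 A x u \<and> smooth_near A x u \<and> (N, E) \<in> \<F> \<and> x \<in> N" if "j \<in> J2 A" for j
    using that cover unfolding J2_def by blast
  have open_cyl: "openin ?T (frame_jets E N (UNIV \<times> UNIV \<times> UNIV \<times> B))" if "(N, E) \<in> \<F>" "open B" for N E B
    by (rule open_frame_jets[OF fr[OF that(1)]]) (simp add: open_Times that(2))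
  have int_cyl: "jet2 A x u \<in> ?T interior_of F"
    if NE: "(N, E) \<in> \<F>" and x: "x \<in> N" and u: "smooth_near A x u" and B: "open B" "hessm E u x \<in> B" "B \<inter> Sym \<subseteq> S" for N E x u B
  proof -
    have "frame_jets E N (UNIV \<times> UNIV \<times> UNIV \<times> B) \<subseteq> F"
    proof
      fix j assume "j \<in> frame_jets E N (UNIV \<times> UNIV \<times> UNIV \<times> B)"
      then obtain y v where v: "j = jet2 A y v" "y \<in> N" "smooth_near A y v" "hessm E v y \<in> B"
        unfolding frame_jets_def by blast
      have "hessm E v y \<in> S" using hessm_Sym[OF fr[OF NE] v(2,3)] v(4) B(3) by blast
      then show "j \<in> F" using mem[OF NE v(2,3)] v(1) by simp
    qed
    moreover have "jet2 A x u \<in> frame_jets E N (UNIV \<times> UNIV \<times> UNIV \<times> B)"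
      using mem_frame_jets[OF fr[OF NE] x u] B(2) by simp
    ultimately show ?thesis using interior_of_maximal[OF _ open_cyl[OF NE B(1)]] by blast
  qed
  \<comment> \<open>Raising the Hessian by a small multiple of the identity, with value and gradient
    kept, moves a jet of \<open>F\<close> into the interior. The new jet has the same base point, so
    one approximation serves the closure in the bundle and in each fibre.\<close>
  have approx: "\<exists>v. smooth_near A x v \<and> jet2 A x v \<in> W \<and> jet2 A x v \<in> ?T interior_of F"
    if W: "openin ?T W" "jet2 A x u \<in> W" and u: "smooth_near A x u" and F: "jet2 A x u \<in> F" for W x u
  proof -
    obtain N E where NE: "(N, E) \<in> \<F>" "x \<in> N" using cover[of x] by blast
    note nf = fr[OF NE(1)]
    obtain R where R: "open R" "(x, u x, gradm E u x, hessm E u x) \<in> R" "frame_jets E N R \<subseteq> W"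
      by (rule frame_jets_nhd[OF nf W NE(2) u])
    let ?h = "\<lambda>e. (x, u x, gradm E u x, hessm E u x + e *\<^sub>R mat 1)"
    have "continuous_on UNIV ?h" by (intro continuous_intros)
    then have "open (?h -` R)" by (rule open_vimage[OF R(1)])
    moreover have "0 \<in> ?h -` R" using R(2) by simp
    ultimately obtain \<delta> where d: "\<delta> > 0" "ball 0 \<delta> \<subseteq> ?h -` R" by (meson open_contains_ball)
    define e where "e = \<delta> / 2"
    have e: "e > 0" "?h e \<in> R" using d by (auto simp: e_def dist_norm subset_iff)
    have me: "e *\<^sub>R mat 1 = (mat e :: real ^ 'k ^ 'k)" by (simp add: vec_eq_iff mat_def)
    let ?H = "hessm E u x" and ?K = "hessm E u x + mat e"
    have HS: "?H \<in> S" using mem[OF NE u] F by simp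
    have HSym: "?H \<in> Sym" by (rule hessm_Sym[OF nf NE(2) u])
    obtain v where v: "smooth_near A x v" "v x = u x" "gradm E v x = gradm E u x" "hessm E v x = ?K"
      using realize_jet[OF nf NE(2) Sym_add[OF HSym Sym_mat]] by metis
    have "jet2 A x v \<in> W" using R(3) mem_frame_jets[OF nf NE(2) v(1), of R] v e(2) by (auto simp: me)
    moreover have "jet2 A x v \<in> ?T interior_of F"
    proof (rule int_cyl[OF NE v(1) open_ball])
      show "hessm E v x \<in> ball ?K e" using v(4) e(1) by simp
      \<comment> \<open>For \<open>C\<close> in this ball, \<open>C - ?H\<close> is
        \<open>mat e\<close> plus a matrix of norm at most \<open>e\<close>, hence
        semidefinite.\<close>
      show "ball ?K e \<inter> Sym \<subseteq> S"
      proof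
        fix C assume C: "C \<in> ball ?K e \<inter> Sym"
        then have "norm (C - ?K) \<le> e" by (simp add: dist_norm norm_minus_commute)
        then have "psd (mat e + (C - ?K))" by (rule psd_mat_add)
        then show "C \<in> S" using C by (intro mono[OF HS]) auto
      qed
    qed
    ultimately show ?thesis using v(1) by blast
  qed
  \<comment> \<open>Membership in \<open>F\<close> depends on the frame Hessian alone, so the
    complement is a union of open cylinders over the complement of \<open>S\<close>.\<close>
  have closedF: "closedin ?T F"
    unfolding closedin_def topspace_jet_topology
  proof (intro conjI FJ)
    show "openin ?T (J2 A - F)"
    proof (subst openin_subopen, intro ballI)
      fix j assume j: "j \<in> J2 A - F"
      then obtain x u N E where u: "j = jet2 A x u" "smooth_near A x u" "(N, E) \<in> \<F>" "x \<in> N" using jet by blast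
      let ?W = "frame_jets E N (UNIV \<times> UNIV \<times> UNIV \<times> (- S))"
      have "j \<in> ?W" using j u mem[OF u(3,4,2)] by (auto simp: frame_jets_def)
      moreover have "?W \<subseteq> J2 A - F" using mem[OF u(3)] by (auto simp: frame_jets_def J2_def)
      ultimately show "\<exists>W. openin ?T W \<and> j \<in> W \<and> W \<subseteq> J2 A - F"
        using open_cyl[OF u(3), of "- S"] closed by (auto simp: open_Compl)
    qed
  qed
  have sumP: "jet_sum A F (jet_P A g) \<subseteq> F"
  proof
    fix j assume "j \<in> jet_sum A F (jet_P A g)"
    then obtain x u v where j: "j = jet2 A x (\<lambda>y. u y + v y)" "smooth_near A x u" "smooth_near A x v"
      "jet2 A x u \<in> F" "jet2 A x v \<in> jet_P A g" unfolding jet_sum_def by blast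
    obtain N E where NE: "(N, E) \<in> \<F>" "x \<in> N" using cover[of x] by blast
    note nf = fr[OF NE(1)]
    have s: "hessm E (\<lambda>y. u y + v y) x = hessm E u x + hessm E v x"
      using hessm_lincomb[OF nf NE(2) j(2,3), of 1 1] by simp
    have "hessm E (\<lambda>y. u y + v y) x \<in> S"
    proof (rule mono)
      show "hessm E u x \<in> S" using mem[OF NE j(2)] j(4) by simp
      show "hessm E (\<lambda>y. u y + v y) x \<in> Sym" by (rule hessm_Sym[OF nf NE(2) smooth_near_add[OF j(2,3)]])
      show "psd (hessm E (\<lambda>y. u y + v y) x - hessm E u x)" unfolding s using psd_jet_P[OF nf NE(2) j(3,5)] by simp
    qed
    then show "j \<in> F" using mem[OF NE smooth_near_add[OF j(2,3)]] j(1) by simp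
  qed
  have sumN: "jet_sum A F (jet_N A g) \<subseteq> F"
  proof
    fix j assume "j \<in> jet_sum A F (jet_N A g)"
    then obtain x u v where j: "j = jet2 A x (\<lambda>y. u y + v y)" "smooth_near A x u" "smooth_near A x v"
      "jet2 A x u \<in> F" "jet2 A x v \<in> jet_N A g" unfolding jet_sum_def by blast
    obtain N E where NE: "(N, E) \<in> \<F>" "x \<in> N" using cover[of x] by blast
    note nf = fr[OF NE(1)]
    have "hessm E (\<lambda>y. u y + v y) x = hessm E u x"
      using hessm_lincomb[OF nf NE(2) j(2,3), of 1 1] zero_jet_N[OF nf NE(2) j(3,5)] by simp
    then show "j \<in> F" using mem[OF NE smooth_near_add[OF j(2,3)]] mem[OF NE j(2)] j by simp
  qed
  have clF: "F = ?T closure_of (?T interior_of F)"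
  proof
    show "?T closure_of (?T interior_of F) \<subseteq> F"
      by (rule closure_of_minimal[OF interior_of_subset closedF])
    show "F \<subseteq> ?T closure_of (?T interior_of F)"
    proof
      fix j assume j: "j \<in> F"
      then obtain x u where u: "j = jet2 A x u" "smooth_near A x u" unfolding F_def by blast
      show "j \<in> ?T closure_of (?T interior_of F)"
        unfolding in_closure_of topspace_jet_topology using approx[OF _ _ u(2)] j u(1) FJ by blast
    qed
  qed
  have fibre: "jet_fibre F x = F \<inter> jet_fibre (J2 A) x" for x using FJ by (auto simp: jet_fibre_def)
  have fst: "fst (jet2 A x u) = x" for x u by (simp add: jet2_def)
  have mem_fibre: "jet2 A x u \<in> jet_fibre (J2 A) x" if "smooth_near A x u" for x u
    using that by (auto simp: jet_fibre_def J2_def fst)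
  have int_sub: "?T interior_of F \<inter> jet_fibre (J2 A) x \<subseteq> jet_fibre_topology A x interior_of jet_fibre F x" for x
  proof (rule interior_of_maximal)
    show "?T interior_of F \<inter> jet_fibre (J2 A) x \<subseteq> jet_fibre F x"
      unfolding fibre using interior_of_subset[of ?T F] by blast
    show "openin (jet_fibre_topology A x) (?T interior_of F \<inter> jet_fibre (J2 A) x)"
      unfolding jet_fibre_topology_def openin_subtopology by (blast intro: openin_interior_of)
  qed
  have clx: "jet_fibre F x = jet_fibre_topology A x closure_of (jet_fibre_topology A x interior_of jet_fibre F x)" for x
  proof
    have "closedin (jet_fibre_topology A x) (jet_fibre F x)"
      unfolding jet_fibre_topology_def closedin_subtopology fibre using closedF by blast
    then show "jet_fibre_topology A x closure_of (jet_fibre_topology A x interior_of jet_fibre F x) \<subseteq> jet_fibre F x"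
      by (rule closure_of_minimal[OF interior_of_subset])
    show "jet_fibre F x \<subseteq> jet_fibre_topology A x closure_of (jet_fibre_topology A x interior_of jet_fibre F x)"
    proof
      fix j assume j: "j \<in> jet_fibre F x"
      then obtain y u where u0: "j = jet2 A y u" "smooth_near A y u" "j \<in> F" "fst j = x"
        unfolding jet_fibre_def F_def by blast
      then have "y = x" by (simp add: fst)
      note u = u0[unfolded this]
      show "j \<in> jet_fibre_topology A x closure_of (jet_fibre_topology A x interior_of jet_fibre F x)"
        unfolding in_closure_of
      proof (intro conjI allI impI)
        show "j \<in> topspace (jet_fibre_topology A x)"
          using mem_fibre[OF u(2)] u(1) FJ u(3) by (auto simp: jet_fibre_topology_def topspace_jet_topology)
        fix W assume W: "j \<in> W \<and> openin (jet_fibre_topology A x) W"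
        then obtain W' where W': "openin ?T W'" "W = W' \<inter> jet_fibre (J2 A) x"
          unfolding jet_fibre_topology_def openin_subtopology by blast
        then obtain v where v: "smooth_near A x v" "jet2 A x v \<in> W'" "jet2 A x v \<in> ?T interior_of F"
          using approx[OF W'(1) _ u(2)] W u(1,3) by blast
        then show "\<exists>y. y \<in> jet_fibre_topology A x interior_of jet_fibre F x \<and> y \<in> W"
          using int_sub[of x] mem_fibre[OF v(1)] W'(2) by blast
      qed
    qed
  qed
  have intx: "jet_fibre_topology A x interior_of jet_fibre F x = jet_fibre (?T interior_of F) x" for x
  proof
    have "jet_fibre (?T interior_of F) x \<subseteq> ?T interior_of F \<inter> jet_fibre (J2 A) x"
      using FJ interior_of_subset[of ?T F] by (auto simp: jet_fibre_def)
    then show "jet_fibre (?T interior_of F) x \<subseteq> jet_fibre_topology A x interior_of jet_fibre F x"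
      using int_sub by blast
    show "jet_fibre_topology A x interior_of jet_fibre F x \<subseteq> jet_fibre (?T interior_of F) x"
    proof
      fix j assume "j \<in> jet_fibre_topology A x interior_of jet_fibre F x"
      then obtain W where W: "openin (jet_fibre_topology A x) W" "j \<in> W" "W \<subseteq> jet_fibre F x"
        unfolding interior_of_def by blast
      then obtain W' where W': "openin ?T W'" "W = W' \<inter> jet_fibre (J2 A) x"
        unfolding jet_fibre_topology_def openin_subtopology by blast
      have "j \<in> jet_fibre F x" using W by blast
      then obtain y u where u0: "j = jet2 A y u" "smooth_near A y u" "fst j = x"
        unfolding jet_fibre_def F_def by blast
      then have "y = x" by (simp add: fst)
      note u = u0[unfolded this]
      obtain N E where NE: "(N, E) \<in> \<F>" "x \<in> N" using cover[of x] by blast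
      note nf = fr[OF NE(1)]
      have "jet2 A x u \<in> W'" using W(2) W'(2) u(1) by blast
      then obtain R where R: "open R" "(x, u x, gradm E u x, hessm E u x) \<in> R" "frame_jets E N R \<subseteq> W'"
        using frame_jets_nhd[OF nf W'(1) _ NE(2) u(2)] by metis
      \<comment> \<open>Freezing value and gradient at those of \<open>u\<close> turns the
        neighbourhood in the fibre into an open set of Hessians. By \<open>realize_jet\<close> each
        symmetric matrix in it comes from a jet of the fibre and so lies in \<open>S\<close>; since
        \<open>F\<close> sees nothing but the Hessian, the whole open cylinder over \<open>B\<close>
        lies in \<open>F\<close>.\<close>
      define B where "B = (\<lambda>H. (x, u x, gradm E u x, H)) -` R"
      have oB: "open B" unfolding B_def by (rule open_vimage[OF R(1)]) (intro continuous_intros)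
      have "B \<inter> Sym \<subseteq> S"
      proof
        fix H assume H: "H \<in> B \<inter> Sym"
        then obtain v where v: "smooth_near A x v" "v x = u x" "gradm E v x = gradm E u x" "hessm E v x = H"
          using realize_jet[OF nf NE(2), of H "u x" "gradm E u x"] by blast
        have "jet2 A x v \<in> frame_jets E N R" using mem_frame_jets[OF nf NE(2) v(1)] v H by (simp add: B_def)
        then have "jet2 A x v \<in> W" using R(3) W'(2) mem_fibre[OF v(1)] by blast
        then have "jet2 A x v \<in> F" using W(3) by (auto simp: jet_fibre_def)
        then show "H \<in> S" using mem[OF NE v(1)] v(4) by simp
      qed
      then have "jet2 A x u \<in> ?T interior_of F"
        using int_cyl[OF NE u(2) oB] R(2) by (simp add: B_def)
      then show "j \<in> jet_fibre (?T interior_of F) x" using u by (simp add: jet_fibre_def)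
    qed
  qed
  show ?thesis
    unfolding subequation_def using FJ sumP sumN clF clx intx by (intro conjI allI)
qed

end

section \<open>The degenerate special Lagrangian subequation\<close>

context product_manifold
begin

lemma Hess_matrix_eq: "Hess_matrix A g e u p = R.hessm (bar_frame A e) u p"
  by (simp add: Hess_matrix_def R.hessm_def)

text \<open>The matrix of the frame change between two frames of the form \<open>(\<partial>\<^sub>t, e)\<close> is \<open>diag(1, Q)\<close>
  with \<open>Q\<close> orthogonal.\<close>

lemma bar_frame_change:
  assumes W: "open W" "orthonormal_frame_on A g W e" "snd p \<in> W"
    and W': "open W'" "orthonormal_frame_on A g W' e'" "snd p \<in> W'"
    and u: "smooth_near (product_atlas A) p u"
  shows "Theta_tilde (Hess_matrix A g e' u p) = Theta_tilde (Hess_matrix A g e u p)"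
proof -
  let ?e = "bar_frame A e" and ?e' = "bar_frame A e'" and ?G = "product_metric g"
  have o: "open ((UNIV :: real set) \<times> W)" "open ((UNIV :: real set) \<times> W')"
    using W W' by (simp_all add: open_Times)
  note f = bar_frame_orthonormal[OF W(1,2)] and f' = bar_frame_orthonormal[OF W'(1,2)]
  have p: "p \<in> UNIV \<times> W" "p \<in> UNIV \<times> W'" using W W' by (simp_all add: mem_Times_iff)
  note t = R.frame_tangent[OF o(1) f p(1)] R.frame_tangent[OF o(2) f' p(2)]
  define Q where "Q = (\<chi> k l. ?G p (?e' k p) (?e l p))"
  have Q: "Q ** transpose Q = mat 1"
    using R.g_expand[OF o(1) f p(1) t(2) t(2)] R.frame_on[OF o(2) f' p(2)]
    by (simp add: vec_eq_iff matrix_matrix_mult_def transpose_def Q_def mat_def)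
  \<comment> \<open>Both frames share their first field, so orthonormality makes the first row and
    the first column of \<open>Q\<close> those of the identity.\<close>
  have None: "?e None p = ?e' None p"
    by (cases p) (auto simp: bar_frame_def fun_eq_iff)
  have Q0: "Q $ k $ None = (if k = None then 1 else 0)" for k
    using R.frame_on[OF o(2) f' p(2), of k None] by (simp add: Q_def None)
  have Q1: "Q $ None $ k = (if k = None then 1 else 0)" for k
    using R.frame_on[OF o(1) f p(1), of None k] by (auto simp: Q_def None[symmetric])
  have "R.hessm ?e' u p = Q ** R.hessm ?e u p ** transpose Q"
  proof -
    have "R.hessm ?e' u p $ k $ l = (Q ** R.hessm ?e u p ** transpose Q) $ k $ l" for k l
    proof -
      have "R.hessm ?e' u p $ k $ l = (\<Sum>a\<in>UNIV. \<Sum>b\<in>UNIV. Q $ k $ a * Q $ l $ b * R.hessm ?e u p $ a $ b)"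
        using R.Hess_frame[OF o(1) f o(2) p(2,1) R.frame_vf[OF o(2) f'] R.frame_vf[OF o(2) f'] u, of k l]
        by (simp add: R.hessm_def R.fcoeff_def Q_def)
      also have "\<dots> = (\<Sum>b\<in>UNIV. \<Sum>a\<in>UNIV. Q $ k $ a * Q $ l $ b * R.hessm ?e u p $ a $ b)"
        by (rule sum.swap)
      also have "\<dots> = (Q ** R.hessm ?e u p ** transpose Q) $ k $ l"
        by (simp add: matrix_matrix_mult_def transpose_def sum_distrib_left sum_distrib_right mult_ac)
      finally show ?thesis .
    qed
    then show ?thesis by (simp add: vec_eq_iff)
  qed
  then show ?thesis
    unfolding Hess_matrix_eq using Theta_tilde_conj[OF R.hessm_Sym[OF o(1) f p(1) u] Q Q0 Q1] by simp
qed

lemma jet_invariance: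
  assumes u: "smooth_near (product_atlas A) p u" and v: "smooth_near (product_atlas A) p v"
    and uv: "jet2 (product_atlas A) p u = jet2 (product_atlas A) p v"
    and W: "open W" "snd p \<in> W" "orthonormal_frame_on A g W e"
  shows "Hess_matrix A g e u p = Hess_matrix A g e v p"
proof -
  have "open ((UNIV :: real set) \<times> W)" using W by (simp add: open_Times)
  moreover have "p \<in> UNIV \<times> W" using W by (simp add: mem_Times_iff)
  ultimately show ?thesis
    unfolding Hess_matrix_eq
    using R.jet2_eq_iff[OF _ bar_frame_orthonormal[OF W(1,3)] _ u v] uv by simp
qed

lemma DSL_subequation: "subequation (product_atlas A) (product_metric g) (DSL_subequation A g c)"
proof -
  define \<F> where "\<F> = {((UNIV :: real set) \<times> W, bar_frame A e) |W e. open W \<and> orthonormal_frame_on A g W e}"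
  define S where "S = {H \<in> Sym. c \<le> Theta_tilde (H :: real ^ 'n option ^ 'n option)}"
  have F: "\<exists>W e. N = UNIV \<times> W \<and> E = bar_frame A e \<and> open W \<and> orthonormal_frame_on A g W e" if "(N, E) \<in> \<F>" for N E
    using that by (auto simp: \<F>_def)
  have fr: "open N" "orthonormal_frame_on (product_atlas A) (product_metric g) N E" if "(N, E) \<in> \<F>" for N E
    using F[OF that] bar_frame_orthonormal by (auto simp: open_Times)
  have "subequation (product_atlas A) (product_metric g)
    {jet2 (product_atlas A) p u |p u. smooth_near (product_atlas A) p u \<and> (\<exists>(N, E)\<in>\<F>. p \<in> N \<and> R.hessm E u p \<in> S)}"
  proof (rule R.subequation_of_matrix_set[OF fr])
    fix p :: "real \<times> 'm"
    obtain W e where "open W" "snd p \<in> W" "orthonormal_frame_on A g W e" by (rule M.frame_exists)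
    then have "(UNIV \<times> W, bar_frame A e) \<in> \<F>" "p \<in> UNIV \<times> W"
      by (auto simp: \<F>_def mem_Times_iff)
    then show "\<exists>(N, E)\<in>\<F>. p \<in> N"
      by (intro bexI[of _ "(UNIV \<times> W, bar_frame A e)"]) auto
  next
    fix N E N' E' p u
    assume a: "(N, E) \<in> \<F>" "(N', E') \<in> \<F>" "p \<in> N" "p \<in> N'" "smooth_near (product_atlas A) p u" "R.hessm E u p \<in> S"
    obtain W e where W: "N = UNIV \<times> W" "E = bar_frame A e" "open W" "orthonormal_frame_on A g W e" using F[OF a(1)] by blast
    obtain W' e' where W': "N' = UNIV \<times> W'" "E' = bar_frame A e'" "open W'" "orthonormal_frame_on A g W' e'" using F[OF a(2)] by blast
    have "snd p \<in> W" "snd p \<in> W'" using a W W' by auto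
    from bar_frame_change[OF W(3,4) this(1) W'(3,4) this(2) a(5)]
    show "R.hessm E' u p \<in> S"
      using a(6) R.hessm_Sym[OF fr[OF a(2)] a(4,5)] by (simp add: S_def W(2) W'(2) Hess_matrix_eq)
  next
    show "closed S" unfolding S_def by (rule Theta_tilde_closed)
  next
    fix H K assume "H \<in> S" "K \<in> Sym" "psd (K - H)"
    then show "K \<in> S" using Theta_tilde_mono[of H K] by (auto simp: S_def)
  qed
  also have "{jet2 (product_atlas A) p u |p u. smooth_near (product_atlas A) p u \<and> (\<exists>(N, E)\<in>\<F>. p \<in> N \<and> R.hessm E u p \<in> S)} =
    DSL_subequation A g c"
  proof -
    have iff: "(\<exists>(N, E)\<in>\<F>. p \<in> N \<and> R.hessm E u p \<in> S) \<longleftrightarrow>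
      (\<exists>W e. open W \<and> snd p \<in> W \<and> orthonormal_frame_on A g W e \<and> Theta_tilde (Hess_matrix A g e u p) \<ge> c)"
      if u: "smooth_near (product_atlas A) p u" for p u
    proof
      assume "\<exists>(N, E)\<in>\<F>. p \<in> N \<and> R.hessm E u p \<in> S"
      then obtain N E where NE: "(N, E) \<in> \<F>" "p \<in> N" "R.hessm E u p \<in> S" by blast
      from F[OF NE(1)] obtain W e where "N = UNIV \<times> W" "E = bar_frame A e" "open W" "orthonormal_frame_on A g W e" by blast
      with NE(2,3) show "\<exists>W e. open W \<and> snd p \<in> W \<and> orthonormal_frame_on A g W e \<and> Theta_tilde (Hess_matrix A g e u p) \<ge> c"
        by (intro exI[of _ W] exI[of _ e]) (auto simp: Hess_matrix_eq S_def)
    next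
      assume "\<exists>W e. open W \<and> snd p \<in> W \<and> orthonormal_frame_on A g W e \<and> Theta_tilde (Hess_matrix A g e u p) \<ge> c"
      then obtain W e where W: "open W" "snd p \<in> W" "orthonormal_frame_on A g W e" "Theta_tilde (Hess_matrix A g e u p) \<ge> c" by blast
      then have NE: "(UNIV \<times> W, bar_frame A e) \<in> \<F>" "p \<in> UNIV \<times> W" by (auto simp: \<F>_def mem_Times_iff)
      have "R.hessm (bar_frame A e) u p \<in> S"
        using R.hessm_Sym[OF fr[OF NE(1)] NE(2) u] W(4) by (simp add: S_def Hess_matrix_eq)
      with NE show "\<exists>(N, E)\<in>\<F>. p \<in> N \<and> R.hessm E u p \<in> S"
        by (intro bexI[of _ "(UNIV \<times> W, bar_frame A e)"]) auto
    qed
    show ?thesis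
      unfolding DSL_subequation_def by (intro Collect_cong ex_cong1 conj_cong refl iff)
  qed
  finally show ?thesis .
qed

end

theorem proposition1p1p1:
  fixes A :: "('m::{t2_space,second_countable_topology}, 'n::finite) chart set"
    and g :: "'m metric"
    and c :: real
  assumes "riemannian_manifold A g"
    and "- (real (CARD('n) + 1) * pi / 2) < c"
    and "c < real (CARD('n) + 1) * pi / 2"
  shows "(\<forall>p u v W W' e e'.
            smooth_near (product_atlas A) p u \<longrightarrow> smooth_near (product_atlas A) p v \<longrightarrow>
            jet2 (product_atlas A) p u = jet2 (product_atlas A) p v \<longrightarrow>
            open W \<longrightarrow> snd p \<in> W \<longrightarrow> orthonormal_frame_on A g W e \<longrightarrow>
            open W' \<longrightarrow> snd p \<in> W' \<longrightarrow> orthonormal_frame_on A g W' e' \<longrightarrow>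
            (Theta_tilde (Hess_matrix A g e u p) \<ge> c \<longleftrightarrow>
             Theta_tilde (Hess_matrix A g e' v p) \<ge> c)) \<and>
         subequation (product_atlas A) (product_metric g) (DSL_subequation A g c)"
proof -
  interpret product_manifold A g
  proof unfold_locales
    show "smooth_atlas A" "riemannian_metric A g" using assms(1) by (simp_all add: riemannian_manifold_def)
  qed
  show ?thesis
  proof (intro conjI allI impI DSL_subequation)
    fix p u v W W' e e'
    assume u: "smooth_near (product_atlas A) p u" and v: "smooth_near (product_atlas A) p v"
      and uv: "jet2 (product_atlas A) p u = jet2 (product_atlas A) p v"
      and W: "open W" "snd p \<in> W" "orthonormal_frame_on A g W e"
      and W': "open W'" "snd p \<in> W'" "orthonormal_frame_on A g W' e'"
    \<comment> \<open>From \<open>u\<close> to \<open>v\<close> in the frame \<open>e\<close>, then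
      from \<open>e\<close> to \<open>e'\<close> for the function \<open>v\<close>.\<close>
    show "Theta_tilde (Hess_matrix A g e u p) \<ge> c \<longleftrightarrow> Theta_tilde (Hess_matrix A g e' v p) \<ge> c"
      using jet_invariance[OF u v uv W] bar_frame_change[OF W(1,3,2) W'(1,3,2) v] by simp
  qed
qed

end
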